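(* Let $d\ge 1$, let $r\in(0,+\infty)$, let $U\subset\mathbb{R}^d$ be a nonempty open convex set, and let $F:U\to\mathbb{R}$ be a $C^2$ strictly convex function such that $\nabla^2F(x)$ is symmetric positive definite for every $x\in U$. For a probability distribution $P$ on $\mathbb{R}^d$ with $P(U)=1$, let $h=\frac{\mathrm{d}P^a}{\mathrm{d}\lambda_d}$ denote the density of the absolutely continuous part $P^a$ of $P$ with respect to the Lebesgue measure $\lambda_d$ on $\mathbb{R}^d$, and set $$Q_r(\phi_F,P)=2^{-r/2}\,Q_r([0,1]^d)\,\big\|\det(\nabla^2F)^{\frac{r}{2d}}\cdot h\big\|_{L^{\frac{d}{d+r}}(\lambda_d)}.$$ (a) (Asymptotic sharp rate) Let $P$ be a probability distribution with $P(U)=1$ such that $$\int_U\big(|\xi|^{2(1+\delta)}\vee|F(\xi)|\big)^{\frac r2}P(\mathrm{d}\xi)<+\infty\quad\text{for some }\delta>0.$$ Assume that at least one of the following holds: (i) $\mathrm{supp}(P)$ is compact and included in $U$; (ii) there exists $\eta\ge 0$ such that $\mathrm{supp}_U(P)\subset U_\eta$ and $\sup_{x\in U_\eta}\|\nabla^2F(x)\|_{\mathrm{op}}<+\infty$. Then $$\lim_{n\to+\infty}n^{\frac1d}\,e_{r,n}(P,\phi_F)=Q_r(\phi_F,P)^{\frac1r}.$$ (b) (Universal lower bound) For any probability distribution $P$ with $P(U)=1$, $$\liminf_{n\to+\infty}n^{\frac1d}\,e_{r,n}(P,\phi_F)\ge Q_r(\phi_F,P)^{\frac1r}.$$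
   Context: $|\cdot|$ is the canonical Euclidean norm on $\mathbb{R}^d$, $\langle\cdot\,|\,\cdot\rangle$ the canonical inner product, $\|\cdot\|_{\mathrm{op}}$ the associated operator norm on matrices, and $a\vee b=\max(a,b)$. Bregman divergence: for $\xi,x\in U$, $\phi_F(\xi,x)=F(\xi)-F(x)-\langle\nabla F(x)\,|\,\xi-x\rangle\ge 0$. Quantization errors: for a finite nonempty set $\Gamma\subset U$, $e_r(\Gamma,P,\phi_F)=\big[\int_U\min_{a\in\Gamma}\phi_F(\xi,a)^{r/2}P(\mathrm{d}\xi)\big]^{1/r}$, and for $n\ge1$, $e_{r,n}(P,\phi_F)=\inf\{e_r(\Gamma,P,\phi_F):\Gamma\subset U,\ 1\le|\Gamma|\le n\}$ (where $|\Gamma|$ is the cardinality of $\Gamma$). Constant $Q_r([0,1]^d)$: $Q_r([0,1]^d)=\inf_{n\ge1}n^{r/d}\inf_{\Gamma\subset\mathbb{R}^d,\,1\le|\Gamma|\le n}\int_{[0,1]^d}\min_{a\in\Gamma}|\xi-a|^r\,\mathrm{d}\xi$. By the classical theorem of Zador this infimum is also the limit as $n\to+\infty$ and lies in $(0,+\infty)$. For $s>0$ (possibly $s<1$) and measurable $g\ge0$, $\|g\|_{L^s(\lambda_d)}=\big(\int g^s\,\mathrm{d}\lambda_d\big)^{1/s}\in[0,+\infty]$; here the integral is over $U$, since $h$ vanishes $\lambda_d$-a.e. outside $U$. For $\eta>0$, $U_\eta=\{x\in U: d(x,U^c)>\eta\}$, where $d(x,U^c)$ is the Euclidean distance from $x$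 to $U^c=\mathbb{R}^d\setminus U$ (equal to $+\infty$ if $U=\mathbb{R}^d$), and by convention $U_0=U$. $\mathrm{supp}(P)$ is the support of $P$ in $\mathbb{R}^d$ and $\mathrm{supp}_U(P)$ is the support of $P$ viewed as a distribution on $U$ (i.e. $\mathrm{supp}(P)\cap U$). *)

theory Defs
  imports "HOL-Analysis.Analysis" "HOL-Probability.Probability_Measure"
begin

section \<open>Differential calculus\<close>

definition grad :: "((real^'n) \<Rightarrow> real) \<Rightarrow> real^'n \<Rightarrow> real^'n" where
  "grad F x = (THE D. GDERIV F x :> D)"

definition hessian :: "((real^'n) \<Rightarrow> real) \<Rightarrow> real^'n \<Rightarrow> real^'n^'n" where
  "hessian F x = jacobian (grad F) (at x)"

text \<open>Intended for open \<open>U\<close>. The function \<open>F\<close> is total in HOL, but only its values on \<open>U\<close>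
  matter here and below, since \<open>grad\<close> and \<open>hessian\<close> are local.\<close>
definition C2_on :: "(real^'n) set \<Rightarrow> ((real^'n) \<Rightarrow> real) \<Rightarrow> bool" where
  "C2_on U F \<longleftrightarrow>
     (\<forall>x\<in>U. F differentiable (at x)) \<and>
     (\<forall>x\<in>U. grad F differentiable (at x)) \<and>
     continuous_on U (hessian F)"

definition strictly_convex_on :: "'a::real_vector set \<Rightarrow> ('a \<Rightarrow> real) \<Rightarrow> bool" where
  "strictly_convex_on S f \<longleftrightarrow> convex S \<and>
     (\<forall>x\<in>S. \<forall>y\<in>S. \<forall>t. x \<noteq> y \<longrightarrow> 0 < t \<longrightarrow> t < 1 \<longrightarrow>
        f ((1 - t) *\<^sub>R x + t *\<^sub>R y) < (1 - t) * f x + t * f y)"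

definition sym_pos_def :: "real^'n^'n \<Rightarrow> bool" where
  "sym_pos_def A \<longleftrightarrow> transpose A = A \<and> (\<forall>v. v \<noteq> 0 \<longrightarrow> 0 < v \<bullet> (A *v v))"

section \<open>Bregman divergence and quantization errors\<close>

definition bregman :: "((real^'n) \<Rightarrow> real) \<Rightarrow> real^'n \<Rightarrow> real^'n \<Rightarrow> real" where
  "bregman F \<xi> x = F \<xi> - F x - grad F x \<bullet> (\<xi> - x)"

text \<open>Powers of extended nonnegative reals, for exponents \<open>s > 0\<close> only.\<close>
definition ennreal_powr :: "ennreal \<Rightarrow> real \<Rightarrow> ennreal" where
  "ennreal_powr x s = (if x = top then top else ennreal (enn2real x powr s))"

definition quant_err ::
  "(real^'n) set \<Rightarrow> ((real^'n) \<Rightarrow> real) \<Rightarrow> real \<Rightarrow> (real^'n) measure \<Rightarrow> (real^'n) set \<Rightarrow> ennreal" where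
  "quant_err U F r P \<Gamma> =
     ennreal_powr
       (\<integral>\<^sup>+\<xi>\<in>U. ennreal (Min ((\<lambda>a. bregman F \<xi> a powr (r / 2)) ` \<Gamma>)) \<partial>P) (1 / r)"

definition opt_quant_err ::
  "(real^'n) set \<Rightarrow> ((real^'n) \<Rightarrow> real) \<Rightarrow> real \<Rightarrow> (real^'n) measure \<Rightarrow> nat \<Rightarrow> ennreal" where
  "opt_quant_err U F r P n =
     (INF \<Gamma>\<in>{\<Gamma>. \<Gamma> \<subseteq> U \<and> finite \<Gamma> \<and> 1 \<le> card \<Gamma> \<and> card \<Gamma> \<le> n}. quant_err U F r P \<Gamma>)"

text \<open>The constant \<open>Q\<^sub>r([0,1]\<^sup>d)\<close>, where \<open>d = CARD('n)\<close>.\<close>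
definition zador_const :: "'n::finite itself \<Rightarrow> real \<Rightarrow> ennreal" where
  "zador_const _ r =
     (INF n\<in>{1::nat..}. ennreal (real n powr (r / CARD('n))) *
        (INF \<Gamma>\<in>{\<Gamma> :: (real^'n) set. finite \<Gamma> \<and> 1 \<le> card \<Gamma> \<and> card \<Gamma> \<le> n}.
           \<integral>\<^sup>+\<xi>\<in>cbox 0 1. ennreal (Min ((\<lambda>a. norm (\<xi> - a) powr r) ` \<Gamma>)) \<partial>lborel))"

section \<open>Measure-theoretic notions\<close>

text \<open>\<open>h\<close> is (a version of) the density of the absolutely continuous part in the Lebesgue
  decomposition of \<open>P\<close> with respect to Lebesgue measure; \<open>S\<close> is the singular part. Such an \<open>h\<close>
  always exists, see \<open>ex_ac_density\<close>, and it is unique up to Lebesgue-null sets.\<close>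
definition ac_density :: "'a::euclidean_space measure \<Rightarrow> ('a \<Rightarrow> ennreal) \<Rightarrow> bool" where
  "ac_density P h \<longleftrightarrow> h \<in> borel_measurable borel \<and>
     (\<exists>S. sets S = sets borel \<and>
          (\<exists>N\<in>null_sets lborel. emeasure S (- N) = 0) \<and>
          (\<forall>A\<in>sets borel. emeasure P A = emeasure (density lborel h) A + emeasure S A))"

lemma ex_ac_density:
  fixes P :: "'a::euclidean_space measure"
  assumes fin: "finite_measure P" and sets_P: "sets P = sets borel"
  shows "\<exists>h. ac_density P h"
proof -
  interpret P: finite_measure P by fact
  note sets_P [measurable_cong]
  have space_P: "space P = UNIV"
    using sets_eq_imp_space_eq[OF sets_P] by simp
  let ?m = "SUP N\<in>null_sets lborel. emeasure P N"
  have ne: "null_sets (lborel :: 'a measure) \<noteq> {}" by (auto intro: exI[of _ "{}"])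
  obtain f where f: "range f \<subseteq> emeasure P ` null_sets lborel" "?m = (SUP i::nat. f i)"
    using ennreal_Sup_countable_SUP[of "emeasure P ` null_sets lborel"] ne by auto
  then have "\<forall>i. \<exists>N. N \<in> null_sets lborel \<and> f i = emeasure P N" by auto
  then obtain g where g: "\<And>i. g i \<in> null_sets lborel" "\<And>i. f i = emeasure P (g i)" by metis
  define N where "N = (\<Union>i. g i)"
  have N: "N \<in> null_sets lborel" unfolding N_def using g(1) by blast
  then have N_sets [measurable]: "N \<in> sets borel" by auto
  have sup: "?m \<le> emeasure P N"
    unfolding f(2) g(2) by (intro SUP_least emeasure_mono)
      (auto simp: sets_P N_def[symmetric], auto simp: N_def)
  define Q where "Q = density P (indicator (- N))"
  have Q: "emeasure Q A = emeasure P (A - N)" if "A \<in> sets borel" for A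
    using that unfolding Q_def
    by (subst emeasure_density)
      (auto simp: sets_P indicator_inter_arith[symmetric] Diff_eq Int_commute)
  have "absolutely_continuous lborel Q"
    unfolding absolutely_continuous_def
  proof
    fix A assume A: "A \<in> null_sets (lborel :: 'a measure)"
    then have [measurable]: "A \<in> sets borel" by auto
    have "emeasure P N + emeasure P (A - N) = emeasure P (A \<union> N)"
      by (subst plus_emeasure) (auto simp: sets_P Un_commute)
    also have "\<dots> \<le> ?m" using A N by (intro SUP_upper) auto
    also have "\<dots> \<le> emeasure P N + 0" using sup by simp
    finally have "emeasure P (A - N) = 0"
      by (metis ennreal_add_left_cancel_le P.emeasure_finite infinity_ennreal_def le_zero_eq)
    then show "A \<in> null_sets Q" by (auto simp: null_sets_def Q) (auto simp: Q_def sets_P)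
  qed
  moreover have "sets Q = sets lborel" by (simp add: Q_def sets_P)
  ultimately have D: "density lborel (RN_deriv lborel Q) = Q"
    by (rule sigma_finite_measure.density_RN_deriv[OF sigma_finite_lborel])
  define S where "S = density P (indicator N)"
  have S: "emeasure S A = emeasure P (A \<inter> N)" if "A \<in> sets borel" for A
    using that unfolding S_def
    by (subst emeasure_density)
      (auto simp: sets_P indicator_inter_arith[symmetric] Int_commute)
  have SN: "emeasure S (- N) = 0" by (subst S) auto
  have "ac_density P (RN_deriv lborel Q)"
    unfolding ac_density_def D
  proof (intro conjI exI[of _ S] bexI[of _ N] ballI)
    show "RN_deriv lborel Q \<in> borel_measurable borel"
      using borel_measurable_RN_deriv[of lborel Q] by simp
    fix A :: "'a set" assume [measurable]: "A \<in> sets borel"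
    show "emeasure P A = emeasure Q A + emeasure S A"
      by (subst Q, simp, subst S, simp, subst plus_emeasure)
        (auto simp: sets_P intro!: arg_cong[where f="emeasure P"])
  qed (use N SN in \<open>auto simp: S_def sets_P\<close>)
  then show ?thesis by blast
qed

definition supp :: "'a::topological_space measure \<Rightarrow> 'a set" where
  "supp P = {x. \<forall>V. open V \<longrightarrow> x \<in> V \<longrightarrow> 0 < emeasure P V}"

text \<open>The infimum over the empty set is \<open>\<infinity>\<close>, as required for \<open>U = UNIV\<close>.\<close>
definition inner_part :: "'a::metric_space set \<Rightarrow> real \<Rightarrow> 'a set" where
  "inner_part U \<eta> =
     (if \<eta> = 0 then U else {x\<in>U. ereal \<eta> < (INF y\<in>- U. ereal (dist x y))})"

section \<open>The limiting constant\<close>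

definition Q_bregman ::
  "(real^'n) set \<Rightarrow> ((real^'n) \<Rightarrow> real) \<Rightarrow> real \<Rightarrow> ((real^'n) \<Rightarrow> ennreal) \<Rightarrow> ennreal" where
  "Q_bregman U F r h =
     ennreal (2 powr (- r / 2)) * zador_const TYPE('n) r *
     (let d = real CARD('n); s = d / (d + r) in
       ennreal_powr
         (\<integral>\<^sup>+x\<in>U. ennreal_powr (ennreal (det (hessian F x) powr (r / (2 * d))) * h x) s \<partial>lborel)
         (1 / s))"

end

theory Submission
  imports Defs
begin

text \<open>
  Put \<open>q = r / d\<close> and \<open>p = 1 / (1 + q) = d / (d + r)\<close>. Everything is done for \<open>r\<close>-th powers of
  errors: for a cost \<open>c\<close>, a measure \<open>\<mu>\<close> and a set \<open>A\<close> one studies the least value \<open>V\<^sub>A(n)\<close> of the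
  integral over \<open>A\<close> of \<open>min {c \<xi> a | a \<in> \<Gamma>}\<close> among all \<open>\<Gamma>\<close> with at most \<open>n\<close> points. If \<open>n\<close> centers
  are shared between two parts with errors \<open>a m\<^sup>-\<^sup>q\<close> and \<open>b k\<^sup>-\<^sup>q\<close>, the best division \<open>m + k = n\<close>
  costs \<open>(a\<^sup>p + b\<^sup>p)\<^sup>1\<^sup>/\<^sup>p n\<^sup>-\<^sup>q\<close>. Hence the \<open>p\<close>-th power of the upper rate
  \<open>limsup n\<^sup>q V\<^sub>A(n)\<close> is subadditive in \<open>A\<close> (\<open>rate_sup_add\<close>), and that of the lower rate is
  superadditive over parts that cannot make use of each other's centers (\<open>rate_inf_superadd\<close>). The theorem
  compares both of them with the measure with density
  \<open>(Q 2\<^sup>-\<^sup>r\<^sup>/\<^sup>2 det(\<nabla>\<^sup>2F)\<^sup>r\<^sup>/\<^sup>2\<^sup>d h)\<^sup>p\<close>, where \<open>Q\<close> is the constant of the unit cube: the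
  lower rate is at least this measure, and under the hypotheses of (a) the upper rate is at most this
  measure.

  For Lebesgue measure and the cost \<open>|\<xi> - a|\<^sup>r\<close>, a compact set is covered by small equal cells and every
  cell gets a scaled copy of a nearly optimal quantizer of the unit cube; this yields the upper bound
  (\<open>rate_sup_compact\<close>). Since \<open>Q\<close> is an infimum over \<open>n\<close>, the lower bound holds for cubes. It passes to
  every bounded Borel subset \<open>B\<close> of a cube by looking at the complement: a too good quantization of \<open>B\<close>,
  together with the known upper bound for the rest, would give a too good quantization of the cube
  (\<open>rate_inf_complement\<close>, \<open>rate_inf_bounded\<close>).

  A Bregman divergence is locally \<open>|L (\<xi> - a)|\<^sup>2 / 2\<close> with \<open>L\<^sup>T L = \<nabla>\<^sup>2F\<close>, up to a factor \<open>\<kappa>\<close> close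
  to 1. The set \<open>{0 < h < \<infinity>}\<close> is a countable disjoint union of tame pieces, on which \<open>L\<close> and \<open>h\<close>
  can be taken constant up to such a factor (\<open>tame_cover\<close>), and the linear map \<open>L\<close> reduces each
  piece to the Euclidean case (\<open>piece_upper\<close>, \<open>piece_lower\<close>).

  It remains to assemble the pieces. For the lower bound, \<open>bregman F \<xi>\<close> increases along rays that start
  at \<open>\<xi>\<close>, so for \<open>\<xi>\<close> in a compact set all distant centers can be replaced by one finite net
  (\<open>bregman_localization\<close>). Disjoint compact pieces are thus asymptotically independent
  (\<open>lower_rate_superadd\<close>). For the upper bound, the Hessian is bounded on a convex open set of full measure.
  There the cost is at most \<open>C |\<xi> - a|\<^sup>r\<close>, and Pierce's estimate bounds the upper rate by a moment of
  order \<open>r (1 + \<delta>)\<close>, that is, by a finite measure (\<open>pierce_bound\<close>). Finite subadditivity then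
  becomes countable, and a bound for compact subsets carries over to Borel sets (\<open>regular_rate\<close>). Compact
  Lebesgue-null sets have rate zero (\<open>rate_sup_null_compact\<close>), so the singular part of \<open>P\<close> does not
  contribute.
\<close>

section \<open>Powers of extended nonnegative reals\<close>

lemma ennreal_powr_ennreal [simp]: "0 \<le> x \<Longrightarrow> ennreal_powr (ennreal x) s = ennreal (x powr s)"
  by (simp add: ennreal_powr_def)

lemma ennreal_powr_top [simp]: "ennreal_powr top s = top"
  by (simp add: ennreal_powr_def)

lemma ennreal_powr_0 [simp]: "ennreal_powr 0 s = 0"
  by (simp add: ennreal_powr_def)

lemma ennreal_powr_mono: "0 \<le> s \<Longrightarrow> x \<le> y \<Longrightarrow> ennreal_powr x s \<le> ennreal_powr y s"
  by (cases x rule: ennreal_cases; cases y rule: ennreal_cases)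
    (auto intro!: powr_mono2 simp: top_unique)

lemma ennreal_powr_powr: "ennreal_powr (ennreal_powr x s) t = ennreal_powr x (s * t)"
  by (cases x rule: ennreal_cases) (auto simp: powr_powr)

lemma ennreal_powr_one [simp]: "ennreal_powr x 1 = x"
  by (cases x rule: ennreal_cases) auto

text \<open>The powers with exponents \<open>s\<close> and \<open>1 / s\<close> are inverse order isomorphisms, so they commute with
  infima.\<close>

lemma ennreal_powr_le_iff:
  assumes "0 < s"
  shows "ennreal_powr x s \<le> y \<longleftrightarrow> x \<le> ennreal_powr y (1 / s)"
proof
  assume "ennreal_powr x s \<le> y"
  from ennreal_powr_mono[OF _ this, of "1/s"] assms show "x \<le> ennreal_powr y (1/s)"
    by (simp add: ennreal_powr_powr)
next
  assume "x \<le> ennreal_powr y (1/s)"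
  from ennreal_powr_mono[OF _ this, of s] assms show "ennreal_powr x s \<le> y"
    by (simp add: ennreal_powr_powr)
qed

lemma ennreal_powr_mult:
  assumes "0 < s"
  shows "ennreal_powr (x * y) s = ennreal_powr x s * ennreal_powr y s"
proof (cases "x = 0 \<or> y = 0")
  case False
  then show ?thesis
    by (cases x rule: ennreal_cases; cases y rule: ennreal_cases)
       (auto simp: ennreal_mult[symmetric] powr_mult ennreal_mult_top ennreal_top_mult
         simp del: ennreal_eq_0_iff)
qed auto

lemma continuous_ennreal_powr:
  assumes "0 < s"
  shows "continuous_on UNIV (\<lambda>x. ennreal_powr x s)"
proof (rule continuous_onI_mono)
  have "y \<in> range (\<lambda>x. ennreal_powr x s)" for y
    by (rule range_eqI[of _ _ "ennreal_powr y (1/s)"]) (use assms in \<open>simp add: ennreal_powr_powr\<close>)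
  then have "range (\<lambda>x. ennreal_powr x s) = UNIV" by blast
  then show "open (range (\<lambda>x. ennreal_powr x s))" by simp
qed (use assms in \<open>auto intro: ennreal_powr_mono\<close>)

lemma borel_measurable_ennreal_powr [measurable (raw)]:
  assumes "0 < s" "f \<in> borel_measurable M"
  shows "(\<lambda>x. ennreal_powr (f x) s) \<in> borel_measurable M"
  by (rule borel_measurable_continuous_on[OF continuous_ennreal_powr assms(2)]) fact

lemma ennreal_powr_INF:
  assumes "0 < s"
  shows "ennreal_powr (INF i\<in>I. f i) s = (INF i\<in>I. ennreal_powr (f i) s)"
proof (rule antisym)
  have "(INF i\<in>I. ennreal_powr (f i) s) \<le> ennreal_powr (f i) s" if "i \<in> I" for i
    using that by (rule INF_lower)
  then have "ennreal_powr (INF i\<in>I. ennreal_powr (f i) s) (1/s) \<le> (INF i\<in>I. f i)"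
    using assms by (intro INF_greatest) (simp add: ennreal_powr_le_iff)
  then show "(INF i\<in>I. ennreal_powr (f i) s) \<le> ennreal_powr (INF i\<in>I. f i) s"
    using assms by (simp add: ennreal_powr_le_iff)
qed (use assms in \<open>auto intro!: INF_greatest ennreal_powr_mono INF_lower\<close>)

text \<open>Reals strictly below an extended number determine it. Zero has none, so it has to be allowed as an
  approximation separately.\<close>

lemma ennreal_add_le_by_approx:
  fixes X Y Z :: ennreal
  assumes *: "\<And>a b::real. 0 \<le> a \<Longrightarrow> 0 \<le> b \<Longrightarrow> a = 0 \<or> ennreal a < X \<Longrightarrow> b = 0 \<or> ennreal b < Y
      \<Longrightarrow> ennreal (a + b) \<le> Z"
  shows "X + Y \<le> Z"
proof (cases Z rule: ennreal_cases)
  case (real z)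
  have X: "ennreal b + X \<le> Z" if "0 \<le> b" "b = 0 \<or> ennreal b < Y" for b
  proof -
    have "X \<le> ennreal (z - b)"
    proof (rule dense_le)
      fix w assume w: "w < X"
      then obtain a where a: "w = ennreal a" "0 \<le> a" by (cases w rule: ennreal_cases) auto
      from *[of a b] a w that have "ennreal (a + b) \<le> Z" by auto
      then show "w \<le> ennreal (z - b)" using real a that(1)
        by (auto simp: ennreal_le_iff2 simp del: ennreal_plus)
    qed
    then have "ennreal b + X \<le> ennreal b + ennreal (z - b)" by (intro add_mono) auto
    also have "b \<le> z" using *[of 0 b] that real by (auto simp: ennreal_le_iff2)
    then have "ennreal b + ennreal (z - b) = Z" using real that
      by (subst ennreal_plus[symmetric]) auto
    finally show ?thesis .
  qed
  from X[of 0] have XZ: "X \<le> Z" by simp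
  then obtain x where x: "X = ennreal x" "0 \<le> x" using real
    by (cases X rule: ennreal_cases) (auto simp: top_unique)
  have "Y \<le> ennreal (z - x)"
  proof (rule dense_le)
    fix w assume w: "w < Y"
    then obtain b where b: "w = ennreal b" "0 \<le> b" by (cases w rule: ennreal_cases) auto
    then have "ennreal (b + x) \<le> Z" using X[of b] w x by (simp add: ennreal_plus)
    then show "w \<le> ennreal (z - x)" using real b x
      by (auto simp: ennreal_le_iff2 simp del: ennreal_plus)
  qed
  then have "X + Y \<le> ennreal x + ennreal (z - x)" using x by (intro add_mono) auto
  also have "x \<le> z" using real x XZ by (auto simp: ennreal_le_iff2)
  then have "ennreal x + ennreal (z - x) = Z" using real x by (subst ennreal_plus[symmetric]) auto
  finally show ?thesis .
qed simp

lemma ennreal_diff_le_real: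
  assumes "ennreal u \<le> z + ennreal v" "0 \<le> v"
  shows "ennreal (u - v) \<le> z"
proof (cases z rule: ennreal_cases)
  case (real x)
  then have "ennreal u \<le> ennreal (x + v)" using assms by simp
  then have "u \<le> x + v" using real assms by (auto simp: ennreal_le_iff2 simp del: ennreal_plus)
  then show ?thesis using real by (auto intro!: ennreal_leI)
qed simp

section \<open>Upper and lower rates\<close>

definition rate_sup :: "real \<Rightarrow> (nat \<Rightarrow> ennreal) \<Rightarrow> ennreal" where
  "rate_sup q f = limsup (\<lambda>n. ennreal (real n powr q) * f n)"

definition rate_inf :: "real \<Rightarrow> (nat \<Rightarrow> ennreal) \<Rightarrow> ennreal" where
  "rate_inf q f = liminf (\<lambda>n. ennreal (real n powr q) * f n)"

lemma rate_bound_iff: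
  assumes "0 < n" "0 \<le> b"
  shows "ennreal (real n powr q) * y \<le> ennreal b \<longleftrightarrow> y \<le> ennreal (b * real n powr - q)"
    and "ennreal b \<le> ennreal (real n powr q) * y \<longleftrightarrow> ennreal (b * real n powr - q) \<le> y"
proof -
  have n: "0 < real n powr q" using assms by simp
  show "ennreal (real n powr q) * y \<le> ennreal b \<longleftrightarrow> y \<le> ennreal (b * real n powr - q)"
    using assms n by (cases y rule: ennreal_cases)
      (auto simp: ennreal_mult[symmetric] powr_minus field_simps ennreal_mult_top top_unique)
  show "ennreal b \<le> ennreal (real n powr q) * y \<longleftrightarrow> ennreal (b * real n powr - q) \<le> y"
    using assms n by (cases y rule: ennreal_cases)
      (auto simp: ennreal_mult[symmetric] powr_minus field_simps ennreal_mult_top)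
qed

lemma rate_sup_leI:
  assumes "\<forall>\<^sub>F n in sequentially. f n \<le> ennreal (b * real n powr - q)" "0 \<le> b"
  shows "rate_sup q f \<le> ennreal b"
  unfolding rate_sup_def
proof (rule Limsup_bounded)
  from assms(1) eventually_gt_at_top[of 0]
  show "\<forall>\<^sub>F n in sequentially. ennreal (real n powr q) * f n \<le> ennreal b"
    by eventually_elim (use assms(2) in \<open>simp add: rate_bound_iff\<close>)
qed

lemma rate_sup_lessD:
  assumes "rate_sup q f < ennreal b" "0 \<le> b"
  shows "\<forall>\<^sub>F n in sequentially. f n \<le> ennreal (b * real n powr - q)"
  using Limsup_lessD[OF assms(1)[unfolded rate_sup_def]] eventually_gt_at_top[of 0]
  by eventually_elim (use assms(2) in \<open>simp add: rate_bound_iff[symmetric] less_imp_le\<close>)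

lemma rate_inf_lessD:
  assumes "ennreal b < rate_inf q f" "0 \<le> b"
  shows "\<forall>\<^sub>F n in sequentially. ennreal (b * real n powr - q) \<le> f n"
  using less_LiminfD[OF assms(1)[unfolded rate_inf_def]] eventually_gt_at_top[of 0]
  by eventually_elim (use assms(2) in \<open>simp add: rate_bound_iff[symmetric] less_imp_le\<close>)

lemma rate_sup_mono: "(\<And>n. f n \<le> g n) \<Longrightarrow> rate_sup q f \<le> rate_sup q g"
  unfolding rate_sup_def by (intro Limsup_mono always_eventually allI mult_left_mono) auto

lemma rate_inf_mono: "(\<And>n. f n \<le> g n) \<Longrightarrow> rate_inf q f \<le> rate_inf q g"
  unfolding rate_inf_def by (intro Liminf_mono always_eventually allI mult_left_mono) auto

lemma rate_inf_le_rate_sup: "rate_inf q f \<le> rate_sup q f"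
  unfolding rate_sup_def rate_inf_def by (rule Liminf_le_Limsup) simp


lemma rate_sup_cmult: "rate_sup q (\<lambda>n. ennreal C * f n) = ennreal C * rate_sup q f"
proof -
  have "limsup (\<lambda>n. ennreal C * (ennreal (real n powr q) * f n)) = ennreal C * rate_sup q f"
    unfolding rate_sup_def
    by (rule Limsup_compose_continuous_mono)
       (auto intro!: ennreal_continuous_on_cmult monoI mult_left_mono continuous_intros)
  then show ?thesis by (simp add: rate_sup_def mult_ac)
qed

lemma rate_inf_cmult: "rate_inf q (\<lambda>n. ennreal C * f n) = ennreal C * rate_inf q f"
proof -
  have "liminf (\<lambda>n. ennreal C * (ennreal (real n powr q) * f n)) = ennreal C * rate_inf q f"
    unfolding rate_inf_def
    by (rule Liminf_compose_continuous_mono)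
       (auto intro!: ennreal_continuous_on_cmult monoI mult_left_mono continuous_intros)
  then show ?thesis by (simp add: rate_inf_def mult_ac)
qed

lemma tendsto_powr_scaled:
  assumes "(\<lambda>n. real (m n) / real n) \<longlonglongrightarrow> w" "0 < w"
  shows "(\<lambda>n. real n powr q * real (m n) powr - q) \<longlonglongrightarrow> w powr - q"
proof -
  have "(\<lambda>n. (real (m n) / real n) powr - q) \<longlonglongrightarrow> w powr - q"
    using assms by (intro tendsto_powr) auto
  moreover have "\<forall>\<^sub>F n in sequentially. (real (m n) / real n) powr - q = real n powr q * real (m n) powr - q"
    using eventually_gt_at_top[of 0]
    by eventually_elim (auto simp: powr_divide powr_minus field_simps)
  ultimately show ?thesis by (rule Lim_transform_eventually)
qed

lemma filterlim_of_ratio: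
  assumes "(\<lambda>n. real (m n) / real n) \<longlonglongrightarrow> w" "0 < w"
  shows "filterlim m at_top sequentially"
proof -
  have "filterlim (\<lambda>n. (real (m n) / real n) * real n) at_top sequentially"
    by (rule filterlim_tendsto_pos_mult_at_top[OF assms]) (rule filterlim_real_sequentially)
  moreover have "\<forall>\<^sub>F n in sequentially. (real (m n) / real n) * real n = real (m n)"
    using eventually_gt_at_top[of 0] by eventually_elim auto
  ultimately have "filterlim (\<lambda>n. real (m n)) at_top sequentially"
    by (subst (asm) filterlim_cong[OF refl refl]) auto
  then show ?thesis by (simp add: filterlim_sequentially_iff_filterlim_real)
qed

lemma ratio_tendsto:
  assumes "\<And>n. \<bar>real (m n) - w * real n\<bar> \<le> 1"
  shows "(\<lambda>n. real (m n) / real n) \<longlonglongrightarrow> w"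
proof (rule Lim_transform_eventually)
  have "(\<lambda>n. (real (m n) - w * real n) / real n) \<longlonglongrightarrow> 0"
  proof (rule tendsto_0_le[where K = 1])
    show "(\<lambda>n. 1 / real n) \<longlonglongrightarrow> 0" by (rule lim_1_over_n)
    show "\<forall>\<^sub>F n in sequentially. norm ((real (m n) - w * real n) / real n) \<le> norm (1 / real n) * 1"
      using eventually_gt_at_top[of 0] by eventually_elim (use assms in \<open>simp add: divide_right_mono\<close>)
  qed
  then show "(\<lambda>n. (real (m n) - w * real n) / real n + w) \<longlonglongrightarrow> w" by (auto intro: tendsto_eq_intros)
  show "\<forall>\<^sub>F n in sequentially. (real (m n) - w * real n) / real n + w = real (m n) / real n"
    using eventually_gt_at_top[of 0] by eventually_elim (simp add: field_simps)
qed

text \<open>The relation \<open>p (1 + q) = 1\<close> is what makes \<open>p\<close>-th powers of rates additive.\<close>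

context
  fixes q p :: real
  assumes q: "0 < q" and p: "p = 1 / (1 + q)"
begin

lemma p_pos: "0 < p" and p_q: "p * (1 + q) = 1" and p_q': "1 - p * q = p"
  using q by (auto simp: p field_simps)

lemma powr_rescale:
  fixes x y :: real
  assumes "0 < x" "0 < y"
  shows "x powr (1 + q) * (x / y) powr - q = x * y powr q"
    and "x * (y / x) powr - q = x powr (1 + q) * y powr - q"
proof -
  have "0 < x powr q" "0 < y powr q" using assms by auto
  then show "x powr (1 + q) * (x / y) powr - q = x * y powr q"
    and "x * (y / x) powr - q = x powr (1 + q) * y powr - q"
    using assms by (simp_all add: powr_add powr_divide powr_minus_divide)
qed

lemma powr_p_powr: "0 \<le> t \<Longrightarrow> (t powr p) powr (1 + q) = t" "0 \<le> t \<Longrightarrow> (t powr (1 + q)) powr p = t"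
  using p_q by (simp_all add: powr_powr mult.commute)

text \<open>For \<open>m + k = n\<close> the sum \<open>a m\<^sup>-\<^sup>q + b k\<^sup>-\<^sup>q\<close> is least when \<open>m\<close> and \<open>k\<close> are proportional to
  \<open>a\<^sup>p\<close> and \<open>b\<^sup>p\<close>. Rounding this division has no effect in the limit.\<close>

lemma rate_sup_add_real:
  assumes sub: "\<And>m n. f (m + n) \<le> f1 m + f2 n"
    and a: "0 < a" "\<forall>\<^sub>F n in sequentially. f1 n \<le> ennreal (a * real n powr - q)"
    and b: "0 < b" "\<forall>\<^sub>F n in sequentially. f2 n \<le> ennreal (b * real n powr - q)"
  shows "rate_sup q f \<le> ennreal ((a powr p + b powr p) powr (1 + q))"
proof -
  define S where "S = a powr p + b powr p"
  have S: "0 < S" using a b by (auto simp: S_def intro!: add_pos_pos)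
  define w where "w = a powr p / S"
  have w: "0 < w" "w < 1" "1 - w = b powr p / S" using a b S by (auto simp: w_def S_def field_simps)
  define m where "m n = nat \<lfloor>w * real n\<rfloor>" for n
  define k where "k n = n - m n" for n
  have mn: "real (m n) \<le> w * real n" for n using w by (simp add: m_def)
  have mn': "m n \<le> n" for n
    using order_trans[OF mn[of n] mult_right_mono[of w 1 "real n"]] w by simp
  have "0 \<le> w * real n" for n using w by simp
  then have m: "(\<lambda>n. real (m n) / real n) \<longlonglongrightarrow> w"
    by (intro ratio_tendsto) (simp add: m_def abs_le_iff, linarith)
  have "(\<lambda>n. 1 - real (m n) / real n) \<longlonglongrightarrow> 1 - w" by (intro tendsto_intros m)
  moreover have "\<forall>\<^sub>F n in sequentially. 1 - real (m n) / real n = real (k n) / real n"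
    using eventually_gt_at_top[of 0]
    by eventually_elim (simp add: k_def of_nat_diff mn' field_simps)
  ultimately have k: "(\<lambda>n. real (k n) / real n) \<longlonglongrightarrow> 1 - w" by (rule Lim_transform_eventually)
  define X where "X n = a * (real n powr q * real (m n) powr - q) + b * (real n powr q * real (k n) powr - q)" for n
  have "X \<longlonglongrightarrow> a * w powr - q + b * (1 - w) powr - q"
    unfolding X_def using w by (intro tendsto_intros tendsto_powr_scaled m k) auto
  also have "a * w powr - q = a powr p * S powr q"
    using powr_rescale(1)[of "a powr p" S] a S powr_p_powr(1)[of a] by (simp add: w_def)
  also have "b * (1 - w) powr - q = b powr p * S powr q"
    using powr_rescale(1)[of "b powr p" S] b S powr_p_powr(1)[of b] by (simp add: w(3))
  also have "a powr p * S powr q + b powr p * S powr q = S powr (1 + q)"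
    using S by (simp add: powr_add distrib_right[symmetric] S_def[symmetric])
  finally have lim: "(\<lambda>n. ennreal (X n)) \<longlonglongrightarrow> ennreal (S powr (1 + q))" by (rule tendsto_ennrealI)
  have "rate_sup q f \<le> limsup (\<lambda>n. ennreal (X n))"
    unfolding rate_sup_def
  proof (rule Limsup_mono)
    have m_ev: "\<forall>\<^sub>F n in sequentially. f1 (m n) \<le> ennreal (a * real (m n) powr - q)"
      using a(2) filterlim_of_ratio[OF m w(1)] by (rule eventually_compose_filterlim)
    have k_ev: "\<forall>\<^sub>F n in sequentially. f2 (k n) \<le> ennreal (b * real (k n) powr - q)"
      by (rule eventually_compose_filterlim[OF b(2) filterlim_of_ratio[OF k]]) (use w in simp)
    show "\<forall>\<^sub>F n in sequentially. ennreal (real n powr q) * f n \<le> ennreal (X n)"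
      using m_ev k_ev
    proof eventually_elim
      case (elim n)
      have "f n = f (m n + k n)" using mn' by (simp add: k_def)
      also have "\<dots> \<le> ennreal (a * real (m n) powr - q) + ennreal (b * real (k n) powr - q)"
        using sub elim add_mono order_trans by blast
      finally have "ennreal (real n powr q) * f n
        \<le> ennreal (real n powr q) * (ennreal (a * real (m n) powr - q) + ennreal (b * real (k n) powr - q))"
        by (rule mult_left_mono) simp
      also have "\<dots> = ennreal (X n)"
        using a b by (subst ennreal_plus[symmetric], simp, simp, subst ennreal_mult'[symmetric])
          (simp_all add: X_def algebra_simps)
      finally show ?case .
    qed
  qed
  also have "\<dots> = ennreal (S powr (1 + q))" using lim by (intro lim_imp_Limsup) auto
  finally show ?thesis by (simp add: S_def)
qed

lemma rate_sup_powr_lessD: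
  assumes "ennreal_powr (rate_sup q f) p < ennreal t" "0 < t"
  shows "\<forall>\<^sub>F n in sequentially. f n \<le> ennreal (t powr (1 + q) * real n powr - q)"
proof (rule rate_sup_lessD)
  have "\<not> ennreal (t powr (1+q)) \<le> rate_sup q f"
  proof
    assume "ennreal (t powr (1+q)) \<le> rate_sup q f"
    from ennreal_powr_mono[OF _ this, of p] p_pos assms show False
      by (simp add: powr_powr p_q mult.commute[of _ p] not_le[symmetric])
  qed
  then show "rate_sup q f < ennreal (t powr (1+q))" by simp
qed simp

lemma rate_inf_powr_lessD:
  assumes "ennreal t < ennreal_powr (rate_inf q f) p" "0 < t"
  shows "\<forall>\<^sub>F n in sequentially. ennreal (t powr (1 + q) * real n powr - q) \<le> f n"
proof (rule rate_inf_lessD)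
  have "\<not> rate_inf q f \<le> ennreal (t powr (1+q))"
  proof
    assume "rate_inf q f \<le> ennreal (t powr (1+q))"
    from ennreal_powr_mono[OF _ this, of p] p_pos assms show False
      by (simp add: powr_powr p_q mult.commute[of _ p] not_le[symmetric])
  qed
  then show "ennreal (t powr (1+q)) < rate_inf q f" by simp
qed simp

lemma ennreal_powr_p_le:
  assumes "x \<le> ennreal (t powr (1 + q))" "0 \<le> t"
  shows "ennreal_powr x p \<le> ennreal t"
  using ennreal_powr_mono[OF _ assms(1), of p] p_pos assms(2)
  by (simp add: powr_powr p_q mult.commute[of _ p])

lemma ennreal_powr_p_ge:
  assumes "ennreal (t powr (1 + q)) \<le> x" "0 \<le> t"
  shows "ennreal t \<le> ennreal_powr x p"
  using ennreal_powr_mono[OF _ assms(1), of p] p_pos assms(2)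
  by (simp add: powr_powr p_q mult.commute[of _ p])

lemma rate_sup_add:
  assumes sub: "\<And>m n. f (m + n) \<le> f1 m + f2 n"
  shows "ennreal_powr (rate_sup q f) p \<le> ennreal_powr (rate_sup q f1) p + ennreal_powr (rate_sup q f2) p"
proof (rule ennreal_le_epsilon)
  fix e :: real assume fin: "ennreal_powr (rate_sup q f1) p + ennreal_powr (rate_sup q f2) p < top" and e: "0 < e"
  then obtain x y where x: "ennreal_powr (rate_sup q f1) p = ennreal x" "0 \<le> x"
    and y: "ennreal_powr (rate_sup q f2) p = ennreal y" "0 \<le> y"
    by (cases "ennreal_powr (rate_sup q f1) p" rule: ennreal_cases;
        cases "ennreal_powr (rate_sup q f2) p" rule: ennreal_cases) auto
  \<comment> \<open>Adding \<open>e / 2\<close> makes both bounds strict and positive, even if a rate vanishes.\<close>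
  have "rate_sup q f \<le> ennreal ((((x + e/2) powr (1+q)) powr p + ((y + e/2) powr (1+q)) powr p) powr (1 + q))"
    by (rule rate_sup_add_real, rule sub)
       (use e x y in \<open>auto intro!: rate_sup_powr_lessD simp: ennreal_less_iff simp del: ennreal_plus\<close>)
  also have "\<dots> = ennreal ((x + e/2 + (y + e/2)) powr (1 + q))"
    using e x y by (simp add: powr_p_powr(2))
  also have "x + e/2 + (y + e/2) = x + y + e" by simp
  finally have "ennreal_powr (rate_sup q f) p \<le> ennreal (x + y + e)"
    using e x y by (intro ennreal_powr_p_le) auto
  then show "ennreal_powr (rate_sup q f) p \<le> ennreal_powr (rate_sup q f1) p + ennreal_powr (rate_sup q f2) p + ennreal e"
    using x y e by simp
qed

text \<open>Jensen's inequality for the convex function \<open>t\<^sup>-\<^sup>q\<close> with weights proportional to \<open>a\<^sup>p\<close> and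
  \<open>b\<^sup>p\<close>: no division of \<open>x + y\<close> beats the proportional one.\<close>

lemma two_term_hoelder:
  fixes a b x y :: real
  assumes "0 \<le> a" "0 \<le> b" "0 < x" "0 < y"
  shows "(a powr p + b powr p) powr (1 + q) * (x + y) powr - q \<le> a * x powr - q + b * y powr - q"
proof (cases "a = 0 \<or> b = 0")
  case True
  have "(x + y) powr - q \<le> x powr - q" "(x + y) powr - q \<le> y powr - q"
    using assms q by (auto intro!: powr_mono2')
  then show ?thesis using True assms
    by (auto simp: powr_p_powr(1) mult_left_mono)
next
  case False
  then have a: "0 < a" "0 < b" using assms by auto
  define S where "S = a powr p + b powr p"
  have S: "0 < S" using a by (auto simp: S_def intro!: add_pos_pos)
  have conv: "convex_on {0<..} (\<lambda>t::real. t powr - q)"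
    by (rule f''_ge0_imp_convex[where f' = "\<lambda>t. - q * t powr (- q - 1)"
          and f'' = "\<lambda>t. q * (q + 1) * t powr (- q - 1 - 1)"])
       (use q in \<open>auto intro!: derivative_eq_intros simp: algebra_simps\<close>)
  let ?\<alpha> = "a powr p" and ?\<beta> = "b powr p"
  have \<alpha>: "0 < ?\<alpha>" "0 < ?\<beta>" using a by auto
  have "((1 - ?\<beta> / S) * (x / ?\<alpha>) + ?\<beta> / S * (y / ?\<beta>)) powr - q
      \<le> (1 - ?\<beta> / S) * (x / ?\<alpha>) powr - q + ?\<beta> / S * (y / ?\<beta>) powr - q"
    using convex_onD[OF conv, of "?\<beta> / S" "x / ?\<alpha>" "y / ?\<beta>"] \<alpha> assms S
    by (simp add: S_def)
  also have "1 - ?\<beta> / S = ?\<alpha> / S" using S by (simp add: S_def field_simps)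
  also have "?\<alpha> / S * (x / ?\<alpha>) + ?\<beta> / S * (y / ?\<beta>) = (x + y) / S"
    using \<alpha> by (simp add: add_divide_distrib)
  finally have "S * ((x + y) / S) powr - q
      \<le> S * (?\<alpha> / S * (x / ?\<alpha>) powr - q + ?\<beta> / S * (y / ?\<beta>) powr - q)"
    using S by (intro mult_left_mono) auto
  also have "\<dots> = ?\<alpha> * (x / ?\<alpha>) powr - q + ?\<beta> * (y / ?\<beta>) powr - q"
    using S by (simp add: distrib_left)
  also have "\<dots> = a * x powr - q + b * y powr - q"
    using \<alpha> assms by (simp add: powr_rescale(2) powr_p_powr(1))
  also have "S * ((x + y) / S) powr - q = S powr (1 + q) * (x + y) powr - q"
    using S assms by (intro powr_rescale(2)) auto
  finally show ?thesis by (simp add: S_def)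
qed

lemma rate_inf_shift:
  assumes "\<And>n. n \<ge> 1 \<Longrightarrow> ennreal (C * real (n + K) powr - q) \<le> f n" "0 \<le> C"
  shows "ennreal C \<le> rate_inf q f"
proof -
  have "(\<lambda>n. 1 + real K * (1 / real n)) \<longlonglongrightarrow> 1 + real K * 0" by (intro tendsto_intros lim_1_over_n)
  moreover have "\<forall>\<^sub>F n in sequentially. 1 + real K * (1 / real n) = real (n + K) / real n"
    using eventually_gt_at_top[of 0] by eventually_elim (simp add: field_simps)
  ultimately have "(\<lambda>n. real (n + K) / real n) \<longlonglongrightarrow> 1 + real K * 0"
    by (rule Lim_transform_eventually)
  then have "(\<lambda>n. real (n + K) / real n) \<longlonglongrightarrow> 1" by simp
  from tendsto_mult_left[OF tendsto_powr_scaled[OF this], of C q]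
  have "(\<lambda>n. ennreal (C * (real n powr q * real (n + K) powr - q))) \<longlonglongrightarrow> ennreal C"
    by (intro tendsto_ennrealI) simp
  then have "ennreal C = liminf (\<lambda>n. ennreal (C * (real n powr q * real (n + K) powr - q)))"
    by (intro lim_imp_Liminf[symmetric]) auto
  also have "\<dots> \<le> rate_inf q f" unfolding rate_inf_def
  proof (rule Liminf_mono)
    show "\<forall>\<^sub>F n in sequentially. ennreal (C * (real n powr q * real (n + K) powr - q)) \<le> ennreal (real n powr q) * f n"
      using eventually_ge_at_top[of 1]
    proof eventually_elim
      case (elim n)
      have "ennreal (C * (real n powr q * real (n + K) powr - q)) = ennreal (real n powr q) * ennreal (C * real (n + K) powr - q)"
        using assms(2) by (simp add: ennreal_mult[symmetric] mult_ac)
      also have "\<dots> \<le> ennreal (real n powr q) * f n" using assms(1)[OF elim] by (rule mult_left_mono) simp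
      finally show ?case .
    qed
  qed
  finally show ?thesis .
qed

text \<open>Here \<open>f\<close> is at least as expensive as the best division of \<open>n + K\<close> centers between two separate
  problems. The constant \<open>K\<close> disappears in the limit, and so do the finitely many centers that are
  added to reach the range where the asymptotic bounds of \<open>f1\<close> and \<open>f2\<close> hold.\<close>

lemma rate_inf_superadd:
  assumes anti: "antimono f1" "antimono f2"
    and split: "\<And>n y. n \<ge> 1 \<Longrightarrow> (\<And>i j. i + j \<le> n + K \<Longrightarrow> y \<le> f1 i + f2 j) \<Longrightarrow> y \<le> f n"
  shows "ennreal_powr (rate_inf q f1) p + ennreal_powr (rate_inf q f2) p \<le> ennreal_powr (rate_inf q f) p"
proof (rule ennreal_add_le_by_approx)
  have ev: "\<exists>N\<ge>1. \<forall>n\<ge>N. ennreal (a powr (1+q) * real n powr - q) \<le> g n"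
    if "0 \<le> a" "a = 0 \<or> ennreal a < ennreal_powr (rate_inf q g) p" for a g
  proof (cases "a = 0")
    case False
    then have "\<forall>\<^sub>F n in sequentially. ennreal (a powr (1 + q) * real n powr - q) \<le> g n"
      using that by (intro rate_inf_powr_lessD) auto
    then obtain N where "\<forall>n\<ge>N. ennreal (a powr (1+q) * real n powr - q) \<le> g n"
      by (auto simp: eventually_sequentially)
    then show ?thesis by (intro exI[of _ "max N 1"]) auto
  qed auto
  fix a b :: real assume ab: "0 \<le> a" "0 \<le> b"
    "a = 0 \<or> ennreal a < ennreal_powr (rate_inf q f1) p" "b = 0 \<or> ennreal b < ennreal_powr (rate_inf q f2) p"
  obtain M where M: "M \<ge> 1" "\<And>n. n \<ge> M \<Longrightarrow> ennreal (a powr (1+q) * real n powr - q) \<le> f1 n"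
    using ev[of a f1] ab by auto
  obtain N where N: "N \<ge> 1" "\<And>n. n \<ge> N \<Longrightarrow> ennreal (b powr (1+q) * real n powr - q) \<le> f2 n"
    using ev[of b f2] ab by auto
  have "ennreal ((a + b) powr (1 + q)) \<le> rate_inf q f"
  proof (rule rate_inf_shift[where K = "K + M + N"])
    fix n :: nat assume n: "n \<ge> 1"
    show "ennreal ((a + b) powr (1 + q) * real (n + (K + M + N)) powr - q) \<le> f n"
    proof (rule split[OF n])
      fix i j :: nat assume ij: "i + j \<le> n + K"
      have "(a + b) powr (1 + q) * real (n + (K + M + N)) powr - q
          \<le> (a + b) powr (1 + q) * (real (i + M) + real (j + N)) powr - q"
        using ij M N q by (intro mult_left_mono powr_mono2') auto
      also have "\<dots> \<le> a powr (1 + q) * real (i + M) powr - q + b powr (1 + q) * real (j + N) powr - q"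
        using two_term_hoelder[of "a powr (1+q)" "b powr (1+q)" "real (i + M)" "real (j + N)"] ab M N
        by (simp add: powr_p_powr(2))
      finally have "ennreal ((a + b) powr (1 + q) * real (n + (K + M + N)) powr - q)
         \<le> ennreal (a powr (1 + q) * real (i + M) powr - q) + ennreal (b powr (1 + q) * real (j + N) powr - q)"
        by (subst ennreal_plus[symmetric]) (auto intro: ennreal_leI simp del: ennreal_plus of_nat_add)
      also have "\<dots> \<le> f1 (i + M) + f2 (j + N)" by (intro add_mono M N) auto
      also have "\<dots> \<le> f1 i + f2 j" by (intro add_mono antimonoD[OF anti(1)] antimonoD[OF anti(2)]) auto
      finally show "ennreal ((a + b) powr (1 + q) * real (n + (K + M + N)) powr - q) \<le> f1 i + f2 j" .
    qed
  qed simp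
  then show "ennreal (a + b) \<le> ennreal_powr (rate_inf q f) p" using ab by (intro ennreal_powr_p_ge) auto
qed

text \<open>If \<open>m\<close> centers serve the first problem and \<open>m b / a\<close> the second one, the total is \<open>m (a + b) / a\<close>, so
  \<open>f1\<close> is at least the bound of \<open>f\<close> there minus the bound of \<open>f2\<close>. This division is the optimal one for
  rates \<open>a\<^sup>1\<^sup>+\<^sup>q\<close> and \<open>b\<^sup>1\<^sup>+\<^sup>q\<close>, and therefore nothing is lost.\<close>

lemma rate_inf_complement_real:
  assumes sub: "\<And>m n. f (m + n) \<le> f1 m + f2 n"
    and f: "\<And>n. n \<ge> 1 \<Longrightarrow> ennreal ((a + b) powr (1 + q) * real n powr - q) \<le> f n"
    and f2: "\<forall>\<^sub>F n in sequentially. f2 n \<le> ennreal (b powr (1 + q) * real n powr - q)"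
    and ab: "0 < a" "0 < b"
  shows "ennreal (a powr (1 + q)) \<le> rate_inf q f1"
proof -
  define k where "k m = nat \<lceil>b / a * real m\<rceil>" for m
  have "0 \<le> b / a * real m" for m using ab by simp
  then have k: "(\<lambda>m. real (k m) / real m) \<longlonglongrightarrow> b / a"
    by (intro ratio_tendsto) (simp add: k_def abs_le_iff, linarith)
  have "(\<lambda>m. 1 + real (k m) / real m) \<longlonglongrightarrow> 1 + b / a" by (intro tendsto_intros k)
  moreover have "\<forall>\<^sub>F m in sequentially. 1 + real (k m) / real m = real (m + k m) / real m"
    using eventually_gt_at_top[of 0] by eventually_elim (simp add: field_simps)
  ultimately have mk: "(\<lambda>m. real (m + k m) / real m) \<longlonglongrightarrow> 1 + b / a" by (rule Lim_transform_eventually)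
  define X where "X m = (a + b) powr (1 + q) * (real m powr q * real (m + k m) powr - q)
     - b powr (1 + q) * (real m powr q * real (k m) powr - q)" for m
  have "X \<longlonglongrightarrow> (a + b) powr (1 + q) * (1 + b / a) powr - q - b powr (1 + q) * (b / a) powr - q"
    unfolding X_def using ab by (intro tendsto_intros tendsto_powr_scaled mk k) (auto simp: add_pos_pos)
  also have "1 + b / a = (a + b) / a" using ab by (simp add: add_divide_distrib)
  also have "(a + b) powr (1 + q) * ((a + b) / a) powr - q = (a + b) * a powr q"
    using ab by (intro powr_rescale(1)) auto
  also have "b powr (1 + q) * (b / a) powr - q = b * a powr q"
    using ab by (intro powr_rescale(1)) auto
  also have "(a + b) * a powr q - b * a powr q = a powr (1 + q)"
    using ab by (simp add: powr_add distrib_right)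
  finally have "(\<lambda>n. ennreal (X n)) \<longlonglongrightarrow> ennreal (a powr (1 + q))" by (rule tendsto_ennrealI)
  then have "ennreal (a powr (1 + q)) = liminf (\<lambda>n. ennreal (X n))"
    by (intro lim_imp_Liminf[symmetric]) auto
  also have "\<dots> \<le> rate_inf q f1" unfolding rate_inf_def
  proof (rule Liminf_mono)
    have "\<forall>\<^sub>F m in sequentially. f2 (k m) \<le> ennreal (b powr (1 + q) * real (k m) powr - q)"
      by (rule eventually_compose_filterlim[OF f2 filterlim_of_ratio[OF k]]) (use ab in simp)
    then show "\<forall>\<^sub>F m in sequentially. ennreal (X m) \<le> ennreal (real m powr q) * f1 m"
      using eventually_ge_at_top[of 1]
    proof eventually_elim
      case (elim m)
      let ?u = "(a + b) powr (1 + q) * real (m + k m) powr - q"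
      let ?v = "b powr (1 + q) * real (k m) powr - q"
      have "ennreal ?u \<le> f (m + k m)" using elim(2) by (intro f) simp
      also have "\<dots> \<le> f1 m + f2 (k m)" by (rule sub)
      also have "\<dots> \<le> f1 m + ennreal ?v" using elim(1) by (rule add_left_mono)
      finally have "ennreal (?u - ?v) \<le> f1 m" by (rule ennreal_diff_le_real) simp
      then have "ennreal (real m powr q) * ennreal (?u - ?v) \<le> ennreal (real m powr q) * f1 m"
        by (rule mult_left_mono) simp
      also have "ennreal (real m powr q) * ennreal (?u - ?v) = ennreal (real m powr q * (?u - ?v))"
        by (rule ennreal_mult'[symmetric]) simp
      also have "real m powr q * (?u - ?v) = X m" by (simp add: X_def algebra_simps)
      finally show ?case .
    qed
  qed
  finally show ?thesis .
qed

text \<open>A lower bound for a part, obtained from a lower bound for the whole and an upper bound for the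
  remainder.\<close>

lemma rate_inf_complement:
  assumes sub: "\<And>m n. f (m + n) \<le> f1 m + f2 n"
    and f: "\<And>n. n \<ge> 1 \<Longrightarrow> ennreal (A powr (1 + q) * real n powr - q) \<le> f n"
    and A: "0 \<le> A"
  shows "ennreal A \<le> ennreal_powr (rate_inf q f1) p + ennreal_powr (rate_sup q f2) p"
proof (rule ennreal_le_epsilon)
  fix e :: real assume fin: "ennreal_powr (rate_inf q f1) p + ennreal_powr (rate_sup q f2) p < top" and e: "0 < e"
  then obtain y where y: "ennreal_powr (rate_sup q f2) p = ennreal y" "0 \<le> y"
    by (cases "ennreal_powr (rate_sup q f2) p" rule: ennreal_cases) auto
  show "ennreal A \<le> ennreal_powr (rate_inf q f1) p + ennreal_powr (rate_sup q f2) p + ennreal e"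
  proof (cases "A \<le> y + e")
    case True
    then have "ennreal A \<le> ennreal_powr (rate_sup q f2) p + ennreal e"
      using y e ennreal_leI[OF True] by simp
    then have "ennreal A \<le> 0 + (ennreal_powr (rate_sup q f2) p + ennreal e)" by simp
    also have "\<dots> \<le> ennreal_powr (rate_inf q f1) p + (ennreal_powr (rate_sup q f2) p + ennreal e)"
      by (intro add_mono) auto
    finally show ?thesis by (simp add: add.assoc)
  next
    case False
    have "ennreal ((A - (y + e)) powr (1 + q)) \<le> rate_inf q f1"
    proof (rule rate_inf_complement_real, rule sub)
      show "\<forall>\<^sub>F n in sequentially. f2 n \<le> ennreal ((y + e) powr (1 + q) * real n powr - q)"
        using y e by (intro rate_sup_powr_lessD) (auto simp: ennreal_less_iff simp del: ennreal_plus)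
    qed (use f False y e in auto)
    then have "ennreal (A - (y + e)) \<le> ennreal_powr (rate_inf q f1) p"
      using False by (intro ennreal_powr_p_ge) auto
    then have "ennreal (A - (y + e)) + ennreal (y + e) \<le> ennreal_powr (rate_inf q f1) p + ennreal (y + e)"
      by (rule add_right_mono)
    also have "ennreal (A - (y + e)) + ennreal (y + e) = ennreal A"
      using False y e by (subst ennreal_plus[symmetric]) auto
    finally show ?thesis using y e by (simp add: add.assoc)
  qed
qed

end

section \<open>Linear changes of variables\<close>

text \<open>By Fubini: once the coordinates other than \<open>b\<close> are fixed, the shear is a translation of the
  \<open>b\<close>-axis.\<close>

lemma nn_integral_lborel_shear:
  fixes b e :: "'a::euclidean_space" and f :: "'a \<Rightarrow> ennreal"
  assumes be: "b \<in> Basis" "e \<in> Basis" "b \<noteq> e" and f [measurable]: "f \<in> borel_measurable borel"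
  shows "(\<integral>\<^sup>+x. f (x + (x \<bullet> e) *\<^sub>R b) \<partial>lborel) = (\<integral>\<^sup>+x. f x \<partial>lborel)"
proof -
  interpret product_sigma_finite "\<lambda>_::'a. lborel :: real measure" ..
  define S where "S = Basis - {b}"
  have S: "Basis = insert b S" "finite S" "b \<notin> S" "e \<in> S" using be by (auto simp: S_def)
  define s where "s y = (\<Sum>i\<in>S. y i *\<^sub>R i)" for y :: "'a \<Rightarrow> real"
  have [measurable]: "s \<in> borel_measurable (Pi\<^sub>M S (\<lambda>_. lborel))"
    unfolding s_def by measurable
  have eq: "(\<Sum>i\<in>Basis. (y(b := t)) i *\<^sub>R i) = t *\<^sub>R b + s y" for y t
  proof -
    have "(\<Sum>i\<in>Basis. (y(b := t)) i *\<^sub>R i) = (\<Sum>i\<in>insert b S. (y(b := t)) i *\<^sub>R i)"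
      by (simp only: S(1))
    also have "\<dots> = t *\<^sub>R b + (\<Sum>i\<in>S. (y(b := t)) i *\<^sub>R i)"
      by (subst sum.insert[OF S(2,3)]) simp
    also have "(\<Sum>i\<in>S. (y(b := t)) i *\<^sub>R i) = s y"
      unfolding s_def using S(3) by (intro sum.cong) auto
    finally show ?thesis .
  qed
  have split: "(\<integral>\<^sup>+x. g x \<partial>lborel) = (\<integral>\<^sup>+y. (\<integral>\<^sup>+t. g (t *\<^sub>R b + s y) \<partial>lborel) \<partial>(Pi\<^sub>M S (\<lambda>_. lborel)))"
    if [measurable]: "g \<in> borel_measurable borel" for g :: "'a \<Rightarrow> ennreal"
  proof -
    have "(\<integral>\<^sup>+x. g x \<partial>lborel) = (\<integral>\<^sup>+y. g (\<Sum>i\<in>Basis. y i *\<^sub>R i) \<partial>(Pi\<^sub>M Basis (\<lambda>_. lborel)))"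
      by (subst lborel_eq) (simp add: nn_integral_distr)
    also have "\<dots> = (\<integral>\<^sup>+y. (\<integral>\<^sup>+t. g (\<Sum>i\<in>Basis. (y(b := t)) i *\<^sub>R i) \<partial>lborel) \<partial>(Pi\<^sub>M S (\<lambda>_. lborel)))"
      unfolding S(1) using S by (intro product_nn_integral_insert) auto
    finally show ?thesis by (simp only: eq)
  qed
  have se: "(t *\<^sub>R b + s y) \<bullet> e = y e" for t y
  proof -
    have "s y \<bullet> e = (\<Sum>i\<in>S. y i * (i \<bullet> e))" by (simp add: s_def inner_sum_left)
    also have "\<dots> = (\<Sum>i\<in>S. if i = e then y i else 0)"
      using be by (intro sum.cong) (auto simp: S_def inner_Basis)
    finally show ?thesis using be S by (simp add: inner_add_left inner_Basis)
  qed
  have shear: "(t *\<^sub>R b + s y) + ((t *\<^sub>R b + s y) \<bullet> e) *\<^sub>R b = (y e + 1 * t) *\<^sub>R b + s y" for t y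
    by (simp only: se) (simp add: scaleR_add_left add_ac)
  have "(\<integral>\<^sup>+x. f (x + (x \<bullet> e) *\<^sub>R b) \<partial>lborel)
    = (\<integral>\<^sup>+y. (\<integral>\<^sup>+t. f ((y e + 1 * t) *\<^sub>R b + s y) \<partial>lborel) \<partial>(Pi\<^sub>M S (\<lambda>_. lborel)))"
    by (subst split, measurable) (simp only: shear)
  also have "\<dots> = (\<integral>\<^sup>+y. (\<integral>\<^sup>+t. f (t *\<^sub>R b + s y) \<partial>lborel) \<partial>(Pi\<^sub>M S (\<lambda>_. lborel)))"
  proof (rule nn_integral_cong)
    fix y show "(\<integral>\<^sup>+t. f ((y e + 1 * t) *\<^sub>R b + s y) \<partial>lborel) = (\<integral>\<^sup>+t. f (t *\<^sub>R b + s y) \<partial>lborel)"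
      using nn_integral_real_affine[of "\<lambda>t. f (t *\<^sub>R b + s y)" 1 "y e"] by simp
  qed
  also have "\<dots> = (\<integral>\<^sup>+x. f x \<partial>lborel)" by (simp add: split)
  finally show ?thesis .
qed

lemma prod_Basis_cart: "(\<Prod>b\<in>Basis. g (b::real^'n)) = (\<Prod>i\<in>UNIV. g (axis i 1))"
proof -
  have "(\<Prod>b\<in>Basis. g (b::real^'n)) = prod g (range (\<lambda>i. axis i 1))"
    by (rule arg_cong[of _ _ "prod g"]) (auto simp: Basis_vec_def)
  also have "\<dots> = (\<Prod>i\<in>UNIV. g (axis i 1))"
    by (subst prod.reindex) (auto simp: inj_on_def axis_eq_axis)
  finally show ?thesis .
qed

lemma sum_Basis_cart: "(\<Sum>b\<in>Basis. g (b::real^'n)) = (\<Sum>i\<in>UNIV. g (axis i 1))"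
proof -
  have "(\<Sum>b\<in>Basis. g (b::real^'n)) = sum g (range (\<lambda>i. axis i 1))"
    by (rule arg_cong[of _ _ "sum g"]) (auto simp: Basis_vec_def)
  also have "\<dots> = (\<Sum>i\<in>UNIV. g (axis i 1))"
    by (subst sum.reindex) (auto simp: inj_on_def axis_eq_axis)
  finally show ?thesis .
qed

text \<open>Both sides are multiplicative under composition, so elementary maps suffice: stretchings, swaps of
  two coordinates, and shears.\<close>

lemma nn_integral_lborel_linear:
  fixes T :: "real^'n \<Rightarrow> real^'n" and f :: "real^'n \<Rightarrow> ennreal"
  assumes "linear T" "det (matrix T) \<noteq> 0" "f \<in> borel_measurable borel"
  shows "(\<integral>\<^sup>+x. f x \<partial>lborel) = ennreal \<bar>det (matrix T)\<bar> * (\<integral>\<^sup>+x. f (T x) \<partial>lborel)"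
proof -
  have meas: "linear T \<Longrightarrow> T \<in> borel_measurable borel" for T :: "real^'n \<Rightarrow> real^'n"
    by (intro borel_measurable_continuous_onI linear_continuous_on linear_conv_bounded_linear[THEN iffD1])
  have "det (matrix T) \<noteq> 0 \<longrightarrow> (\<forall>f::real^'n \<Rightarrow> ennreal. f \<in> borel_measurable borel \<longrightarrow>
     (\<integral>\<^sup>+x. f x \<partial>lborel) = ennreal \<bar>det (matrix T)\<bar> * (\<integral>\<^sup>+x. f (T x) \<partial>lborel))"
  proof (rule induct_linear_elementary[OF assms(1)]; intro allI impI)
    fix S T :: "real^'n \<Rightarrow> real^'n" and f :: "real^'n \<Rightarrow> ennreal"
    assume lin: "linear S" "linear T" and [measurable]: "f \<in> borel_measurable borel"
      and S: "det (matrix S) \<noteq> 0 \<longrightarrow> (\<forall>f. f \<in> borel_measurable borel \<longrightarrow>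
        (\<integral>\<^sup>+x. f x \<partial>lborel) = ennreal \<bar>det (matrix S)\<bar> * (\<integral>\<^sup>+x. f (S x) \<partial>lborel))"
      and T: "det (matrix T) \<noteq> 0 \<longrightarrow> (\<forall>f. f \<in> borel_measurable borel \<longrightarrow>
        (\<integral>\<^sup>+x. f x \<partial>lborel) = ennreal \<bar>det (matrix T)\<bar> * (\<integral>\<^sup>+x. f (T x) \<partial>lborel))"
      and nz: "det (matrix (S \<circ> T)) \<noteq> 0"
    have det: "det (matrix (S \<circ> T)) = det (matrix S) * det (matrix T)"
      using lin by (simp add: matrix_compose det_mul)
    note [measurable] = meas[OF lin(1)]
    have "(\<integral>\<^sup>+x. f x \<partial>lborel) = ennreal \<bar>det (matrix S)\<bar> * (\<integral>\<^sup>+x. f (S x) \<partial>lborel)"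
      using S[rule_format, of f] nz det by simp
    also have "(\<integral>\<^sup>+x. f (S x) \<partial>lborel) = ennreal \<bar>det (matrix T)\<bar> * (\<integral>\<^sup>+x. f (S (T x)) \<partial>lborel)"
      using T[rule_format, of "\<lambda>x. f (S x)"] nz det by simp
    finally show "(\<integral>\<^sup>+x. f x \<partial>lborel) = ennreal \<bar>det (matrix (S \<circ> T))\<bar> * (\<integral>\<^sup>+x. f ((S \<circ> T) x) \<partial>lborel)"
      by (simp add: det abs_mult ennreal_mult' mult.assoc)
  next
    fix T :: "real^'n \<Rightarrow> real^'n" and i
    assume T: "linear T" "\<And>x. T x $ i = 0" "det (matrix T) \<noteq> 0"
    have "row i (matrix T) = 0" using T(2) by (simp add: matrix_def row_def vec_eq_iff)
    then have "det (matrix T) = 0" by (rule det_zero_row(1))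
    with T(3) show "(\<integral>\<^sup>+x. f x \<partial>lborel) = ennreal \<bar>det (matrix T)\<bar> * (\<integral>\<^sup>+x. f (T x) \<partial>lborel)" for f
      by simp
  next
    fix c :: "'n \<Rightarrow> real" and f :: "real^'n \<Rightarrow> ennreal"
    let ?T = "\<lambda>x::real^'n. \<chi> i. c i * x $ i"
    assume nz: "det (matrix ?T) \<noteq> 0" and f: "f \<in> borel_measurable borel"
    have mT: "matrix ?T = (\<chi> i j. if i = j then c i else 0)"
      by (simp add: matrix_def vec_eq_iff axis_def)
    have det: "det (matrix ?T) = (\<Prod>i\<in>UNIV. c i)" unfolding mT by (subst det_diagonal) auto
    define c' where "c' b = c (THE i. b = axis i 1)" for b :: "real^'n"
    have c': "c' (axis i 1) = c i" for i by (simp add: c'_def axis_eq_axis)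
    have T: "?T x = 0 + (\<Sum>j\<in>Basis. (c' j * (x \<bullet> j)) *\<^sub>R j)" for x
    proof -
      have "(\<Sum>j\<in>Basis. (c' j * (x \<bullet> j)) *\<^sub>R j) = (\<Sum>i\<in>UNIV. (c i * x $ i) *\<^sub>R axis i 1)"
        by (simp add: sum_Basis_cart c' inner_axis)
      then show ?thesis by (simp add: vec_eq_iff axis_def if_distrib sum.delta cong: if_cong)
    qed
    have "lborel = density (distr lborel borel (\<lambda>x. 0 + (\<Sum>j\<in>Basis. (c' j * (x \<bullet> j)) *\<^sub>R j)))
        (\<lambda>_. \<Prod>j\<in>Basis. \<bar>c' j\<bar>)"
    proof (rule lborel_affine_euclidean)
      fix j :: "real^'n" assume "j \<in> Basis"
      then show "c' j \<noteq> 0" using nz det by (auto simp: Basis_vec_def c')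
    qed
    also have "(\<Prod>j\<in>Basis. \<bar>c' j\<bar>) = \<bar>det (matrix ?T)\<bar>"
      by (simp add: det prod_Basis_cart c' abs_prod)
    finally have *: "lborel = density (distr lborel borel ?T) (\<lambda>_. ennreal \<bar>det (matrix ?T)\<bar>)"
      by (simp add: T)
    have lin: "linear ?T" by (rule linearI) (auto simp: vec_eq_iff algebra_simps)
    note [measurable] = meas[OF lin] f
    show "(\<integral>\<^sup>+x. f x \<partial>lborel) = ennreal \<bar>det (matrix ?T)\<bar> * (\<integral>\<^sup>+x. f (?T x) \<partial>lborel)"
      by (subst *) (simp add: nn_integral_density nn_integral_distr nn_integral_cmult)
  next
    fix m n :: 'n and f :: "real^'n \<Rightarrow> ennreal"
    let ?T = "\<lambda>x::real^'n. \<chi> i. x $ Transposition.transpose m n i"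
    assume mn: "m \<noteq> n" and f: "f \<in> borel_measurable borel"
    have lin: "linear ?T" by (rule linearI) (simp_all add: plus_vec_def scaleR_vec_def)
    note [measurable] = meas[OF lin] f
    have "(\<chi> i j. if Transposition.transpose m n i = j then 1 else 0)
        = (\<chi> i j. if j = Transposition.transpose m n i then 1 else (0::real))"
      by (auto intro!: Cart_lambda_cong)
    then have "matrix ?T = transpose(\<chi> i j. mat 1 $ i $ Transposition.transpose m n j)"
      by (auto simp: matrix_eq transpose_def axis_def mat_def matrix_def)
    then have det: "\<bar>det (matrix ?T)\<bar> = 1"
      by (simp add: det_permute_columns permutes_swap_id sign_swap_id abs_mult)
    have "lborel = distr lborel borel ?T"
    proof (rule lborel_eqI)
      fix l u :: "real^'n" assume "\<And>b. b \<in> Basis \<Longrightarrow> l \<bullet> b \<le> u \<bullet> b"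
      from this[of "axis _ 1"] have lu: "l $ i \<le> u $ i" for i by (simp add: inner_axis axis_in_Basis_iff)
      have pre: "?T -` box l u = box (?T l) (?T u)"
        by (auto simp: mem_box_cart) (metis transpose_involutory)+
      have "emeasure (distr lborel borel ?T) (box l u) = emeasure lborel (box (?T l) (?T u))"
        by (subst emeasure_distr) (simp_all add: pre)
      also have "\<dots> = (\<Prod>b\<in>Basis. (?T u - ?T l) \<bullet> b)"
        using lu by (intro emeasure_lborel_box) (auto simp: Basis_vec_def inner_axis)
      also have "(\<Prod>b\<in>Basis. (?T u - ?T l) \<bullet> b) = (\<Prod>b\<in>Basis. (u - l) \<bullet> b)"
        unfolding prod_Basis_cart
        using prod.permute[OF permutes_swap_id, where S=UNIV and g="\<lambda>i. (u - l)$i", of m n]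
        by (simp add: inner_axis)
      finally show "emeasure (distr lborel borel ?T) (box l u) = (\<Prod>b\<in>Basis. (u - l) \<bullet> b)" .
    qed simp
    then have "(\<integral>\<^sup>+x. f x \<partial>lborel) = (\<integral>\<^sup>+x. f x \<partial>distr lborel borel ?T)" by simp
    also have "\<dots> = (\<integral>\<^sup>+x. f (?T x) \<partial>lborel)" by (simp add: nn_integral_distr)
    finally show "(\<integral>\<^sup>+x. f x \<partial>lborel) = ennreal \<bar>det (matrix ?T)\<bar> * (\<integral>\<^sup>+x. f (?T x) \<partial>lborel)"
      by (simp add: det)
  next
    fix m n :: 'n and f :: "real^'n \<Rightarrow> ennreal"
    let ?T = "\<lambda>x::real^'n. \<chi> i. if i = m then x $ m + x $ n else x $ i"
    assume mn: "m \<noteq> n" and f: "f \<in> borel_measurable borel"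
    have "matrix ?T = (\<chi> k. if k = m then row m (mat 1) + 1 *s row n (mat 1) else row k (mat 1))"
      by (auto simp: matrix_def vec_eq_iff row_def mat_def axis_def)
    then have det: "det (matrix ?T) = 1"
      using det_row_operation[OF mn, of "mat 1" 1] by simp
    have T: "?T x = x + (x \<bullet> axis n 1) *\<^sub>R axis m 1" for x
      by (subst inner_axis) (simp add: vec_eq_iff axis_def)
    have "(\<integral>\<^sup>+x. f x \<partial>lborel) = (\<integral>\<^sup>+x. f (?T x) \<partial>lborel)"
      unfolding T using mn f
      by (intro nn_integral_lborel_shear[symmetric]) (auto simp: axis_in_Basis_iff axis_eq_axis)
    then show "(\<integral>\<^sup>+x. f x \<partial>lborel) = ennreal \<bar>det (matrix ?T)\<bar> * (\<integral>\<^sup>+x. f (?T x) \<partial>lborel)"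
      by (simp add: det)
  qed
  with assms show ?thesis by blast
qed

lemma nn_integral_lborel_affine:
  fixes M :: "real^'n^'n" and f :: "real^'n \<Rightarrow> ennreal"
  assumes "det M \<noteq> 0" and [measurable]: "f \<in> borel_measurable borel"
  shows "(\<integral>\<^sup>+x. f x \<partial>lborel) = ennreal \<bar>det M\<bar> * (\<integral>\<^sup>+x. f (t + M *v x) \<partial>lborel)"
proof -
  have "(\<integral>\<^sup>+x. f x \<partial>lborel) = (\<integral>\<^sup>+x. f (t + x) \<partial>lborel)"
  proof -
    have "(\<integral>\<^sup>+x. f x \<partial>lborel) = (\<integral>\<^sup>+x. f x \<partial>distr lborel borel ((+) t))"
      by (simp add: lborel_distr_plus)
    also have "\<dots> = (\<integral>\<^sup>+x. f (t + x) \<partial>lborel)" by (subst nn_integral_distr) simp_all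
    finally show ?thesis .
  qed
  also have "\<dots> = ennreal \<bar>det M\<bar> * (\<integral>\<^sup>+x. f (t + M *v x) \<partial>lborel)"
    using nn_integral_lborel_linear[of "(*v) M" "\<lambda>x. f (t + x)"] assms by simp
  finally show ?thesis .
qed

section \<open>Quantization with a general cost\<close>

lemma ennreal_less_add_pos: "x < top \<Longrightarrow> 0 < e \<Longrightarrow> x < x + ennreal e"
  by (cases x rule: ennreal_cases) (auto simp: ennreal_less_iff ennreal_plus[symmetric] simp del: ennreal_plus)

lemma INF_add_INF_ge:
  fixes f :: "'a \<Rightarrow> ennreal" and g :: "'b \<Rightarrow> ennreal"
  assumes "\<And>i j. i \<in> I \<Longrightarrow> j \<in> J \<Longrightarrow> x \<le> f i + g j"
  shows "x \<le> (INF i\<in>I. f i) + (INF j\<in>J. g j)"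
proof (rule ennreal_le_epsilon)
  fix e :: real assume fin: "(INF i\<in>I. f i) + (INF j\<in>J. g j) < top" and e: "0 < e"
  have "(INF i\<in>I. f i) < (INF i\<in>I. f i) + ennreal (e / 2)" "(INF j\<in>J. g j) < (INF j\<in>J. g j) + ennreal (e / 2)"
    using fin e by (simp_all add: ennreal_less_add_pos)
  then have "\<exists>i\<in>I. f i < (INF i\<in>I. f i) + ennreal (e / 2)" "\<exists>j\<in>J. g j < (INF j\<in>J. g j) + ennreal (e / 2)"
    unfolding INF_less_iff by blast+
  then obtain i j where "i \<in> I" "f i < (INF i\<in>I. f i) + ennreal (e / 2)"
    "j \<in> J" "g j < (INF j\<in>J. g j) + ennreal (e / 2)" by blast
  then have "x \<le> ((INF i\<in>I. f i) + ennreal (e / 2)) + ((INF j\<in>J. g j) + ennreal (e / 2))"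
    by (intro order_trans[OF assms] add_mono) auto
  also have "\<dots> = (INF i\<in>I. f i) + (INF j\<in>J. g j) + (ennreal (e / 2) + ennreal (e / 2))"
    by (simp add: ac_simps)
  also have "ennreal (e / 2) + ennreal (e / 2) = ennreal e"
    using e by (subst ennreal_plus[symmetric]) auto
  finally show "x \<le> (INF i\<in>I. f i) + (INF j\<in>J. g j) + ennreal e" .
qed

abbreviation cost_over :: "('a \<Rightarrow> 'a \<Rightarrow> ennreal) \<Rightarrow> 'a measure \<Rightarrow> 'a set \<Rightarrow> 'a set \<Rightarrow> ennreal" where
  "cost_over c \<mu> A \<Gamma> \<equiv> \<integral>\<^sup>+\<xi>\<in>A. (INF a\<in>\<Gamma>. c \<xi> a) \<partial>\<mu>"

text \<open>The \<open>r\<close>-th power of the optimal error if the cost is an \<open>r\<close>-th power. For \<open>n = 0\<close> the infimum is over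
  the empty set, so the value is \<open>\<infinity>\<close> and \<open>opt_cost_add\<close> holds without side conditions on \<open>m\<close> and \<open>n\<close>.\<close>

definition opt_cost :: "('a \<Rightarrow> 'a \<Rightarrow> ennreal) \<Rightarrow> 'a set \<Rightarrow> 'a measure \<Rightarrow> 'a set \<Rightarrow> nat \<Rightarrow> ennreal" where
  "opt_cost c V \<mu> A n = (INF \<Gamma>\<in>{\<Gamma>. \<Gamma> \<subseteq> V \<and> finite \<Gamma> \<and> \<Gamma> \<noteq> {} \<and> card \<Gamma> \<le> n}.
      cost_over c \<mu> A \<Gamma>)"

lemma opt_cost_le:
  assumes "\<Gamma> \<subseteq> V" "finite \<Gamma>" "\<Gamma> \<noteq> {}" "card \<Gamma> \<le> n"
  shows "opt_cost c V \<mu> A n \<le> cost_over c \<mu> A \<Gamma>"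
  unfolding opt_cost_def using assms by (intro INF_lower) auto

lemma opt_cost_geI:
  assumes "\<And>\<Gamma>. \<Gamma> \<subseteq> V \<Longrightarrow> finite \<Gamma> \<Longrightarrow> \<Gamma> \<noteq> {} \<Longrightarrow> card \<Gamma> \<le> n
    \<Longrightarrow> y \<le> cost_over c \<mu> A \<Gamma>"
  shows "y \<le> opt_cost c V \<mu> A n"
  unfolding opt_cost_def using assms by (intro INF_greatest) auto

lemma opt_cost_antimono: "antimono (opt_cost c V \<mu> A)"
  unfolding opt_cost_def by (intro antimonoI INF_superset_mono) auto

lemma opt_cost_mono_set: "A \<subseteq> B \<Longrightarrow> opt_cost c V \<mu> A n \<le> opt_cost c V \<mu> B n"
  unfolding opt_cost_def by (intro INF_mono' nn_set_integral_set_mono) auto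

lemma opt_cost_add:
  assumes [measurable]: "A \<in> sets \<mu>" "B \<in> sets \<mu>"
    and [measurable]: "\<And>a. a \<in> V \<Longrightarrow> (\<lambda>\<xi>. c \<xi> a) \<in> borel_measurable \<mu>"
  shows "opt_cost c V \<mu> (A \<union> B) (m + n) \<le> opt_cost c V \<mu> A m + opt_cost c V \<mu> B n"
proof -
  have *: "opt_cost c V \<mu> (A \<union> B) (m + n) \<le> cost_over c \<mu> A \<Gamma> + cost_over c \<mu> B \<Delta>"
    if \<Gamma>: "\<Gamma> \<subseteq> V" "finite \<Gamma>" "\<Gamma> \<noteq> {}" "card \<Gamma> \<le> m"
    and \<Delta>: "\<Delta> \<subseteq> V" "finite \<Delta>" "\<Delta> \<noteq> {}" "card \<Delta> \<le> n" for \<Gamma> \<Delta>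
  proof -
    have [measurable]: "(\<lambda>\<xi>. INF a\<in>\<Gamma>. c \<xi> a) \<in> borel_measurable \<mu>" "(\<lambda>\<xi>. INF a\<in>\<Delta>. c \<xi> a) \<in> borel_measurable \<mu>"
      using \<Gamma> \<Delta> by (auto intro!: borel_measurable_INF countable_finite)
    have "opt_cost c V \<mu> (A \<union> B) (m + n) \<le> cost_over c \<mu> (A \<union> B) (\<Gamma> \<union> \<Delta>)"
      using \<Gamma> \<Delta> card_Un_le[of \<Gamma> \<Delta>] by (intro opt_cost_le) auto
    also have "\<dots> \<le> (\<integral>\<^sup>+\<xi>. (INF a\<in>\<Gamma>. c \<xi> a) * indicator A \<xi> + (INF a\<in>\<Delta>. c \<xi> a) * indicator B \<xi> \<partial>\<mu>)"
    proof (rule nn_integral_mono)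
      fix \<xi>
      have "(INF a\<in>\<Gamma> \<union> \<Delta>. c \<xi> a) \<le> (INF a\<in>\<Gamma>. c \<xi> a)" "(INF a\<in>\<Gamma> \<union> \<Delta>. c \<xi> a) \<le> (INF a\<in>\<Delta>. c \<xi> a)"
        by (auto intro: INF_superset_mono)
      then show "(INF a\<in>\<Gamma> \<union> \<Delta>. c \<xi> a) * indicator (A \<union> B) \<xi>
          \<le> (INF a\<in>\<Gamma>. c \<xi> a) * indicator A \<xi> + (INF a\<in>\<Delta>. c \<xi> a) * indicator B \<xi>"
        by (auto simp: indicator_def intro: add_increasing2)
    qed
    also have "\<dots> = cost_over c \<mu> A \<Gamma> + cost_over c \<mu> B \<Delta>"
      by (rule nn_integral_add) measurable
    finally show ?thesis .
  qed
  show ?thesis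
    unfolding opt_cost_def[of _ _ _ A] opt_cost_def[of _ _ _ B] by (rule INF_add_INF_ge) (use * in auto)
qed

section \<open>Grids of cubes\<close>

abbreviation cube :: "real^'n \<Rightarrow> real \<Rightarrow> (real^'n) set" where
  "cube l s \<equiv> cbox l (l + (\<chi> i. s))"

definition cell :: "real \<Rightarrow> ('n \<Rightarrow> int) \<Rightarrow> (real^'n) set" where
  "cell s z = {x. \<forall>i. s * of_int (z i) \<le> x $ i \<and> x $ i < s * (of_int (z i) + 1)}"

definition corner :: "real \<Rightarrow> ('n \<Rightarrow> int) \<Rightarrow> real^'n" where
  "corner s z = (\<chi> i. s * of_int (z i))"

definition grid_index :: "real \<Rightarrow> (real^'n) \<Rightarrow> ('n \<Rightarrow> int)" where
  "grid_index s x = (\<lambda>i. \<lfloor>x $ i / s\<rfloor>)"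

lemma mem_cell_iff: "0 < s \<Longrightarrow> x \<in> cell s z \<longleftrightarrow> z = grid_index s x"
  unfolding cell_def grid_index_def fun_eq_iff
  by (auto simp: eq_commute[of "z _"] floor_eq_iff field_simps)

lemma cell_sets [measurable]: "cell s z \<in> sets borel"
  unfolding cell_def by measurable

lemma disjoint_cells: "0 < s \<Longrightarrow> disjoint_family (cell s)"
  by (auto simp: disjoint_family_on_def mem_cell_iff)

lemma box_subset_cell: "box (corner s z) (corner s z + (\<chi> i. s)) \<subseteq> cell s z"
  and cell_subset_cbox: "cell s z \<subseteq> cube (corner s z) s"
  unfolding cell_def corner_def by (auto simp: mem_box_cart algebra_simps less_imp_le)

lemma norm_diff_cbox_le:
  fixes x y :: "real^'n"
  assumes "x \<in> cube l s" "y \<in> cube l s"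
  shows "norm (x - y) \<le> real CARD('n) * s"
proof -
  have "norm (x - y) \<le> (\<Sum>i\<in>UNIV. \<bar>(x - y) $ i\<bar>)" by (rule norm_le_l1_cart)
  also have "\<dots> \<le> (\<Sum>i\<in>(UNIV::'n set). s)"
  proof (rule sum_mono)
    fix i
    have "l $ i \<le> x $ i" "x $ i \<le> l $ i + s" "l $ i \<le> y $ i" "y $ i \<le> l $ i + s"
      using assms by (auto simp: mem_box_cart)
    then show "\<bar>(x - y) $ i\<bar> \<le> s" by auto
  qed
  finally show ?thesis by simp
qed

lemma emeasure_cell_ge:
  assumes "0 \<le> s"
  shows "ennreal (s ^ CARD('n)) \<le> emeasure lborel (cell s z :: (real^'n) set)"
proof -
  have "emeasure lborel (box (corner s z) (corner s z + (\<chi> i. s)) :: (real^'n) set)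
     = (\<Prod>b\<in>Basis. ((corner s z + (\<chi> i. s)) - corner s z :: real^'n) \<bullet> b)"
    using assms by (intro emeasure_lborel_box) (auto simp: Basis_vec_def inner_axis)
  also have "(\<Prod>b\<in>Basis. ((corner s z + (\<chi> i. s)) - corner s z :: real^'n) \<bullet> b) = s ^ CARD('n)"
    by (simp add: prod_Basis_cart inner_axis)
  finally have "ennreal (s ^ CARD('n)) = emeasure lborel (box (corner s z) (corner s z + (\<chi> i. s)) :: (real^'n) set)" by simp
  also have "\<dots> \<le> emeasure lborel (cell s z)" by (intro emeasure_mono box_subset_cell) auto
  finally show ?thesis .
qed

text \<open>Cells of a fine grid that meet \<open>K\<close> lie in a small open neighborhood of \<open>K\<close> whose measure is still below
  \<open>v\<close>. They are disjoint, so comparing volumes bounds their number, and in particular it is finite.\<close>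

lemma compact_cell_cover:
  fixes K W :: "(real^'n) set"
  assumes K: "compact K" "K \<subseteq> W" "open W" and v: "emeasure lborel K < ennreal v"
  obtains s0 where "0 < s0"
    "\<And>s. 0 < s \<Longrightarrow> s < s0 \<Longrightarrow> finite (grid_index s ` K) \<and> real (card (grid_index s ` K)) * s ^ CARD('n) \<le> v
       \<and> (\<forall>z\<in>grid_index s ` K. cube (corner s z) s \<subseteq> W)"
proof -
  have v0: "0 < v" using v by (cases "0 < v") (auto simp: ennreal_neg)
  have K_sets: "K \<in> sets borel" using K by (simp add: borel_compact)
  obtain e where e: "0 < e" "emeasure lborel K + ennreal e < ennreal v"
  proof -
    obtain k where k: "emeasure lborel K = ennreal k" "0 \<le> k" "k < v"
      using v by (cases "emeasure lborel K" rule: ennreal_cases) (auto simp: ennreal_less_iff)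
    show ?thesis
      by (rule that[of "(v - k)/2"]) (use k v0 in \<open>auto simp: ennreal_plus[symmetric] ennreal_less_iff field_simps simp del: ennreal_plus\<close>)
  qed
  obtain G where G: "open G" "K \<subseteq> G" "emeasure lborel (G - K) < ennreal e"
    using outer_regular_lborel[OF K_sets e(1)] by blast
  have OK: "emeasure lborel G < ennreal v"
  proof -
    have "emeasure lborel G = emeasure lborel K + emeasure lborel (G - K)"
      using G K_sets by (subst plus_emeasure) (auto intro!: arg_cong[where f="emeasure lborel"])
    also have "\<dots> \<le> emeasure lborel K + ennreal e" using G by (intro add_left_mono) auto
    finally show ?thesis using e by auto
  qed
  obtain \<epsilon> where \<epsilon>: "\<epsilon> > 0" "(\<Union>x\<in>K. ball x \<epsilon>) \<subseteq> G \<inter> W"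
    using compact_subset_open_imp_ball_epsilon_subset[OF K(1), of "G \<inter> W"] K G by auto
  show ?thesis
  proof (rule that[of "\<epsilon> / CARD('n)"])
    show "0 < \<epsilon> / CARD('n)" using \<epsilon> by simp
    fix s :: real assume s: "0 < s" "s < \<epsilon> / CARD('n)"
    have sub: "cube (corner s z) s \<subseteq> G \<inter> W" if z: "z \<in> grid_index s ` K" for z
    proof
      fix y assume y: "y \<in> cube (corner s z) s"
      obtain x where x: "x \<in> K" "z = grid_index s x" using z by auto
      then have "x \<in> cell s z" using s by (simp add: mem_cell_iff)
      then have "norm (x - y) \<le> real CARD('n) * s" using y cell_subset_cbox by (intro norm_diff_cbox_le) auto
      also have "\<dots> < \<epsilon>" using s by (simp add: field_simps)
      finally have "y \<in> ball x \<epsilon>" by (simp add: dist_norm)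
      then show "y \<in> G \<inter> W" using \<epsilon> x by blast
    qed
    have bound: "real (card Z) * s ^ CARD('n) \<le> v" if Z: "finite Z" "Z \<subseteq> grid_index s ` K" for Z
    proof -
      have "ennreal (real (card Z) * s ^ CARD('n)) = (\<Sum>z\<in>Z. ennreal (s ^ CARD('n)))"
        using s by (simp add: ennreal_mult ennreal_of_nat_eq_real_of_nat)
      also have "\<dots> \<le> (\<Sum>z\<in>Z. emeasure lborel (cell s z :: (real^'n) set))"
        using s by (intro sum_mono emeasure_cell_ge) auto
      also have "\<dots> = emeasure lborel (\<Union>z\<in>Z. cell s z :: (real^'n) set)"
        using Z by (intro sum_emeasure disjoint_family_on_mono[OF subset_UNIV disjoint_cells[OF s(1)]]) auto
      also have "\<dots> \<le> emeasure lborel G"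
      proof (rule emeasure_mono)
        show "(\<Union>z\<in>Z. cell s z) \<subseteq> G"
        proof (rule UN_least)
          fix z assume "z \<in> Z"
          with Z(2) have "z \<in> grid_index s ` K" by (rule subsetD)
          with sub[of z] cell_subset_cbox[of s z] show "cell s z \<subseteq> G" by blast
        qed
      qed (use G in simp)
      also have "\<dots> \<le> ennreal v" using OK by simp
      finally show ?thesis using v0 by (simp add: ennreal_le_iff)
    qed
    have "finite (grid_index s ` K)"
    proof (rule ccontr)
      assume inf: "infinite (grid_index s ` K)"
      obtain N :: nat where N: "v < real N * s ^ CARD('n)"
        using reals_Archimedean3[of "s ^ CARD('n)"] s by auto
      obtain Z where "finite Z" "card Z = N" "Z \<subseteq> grid_index s ` K"
        using infinite_arbitrarily_large[OF inf] by metis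
      with bound[of Z] N show False by auto
    qed
    with bound sub show "finite (grid_index s ` K) \<and> real (card (grid_index s ` K)) * s ^ CARD('n) \<le> v
       \<and> (\<forall>z\<in>grid_index s ` K. cube (corner s z) s \<subseteq> W)"
      by blast
  qed
qed

section \<open>The Euclidean cost on compact sets\<close>

definition ecost :: "real \<Rightarrow> 'a::real_normed_vector \<Rightarrow> 'a \<Rightarrow> ennreal" where
  "ecost r \<xi> a = ennreal (norm (\<xi> - a) powr r)"

lemma ecost_measurable [measurable]: "(\<lambda>\<xi>. ecost r \<xi> (a::'a::euclidean_space)) \<in> borel_measurable borel"
  unfolding ecost_def by measurable

lemma ennreal_Min_eq_INF:
  assumes "finite \<Gamma>" "\<Gamma> \<noteq> {}"
  shows "ennreal (Min (f ` \<Gamma>)) = (INF a\<in>\<Gamma>. ennreal (f a))"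
proof -
  have "ennreal (Min (f ` \<Gamma>)) = Min (ennreal ` f ` \<Gamma>)"
    using assms by (intro mono_Min_commute monoI ennreal_leI) auto
  also have "\<dots> = (INF a\<in>\<Gamma>. ennreal (f a))"
    using assms by (subst Min_Inf) (auto simp: image_image)
  finally show ?thesis .
qed

lemma zador_const_eq:
  "zador_const TYPE('n::finite) r =
     (INF n\<in>{1..}. ennreal (real n powr (r / CARD('n))) * opt_cost (ecost r) (UNIV :: (real^'n) set) lborel (cbox 0 1) n)"
  unfolding zador_const_def opt_cost_def
proof (intro INF_cong refl arg_cong2[where f = "(*)"])
  fix n :: nat
  show "{\<Gamma> :: (real^'n) set. finite \<Gamma> \<and> 1 \<le> card \<Gamma> \<and> card \<Gamma> \<le> n}
    = {\<Gamma>. \<Gamma> \<subseteq> UNIV \<and> finite \<Gamma> \<and> \<Gamma> \<noteq> {} \<and> card \<Gamma> \<le> n}"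
    by (auto simp: Suc_le_eq card_gt_0_iff)
  fix \<Gamma> :: "(real^'n) set" assume "\<Gamma> \<in> {\<Gamma>. \<Gamma> \<subseteq> UNIV \<and> finite \<Gamma> \<and> \<Gamma> \<noteq> {} \<and> card \<Gamma> \<le> n}"
  then show "(\<integral>\<^sup>+\<xi>\<in>cbox 0 1. ennreal (Min ((\<lambda>a. norm (\<xi> - a) powr r) ` \<Gamma>)) \<partial>lborel)
    = cost_over (ecost r) lborel (cbox 0 1) \<Gamma>"
    by (simp add: ennreal_Min_eq_INF ecost_def)
qed

lemma zador_const_finite:
  assumes "0 < r"
  shows "zador_const TYPE('n::finite) r < top"
proof -
  have "zador_const TYPE('n) r \<le> ennreal (real 1 powr (r / CARD('n))) * opt_cost (ecost r) (UNIV :: (real^'n) set) lborel (cbox 0 1) 1"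
    unfolding zador_const_eq by (intro INF_lower) auto
  also have "\<dots> = opt_cost (ecost r) (UNIV :: (real^'n) set) lborel (cbox 0 1) 1" by simp
  also have "\<dots> \<le> cost_over (ecost r) lborel (cbox 0 1) {0::real^'n}"
    by (intro opt_cost_le) auto
  also have "\<dots> \<le> (\<integral>\<^sup>+\<xi>\<in>cbox 0 (1::real^'n). ennreal (real CARD('n) powr r) \<partial>lborel)"
  proof (rule nn_integral_mono)
    fix \<xi> :: "real^'n"
    show "(INF a\<in>{0}. ecost r \<xi> a) * indicator (cbox 0 1) \<xi> \<le> ennreal (real CARD('n) powr r) * indicator (cbox 0 1) \<xi>"
    proof (cases "\<xi> \<in> cbox 0 1")
      case True
      then have "norm (\<xi> - 0) \<le> real CARD('n) * 1"
        by (intro norm_diff_cbox_le[of _ 0]) (auto simp: mem_box_cart)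
      then show ?thesis using True assms by (auto simp: ecost_def intro!: ennreal_leI powr_mono2)
    qed simp
  qed
  also have "\<dots> = ennreal (real CARD('n) powr r) * emeasure lborel (cbox 0 (1::real^'n))"
    by (simp add: nn_integral_cmult_indicator)
  also have "\<dots> < top"
    using emeasure_lborel_cbox_finite[of 0 "1::real^'n"] by (simp add: ennreal_mult_less_top)
  finally show ?thesis .
qed

lemma opt_cost_cells:
  assumes Z: "finite Z" "Z \<noteq> {}" "K \<subseteq> (\<Union>z\<in>Z. C z)"
    and \<Gamma>: "\<And>z. z \<in> Z \<Longrightarrow> \<Gamma> z \<subseteq> W \<and> finite (\<Gamma> z) \<and> \<Gamma> z \<noteq> {} \<and> card (\<Gamma> z) \<le> n0"
    and n: "card Z * n0 \<le> n"
    and meas: "\<And>z. z \<in> Z \<Longrightarrow> C z \<in> sets \<mu>" "\<And>a. a \<in> W \<Longrightarrow> (\<lambda>\<xi>. c \<xi> a) \<in> borel_measurable \<mu>"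
  shows "opt_cost c W \<mu> K n \<le> (\<Sum>z\<in>Z. \<integral>\<^sup>+\<xi>\<in>C z. (INF a\<in>\<Gamma> z. c \<xi> a) \<partial>\<mu>)"
proof -
  let ?G = "\<Union>z\<in>Z. \<Gamma> z"
  have "card ?G \<le> (\<Sum>z\<in>Z. card (\<Gamma> z))" by (rule card_UN_le[OF Z(1)])
  also have "\<dots> \<le> card Z * n0" using \<Gamma> sum_bounded_above[of Z "\<lambda>z. card (\<Gamma> z)" n0] by auto
  finally have card: "card ?G \<le> n" using n by simp
  have "opt_cost c W \<mu> K n \<le> cost_over c \<mu> K ?G"
    using Z \<Gamma> card by (intro opt_cost_le) auto
  also have "\<dots> \<le> (\<integral>\<^sup>+\<xi>. (\<Sum>z\<in>Z. (INF a\<in>\<Gamma> z. c \<xi> a) * indicator (C z) \<xi>) \<partial>\<mu>)"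
  proof (rule nn_integral_mono)
    fix \<xi>
    show "(INF a\<in>?G. c \<xi> a) * indicator K \<xi> \<le> (\<Sum>z\<in>Z. (INF a\<in>\<Gamma> z. c \<xi> a) * indicator (C z) \<xi>)"
    proof (cases "\<xi> \<in> K")
      case True
      then obtain z where z: "z \<in> Z" "\<xi> \<in> C z" using Z(3) by auto
      have "(INF a\<in>?G. c \<xi> a) * indicator K \<xi> \<le> (INF a\<in>\<Gamma> z. c \<xi> a) * indicator (C z) \<xi>"
        using True z by (auto intro!: INF_superset_mono)
      also have "\<dots> \<le> (\<Sum>z\<in>Z. (INF a\<in>\<Gamma> z. c \<xi> a) * indicator (C z) \<xi>)"
        using Z(1) z(1) by (intro member_le_sum) auto
      finally show ?thesis .
    qed simp
  qed
  also have "\<dots> = (\<Sum>z\<in>Z. \<integral>\<^sup>+\<xi>\<in>C z. (INF a\<in>\<Gamma> z. c \<xi> a) \<partial>\<mu>)"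
  proof (rule nn_integral_sum)
    fix z assume z: "z \<in> Z"
    have [measurable]: "(\<lambda>\<xi>. INF a\<in>\<Gamma> z. c \<xi> a) \<in> borel_measurable \<mu>"
      using \<Gamma>[OF z] meas(2) by (intro borel_measurable_INF countable_finite) auto
    have [measurable]: "C z \<in> sets \<mu>" using z by (rule meas)
    show "(\<lambda>\<xi>. (INF a\<in>\<Gamma> z. c \<xi> a) * indicator (C z) \<xi>) \<in> borel_measurable \<mu>" by measurable
  qed
  finally show ?thesis .
qed

lemma INF_cmult_ennreal:
  assumes "0 < C"
  shows "(INF a\<in>A. ennreal C * f a) = ennreal C * (INF a\<in>A. f a)"
proof (rule antisym)
  have inv: "ennreal (1 / C) * (ennreal C * x) = x" "ennreal C * (ennreal (1 / C) * x) = x" for x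
    using assms by (simp_all add: mult.assoc[symmetric] ennreal_mult[symmetric])
  have "ennreal (1 / C) * (INF a\<in>A. ennreal C * f a) \<le> (INF a\<in>A. f a)"
  proof (rule INF_greatest)
    fix a assume "a \<in> A"
    then have "ennreal (1 / C) * (INF a\<in>A. ennreal C * f a) \<le> ennreal (1 / C) * (ennreal C * f a)"
      by (intro mult_left_mono INF_lower) auto
    then show "ennreal (1 / C) * (INF a\<in>A. ennreal C * f a) \<le> f a" by (simp add: inv)
  qed
  then have "ennreal C * (ennreal (1 / C) * (INF a\<in>A. ennreal C * f a)) \<le> ennreal C * (INF a\<in>A. f a)"
    by (rule mult_left_mono) simp
  then show "(INF a\<in>A. ennreal C * f a) \<le> ennreal C * (INF a\<in>A. f a)" by (simp only: inv)
qed (auto intro!: INF_greatest mult_left_mono INF_lower)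

lemma nn_set_integral_mono_on:
  "(\<And>x. x \<in> A \<Longrightarrow> f x \<le> g x) \<Longrightarrow> (\<integral>\<^sup>+x\<in>A. f x \<partial>M) \<le> (\<integral>\<^sup>+x\<in>A. g x \<partial>M)"
  by (intro nn_integral_mono) (auto simp: indicator_def)

lemma nn_integral_lborel_scale:
  fixes f :: "real^'n \<Rightarrow> ennreal"
  assumes s: "0 < s" and [measurable]: "f \<in> borel_measurable borel"
  shows "(\<integral>\<^sup>+x. f x \<partial>lborel) = ennreal (s ^ CARD('n)) * (\<integral>\<^sup>+x. f (t + s *\<^sub>R x) \<partial>lborel)"
proof -
  have det: "det (mat s :: real^'n^'n) = s ^ CARD('n)"
    by (subst det_diagonal) (auto simp: mat_def)
  have "(mat s :: real^'n^'n) *v x = s *\<^sub>R x" for x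
    by (simp add: vec_eq_iff matrix_vector_mult_def mat_def if_distrib[of "\<lambda>c. c * _"] cong: if_cong)
  with nn_integral_lborel_affine[of "mat s :: real^'n^'n" f t] s det show ?thesis by simp
qed

lemma cell_cost_scale:
  fixes \<Gamma> :: "(real^'n) set"
  assumes s: "0 < s" and fin: "finite \<Gamma>"
  shows "(\<integral>\<^sup>+\<xi>\<in>cube l s. (INF a\<in>(\<lambda>a. l + s *\<^sub>R a) ` \<Gamma>. ecost r \<xi> a) \<partial>lborel)
    = ennreal (s ^ CARD('n) * s powr r) * cost_over (ecost r) lborel (cbox 0 1) \<Gamma>"
proof -
  have s': "0 < s powr r" using s by simp
  have [measurable]: "(\<lambda>\<xi>. INF a\<in>\<Gamma>. ecost r \<xi> a) \<in> borel_measurable borel"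
    if "finite \<Gamma>" for \<Gamma> :: "(real^'n) set" using that by (intro borel_measurable_INF countable_finite) auto
  have ind: "indicator (cube l s) (l + s *\<^sub>R x) = (indicator (cbox 0 1) x :: ennreal)" for x :: "real^'n"
    using s by (auto simp: indicator_def mem_box_cart zero_le_mult_iff)
  have cost: "ecost r (l + s *\<^sub>R x) (l + s *\<^sub>R a) = ennreal (s powr r) * ecost r x a" for x a :: "real^'n"
    using s by (simp add: ecost_def scaleR_diff_right[symmetric] powr_mult ennreal_mult)
  have "(\<integral>\<^sup>+\<xi>\<in>cube l s. (INF a\<in>(\<lambda>a. l + s *\<^sub>R a) ` \<Gamma>. ecost r \<xi> a) \<partial>lborel)
    = ennreal (s ^ CARD('n)) * (\<integral>\<^sup>+x. (INF a\<in>(\<lambda>a. l + s *\<^sub>R a) ` \<Gamma>. ecost r (l + s *\<^sub>R x) a)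
        * indicator (cube l s) (l + s *\<^sub>R x) \<partial>lborel)"
    using s fin by (intro nn_integral_lborel_scale) (auto intro!: borel_measurable_times)
  also have "(\<lambda>x. (INF a\<in>(\<lambda>a. l + s *\<^sub>R a) ` \<Gamma>. ecost r (l + s *\<^sub>R x) a)
        * indicator (cube l s) (l + s *\<^sub>R x))
      = (\<lambda>x. ennreal (s powr r) * ((INF a\<in>\<Gamma>. ecost r x a) * indicator (cbox 0 1) x))"
    by (simp add: image_image ind cost INF_cmult_ennreal[OF s'] mult.assoc)
  also have "ennreal (s ^ CARD('n)) * (\<integral>\<^sup>+x. ennreal (s powr r) * ((INF a\<in>\<Gamma>. ecost r x a) * indicator (cbox 0 1) x) \<partial>lborel)
     = ennreal (s ^ CARD('n) * s powr r) * cost_over (ecost r) lborel (cbox 0 1) \<Gamma>"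
    using s fin by (subst nn_integral_cmult) (auto simp: ennreal_mult mult.assoc)
  finally show ?thesis .
qed

text \<open>If a set is covered by \<open>v / s\<^sup>d\<close> cells with \<open>n0\<close> centers each, this mesh uses up \<open>n\<close> centers.\<close>

lemma mesh_size:
  fixes v :: real and n0 :: nat
  assumes v: "0 < v" and n0: "0 < n0" and d: "0 < d"
  defines "s \<equiv> \<lambda>n. (v * real n0 / real n) powr (1 / real d)"
  shows "\<And>n. 0 < n \<Longrightarrow> 0 < s n"
    and "\<And>n. 0 < n \<Longrightarrow> s n ^ d = v * real n0 / real n"
    and "\<And>n. 0 < n \<Longrightarrow> s n powr r = (v * real n0) powr (r / d) * real n powr - (r / d)"
    and "\<And>s0. 0 < s0 \<Longrightarrow> \<forall>\<^sub>F n in sequentially. s n < s0"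
proof -
  show pos: "0 < s n" if "0 < n" for n using that assms by simp
  show pow: "s n ^ d = v * real n0 / real n" if "0 < n" for n
    using that assms pos[OF that] by (simp add: powr_realpow[symmetric] powr_powr)
  show "s n powr r = (v * real n0) powr (r / d) * real n powr - (r / d)" if "0 < n" for n
    using that assms by (simp add: powr_powr powr_divide powr_minus_divide)
  have "(\<lambda>n. (v * real n0 / real n) powr (1 / real d)) \<longlonglongrightarrow> 0 powr (1 / real d)"
    using assms by (intro tendsto_powr' tendsto_divide_0[OF tendsto_const] filterlim_at_top_imp_at_infinity filterlim_real_sequentially) auto
  then have "s \<longlonglongrightarrow> 0" using assms by simp
  then show "\<forall>\<^sub>F n in sequentially. s n < s0" if "0 < s0" for s0
    using that by (rule order_tendstoD(2))
qed

text \<open>Every cell that meets \<open>K\<close> gets a scaled copy of a nearly optimal quantizer \<open>\<Gamma>\<close> of the unit cube with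
  \<open>n0\<close> points. The mesh tends to 0 with \<open>n\<close>, so the error is governed by \<open>Q\<close> and the total
  volume of the cells, which is close to that of \<open>K\<close>.\<close>

lemma rate_sup_compact:
  fixes K W :: "(real^'n) set"
  assumes r: "0 < r" and Q: "zador_const TYPE('n) r = ennreal Q" "0 \<le> Q"
    and K: "compact K" "K \<subseteq> W" "open W" "W \<noteq> {}"
  defines "q \<equiv> r / real CARD('n)"
  shows "rate_sup q (opt_cost (ecost r) W lborel K) \<le> ennreal (Q * measure lborel K powr (1 + q))"
proof -
  have q: "0 < q" using r by (simp add: q_def)
  have em: "emeasure lborel K = ennreal (measure lborel K)"
    using emeasure_compact_finite[OF K(1)] by (intro emeasure_eq_ennreal_measure) auto
  have bound: "rate_sup q (opt_cost (ecost r) W lborel K) \<le> ennreal ((Q + \<eta>) * (measure lborel K + \<eta>) powr (1 + q))"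
    if \<eta>: "0 < \<eta>" for \<eta>
  proof (rule rate_sup_leI)
    define v where "v = measure lborel K + \<eta>"
    have v: "0 < v" "emeasure lborel K < ennreal v" using \<eta> by (auto simp: v_def em ennreal_less_iff add_nonneg_pos)
    obtain s0 where s0: "0 < s0"
      "\<And>s. 0 < s \<Longrightarrow> s < s0 \<Longrightarrow> finite (grid_index s ` K) \<and> real (card (grid_index s ` K)) * s ^ CARD('n) \<le> v
         \<and> (\<forall>z\<in>grid_index s ` K. cube (corner s z) s \<subseteq> W)"
      using compact_cell_cover[OF K(1-3) v(2)] by metis
    have "zador_const TYPE('n) r < ennreal (Q + \<eta>)" using Q \<eta> by (simp add: ennreal_less_iff del: ennreal_plus)
    then obtain n0 :: nat where n0: "1 \<le> n0"
      "ennreal (real n0 powr q) * opt_cost (ecost r) (UNIV :: (real^'n) set) lborel (cbox 0 1) n0 < ennreal (Q + \<eta>)"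
      unfolding zador_const_eq INF_less_iff q_def by auto
    have n0q: "0 < real n0 powr q" using n0 by simp
    have "opt_cost (ecost r) (UNIV :: (real^'n) set) lborel (cbox 0 1) n0 < ennreal ((Q + \<eta>) / real n0 powr q)"
      using n0 n0q Q \<eta>
      by (cases "opt_cost (ecost r) (UNIV :: (real^'n) set) lborel (cbox 0 1) n0" rule: ennreal_cases)
         (auto simp: ennreal_mult[symmetric] ennreal_less_iff field_simps ennreal_mult_top simp del: ennreal_plus)
    then obtain \<Gamma>' :: "(real^'n) set" where \<Gamma>': "finite \<Gamma>'" "\<Gamma>' \<noteq> {}" "card \<Gamma>' \<le> n0"
      "cost_over (ecost r) lborel (cbox 0 1) \<Gamma>' < ennreal ((Q + \<eta>) / real n0 powr q)"
      unfolding opt_cost_def INF_less_iff by auto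
    \<comment> \<open>Projecting the centers onto the cube keeps them close to the cell and lowers the cost.\<close>
    define \<Gamma> where "\<Gamma> = clamp 0 1 ` \<Gamma>'"
    have zo: "\<forall>i\<in>Basis. (0::real^'n) \<bullet> i \<le> 1 \<bullet> i" by (auto simp: Basis_vec_def inner_axis)
    have \<Gamma>: "finite \<Gamma>" "\<Gamma> \<noteq> {}" "card \<Gamma> \<le> n0" "\<Gamma> \<subseteq> cbox 0 1"
      using \<Gamma>' card_image_le[of \<Gamma>' "clamp 0 1"] zo by (auto simp: \<Gamma>_def)
    have "cost_over (ecost r) lborel (cbox 0 1) \<Gamma> \<le> cost_over (ecost r) lborel (cbox 0 1) \<Gamma>'"
    proof (rule nn_set_integral_mono_on)
      fix \<xi> :: "real^'n" assume \<xi>: "\<xi> \<in> cbox 0 1"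
      have "ecost r \<xi> (clamp 0 1 a) \<le> ecost r \<xi> a" for a
        using dist_clamps_le_dist_args[of 0 1 \<xi> a] \<xi> r
        by (auto simp: ecost_def dist_norm intro!: ennreal_leI powr_mono2)
      then show "(INF a\<in>\<Gamma>. ecost r \<xi> a) \<le> (INF a\<in>\<Gamma>'. ecost r \<xi> a)"
        unfolding \<Gamma>_def image_image by (intro INF_mono') auto
    qed
    also note \<Gamma>'(4)
    finally have I0: "cost_over (ecost r) lborel (cbox 0 1) \<Gamma> \<le> ennreal ((Q + \<eta>) / real n0 powr q)"
      by simp
    define s where "s n = (v * real n0 / real n) powr (1 / real CARD('n))" for n
    note mesh = mesh_size[of v n0 "CARD('n)", OF v(1) _ zero_less_card_finite, folded s_def]
    have "\<forall>\<^sub>F n in sequentially. s n < s0" using n0 s0 by (intro mesh(4)) auto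
    then show "\<forall>\<^sub>F n in sequentially. opt_cost (ecost r) W lborel K n
        \<le> ennreal ((Q + \<eta>) * (measure lborel K + \<eta>) powr (1 + q) * real n powr - q)"
      using eventually_gt_at_top[of 0]
    proof eventually_elim
      case (elim n)
      let ?s = "s n"
      let ?Z = "grid_index ?s ` K"
      have s: "0 < ?s" "?s ^ CARD('n) = v * real n0 / real n"
          "?s powr r = (v * real n0) powr q * real n powr - q"
        using elim n0 mesh(1)[of n] mesh(2)[of n] mesh(3)[of n r] by (auto simp: q_def)
      have Z: "finite ?Z" "real (card ?Z) * ?s ^ CARD('n) \<le> v"
        "\<And>z. z \<in> ?Z \<Longrightarrow> cube (corner ?s z) ?s \<subseteq> W"
        using s0(2)[OF s(1) elim(1)] by auto
      show ?case
      proof (cases "K = {}")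
        case True
        obtain w where "w \<in> W" using K by auto
        then have "opt_cost (ecost r) W lborel K n \<le> cost_over (ecost r) lborel K {w}"
          using elim by (intro opt_cost_le) auto
        then show ?thesis by (simp add: True)
      next
        case False
        have "real (card ?Z * n0) \<le> real n"
          using Z(2) s(2) v n0 elim by (simp add: field_simps)
        then have cardZ: "card ?Z * n0 \<le> n" by (simp only: of_nat_le_iff)
        have "opt_cost (ecost r) W lborel K n \<le> (\<Sum>z\<in>?Z. \<integral>\<^sup>+\<xi>\<in>cube (corner ?s z) ?s.
            (INF a\<in>(\<lambda>a. corner ?s z + ?s *\<^sub>R a) ` \<Gamma>. ecost r \<xi> a) \<partial>lborel)"
        proof (rule opt_cost_cells[OF Z(1) _ _ _ cardZ])
          show "K \<subseteq> (\<Union>z\<in>?Z. cube (corner ?s z) ?s)"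
            using cell_subset_cbox mem_cell_iff[OF s(1)] by fastforce
          fix z assume z: "z \<in> ?Z"
          have "corner ?s z + ?s *\<^sub>R a \<in> cube (corner ?s z) ?s" if "a \<in> \<Gamma>" for a
            using that \<Gamma>(4) s(1) by (auto simp: mem_box_cart)
          then have "(\<lambda>a. corner ?s z + ?s *\<^sub>R a) ` \<Gamma> \<subseteq> W" using Z(3)[OF z] by blast
          then show "(\<lambda>a. corner ?s z + ?s *\<^sub>R a) ` \<Gamma> \<subseteq> W \<and> finite ((\<lambda>a. corner ?s z + ?s *\<^sub>R a) ` \<Gamma>)
              \<and> (\<lambda>a. corner ?s z + ?s *\<^sub>R a) ` \<Gamma> \<noteq> {} \<and> card ((\<lambda>a. corner ?s z + ?s *\<^sub>R a) ` \<Gamma>) \<le> n0"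
            using \<Gamma> card_image_le[OF \<Gamma>(1), of "\<lambda>a. corner ?s z + ?s *\<^sub>R a"] by auto
        qed (use False in auto)
        also have "\<dots> \<le> (\<Sum>z\<in>?Z. ennreal (?s ^ CARD('n) * ?s powr r) * ennreal ((Q + \<eta>) / real n0 powr q))"
          unfolding cell_cost_scale[OF s(1) \<Gamma>(1)] by (intro sum_mono mult_left_mono I0) auto
        also have "\<dots> = ennreal (real (card ?Z) * (?s ^ CARD('n) * ?s powr r * ((Q + \<eta>) / real n0 powr q)))"
          using s(1) Q \<eta> by (simp add: ennreal_mult ennreal_of_nat_eq_real_of_nat mult.assoc
              del: times_divide_eq_right)
        also have "\<dots> \<le> ennreal (v * (?s powr r * ((Q + \<eta>) / real n0 powr q)))"
        proof (rule ennreal_leI)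
          have "real (card ?Z) * (?s ^ CARD('n) * ?s powr r * ((Q + \<eta>) / real n0 powr q))
            = (real (card ?Z) * ?s ^ CARD('n)) * (?s powr r * ((Q + \<eta>) / real n0 powr q))" by simp
          also have "\<dots> \<le> v * (?s powr r * ((Q + \<eta>) / real n0 powr q))"
            using Z(2) Q \<eta> by (intro mult_right_mono) auto
          finally show "real (card ?Z) * (?s ^ CARD('n) * ?s powr r * ((Q + \<eta>) / real n0 powr q)) \<le> \<dots>" .
        qed
        also have "v * (?s powr r * ((Q + \<eta>) / real n0 powr q)) = (Q + \<eta>) * v powr (1 + q) * real n powr - q"
          using v n0q n0 unfolding s(3) by (simp add: powr_mult powr_add)
        finally show ?thesis by (simp add: v_def)
      qed
    qed
  qed (use \<eta> Q in auto)
  have "((\<lambda>\<eta>. ennreal ((Q + \<eta>) * (measure lborel K + \<eta>) powr (1 + q))) \<longlongrightarrow>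
      ennreal ((Q + 0) * (measure lborel K + 0) powr (1 + q))) (at_right 0)"
    using q by (intro tendsto_intros tendsto_powr') (auto simp: eventually_at_right_less intro!: eventually_mono[OF eventually_at_right_less])
  then show ?thesis
    using bound by (intro tendsto_lowerbound[of _ _ "at_right 0"]) (auto intro!: eventually_mono[OF eventually_at_right_less])
qed

section \<open>Bounds by moments and null sets\<close>

text \<open>A bounded increasing function whose slope decays like \<open>|t|\<^sup>-\<^sup>1\<^sup>-\<^sup>\<delta>\<close>. The inverse image of a uniform
  grid is a finite partition of the line with cells that grow no faster than a moment of order
  \<open>r (1 + \<delta>)\<close> can pay for.\<close>

definition squash :: "real \<Rightarrow> real \<Rightarrow> real" where
  "squash \<delta> t = sgn t * (1 - (1 + \<bar>t\<bar>) powr - \<delta>)"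

lemma squash_bound:
  assumes "0 < \<delta>"
  shows "\<bar>squash \<delta> t\<bar> < 1"
proof -
  have "(1 + \<bar>t\<bar>) powr - \<delta> \<le> 1 powr - \<delta>" using assms by (intro powr_mono2') auto
  moreover have "0 < (1 + \<bar>t\<bar>) powr - \<delta>" by (simp add: add_pos_nonneg)
  ultimately have "\<bar>1 - (1 + \<bar>t\<bar>) powr - \<delta>\<bar> < 1" by simp
  then show ?thesis by (simp add: squash_def abs_mult abs_sgn_eq)
qed

text \<open>Mean value theorem on each side of the origin, with the smallest slope on \<open>[- M, M]\<close>.\<close>

lemma squash_expansion:
  fixes t u M :: real
  assumes \<delta>: "0 < \<delta>" and M: "\<bar>t\<bar> \<le> M" "\<bar>u\<bar> \<le> M"
  shows "\<delta> * \<bar>t - u\<bar> \<le> \<bar>squash \<delta> t - squash \<delta> u\<bar> * (1 + M) powr (1 + \<delta>)"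
proof -
  define g where "g x = 1 - (1 + x) powr - \<delta>" for x :: real
  define L where "L = \<delta> * (1 + M) powr (- \<delta> - 1)"
  have M0: "0 \<le> M" using M by linarith
  have L0: "0 \<le> L" using \<delta> by (simp add: L_def)
  have inc: "L * (b - a) \<le> g b - g a" if ab: "0 \<le> a" "a \<le> b" "b \<le> M" for a b
  proof (cases "a = b")
    case False
    then have "a < b" using ab by simp
    moreover have "\<And>x. a \<le> x \<Longrightarrow> x \<le> b \<Longrightarrow> DERIV g x :> \<delta> * (1 + x) powr (- \<delta> - 1)"
      unfolding g_def using ab by (auto intro!: derivative_eq_intros)
    ultimately obtain z where z: "a < z" "z < b" "g b - g a = (b - a) * (\<delta> * (1 + z) powr (- \<delta> - 1))"
      using MVT2[of a b g "\<lambda>x. \<delta> * (1 + x) powr (- \<delta> - 1)"] by auto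
    have "(1 + M) powr (- \<delta> - 1) \<le> (1 + z) powr (- \<delta> - 1)"
      using z ab \<delta> by (intro powr_mono2') auto
    then have "(b - a) * L \<le> (b - a) * (\<delta> * (1 + z) powr (- \<delta> - 1))"
      unfolding L_def using ab \<delta> by (intro mult_left_mono) auto
    then show ?thesis using z by (simp add: mult.commute)
  qed simp
  have g0: "g 0 = 0" by (simp add: g_def)
  have sq: "squash \<delta> x = (if 0 \<le> x then g x else - g (- x))" for x
    by (simp add: squash_def g_def sgn_real_def)
  have main: "L * (b - a) \<le> squash \<delta> b - squash \<delta> a" if "a \<le> b" "\<bar>a\<bar> \<le> M" "\<bar>b\<bar> \<le> M" for a b
  proof -
    consider "0 \<le> a" | "b < 0" | "a < 0" "0 \<le> b" by linarith
    then show ?thesis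
    proof cases
      case 1 then show ?thesis using inc[of a b] that by (simp add: sq)
    next
      case 2 then show ?thesis using inc[of "- b" "- a"] that by (simp add: sq algebra_simps)
    next
      case 3 then show ?thesis using inc[of 0 b] inc[of 0 "- a"] that M0 by (simp add: sq g0 algebra_simps)
    qed
  qed
  have "L * \<bar>t - u\<bar> \<le> \<bar>squash \<delta> t - squash \<delta> u\<bar>"
    using main[of t u] main[of u t] M by (cases "t \<le> u") (auto simp: abs_if)
  then have "L * \<bar>t - u\<bar> * (1 + M) powr (1 + \<delta>) \<le> \<bar>squash \<delta> t - squash \<delta> u\<bar> * (1 + M) powr (1 + \<delta>)"
    by (intro mult_right_mono) auto
  moreover have "L * (1 + M) powr (1 + \<delta>) = \<delta>"
    using M0 by (simp add: L_def mult.assoc powr_add[symmetric])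
  ultimately show ?thesis by (simp add: mult_ac) (metis mult.assoc mult.commute)
qed

text \<open>The centers are one point from each class of \<open>V\<close> under the grid that \<open>squash\<close> pulls back in every
  coordinate. A center is chosen with nearly least norm in its class, so that the slope of \<open>squash\<close> between
  a point and its center is controlled by the norm of the point alone.\<close>

lemma pierce_bound:
  fixes V :: "(real^'n) set" and c :: "real^'n \<Rightarrow> real^'n \<Rightarrow> ennreal"
  assumes r: "0 < r" and \<delta>: "0 < \<delta>" and V: "B \<subseteq> V" "V \<noteq> {}" and C: "0 \<le> C"
    and c: "\<And>\<xi> a. \<xi> \<in> V \<Longrightarrow> a \<in> V \<Longrightarrow> c \<xi> a \<le> ennreal (C * norm (\<xi> - a) powr r)"
    and \<mu>: "sets \<mu> = sets borel" and B: "B \<in> sets borel"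
  shows "rate_sup (r / CARD('n)) (opt_cost c V \<mu> B)
    \<le> ennreal (C * (real CARD('n) * 4 * 2 powr (1 + \<delta>) / \<delta>) powr r)
      * (\<integral>\<^sup>+\<xi>\<in>B. ennreal ((1 + norm \<xi>) powr (r * (1 + \<delta>))) \<partial>\<mu>)"
proof -
  define d where "d = real CARD('n)"
  have d: "1 \<le> d" using zero_less_card_finite[where 'a='n] by (simp add: d_def Suc_le_eq)
  define q where "q = r / d"
  define A where "A = d * 4 * 2 powr (1 + \<delta>) / \<delta>"
  have A: "0 < A" using d \<delta> by (simp add: A_def)
  define I where "I = (\<integral>\<^sup>+\<xi>\<in>B. ennreal ((1 + norm \<xi>) powr (r * (1 + \<delta>))) \<partial>\<mu>)"
  have "\<forall>\<^sub>F n in sequentially. opt_cost c V \<mu> B n \<le> ennreal (C * A powr r * real n powr - q) * I"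
    using eventually_ge_at_top[of "4 ^ CARD('n)"]
  proof eventually_elim
    case (elim n)
    define x where "x = real n powr (1 / d)"
    have n0: "0 < real n" using elim zero_less_power[of "4::nat" "CARD('n)"] by linarith
    have x: "4 \<le> x"
    proof -
      have "(4 ^ CARD('n)) powr (1 / d) \<le> real n powr (1 / d)"
      proof (rule powr_mono2)
        have "real (4 ^ CARD('n)) \<le> real n" using elim by (simp only: of_nat_le_iff)
        then show "4 ^ CARD('n) \<le> real n" by simp
      qed (use d in auto)
      also have "(4 ^ CARD('n)) powr (1 / d) = (4::real)"
        using d by (simp add: powr_realpow[symmetric] powr_powr d_def)
      finally show ?thesis by (simp add: x_def)
    qed
    have xd: "x ^ CARD('n) = real n"
      using n0 d by (simp add: x_def powr_realpow[symmetric] powr_powr d_def)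
    \<comment> \<open>Mesh \<open>1 / m\<close> on the range \<open>(-1, 1)\<close> gives \<open>2 m\<close> cells per coordinate, hence at most \<open>n\<close> in all.\<close>
    define m where "m = nat \<lfloor>x / 2\<rfloor>"
    have m: "x / 4 \<le> real m" "2 * real m \<le> x" using x by (auto simp: m_def) linarith+
    have m0: "0 < real m" using m x by linarith
    define idx :: "real^'n \<Rightarrow> 'n \<Rightarrow> int" where "idx \<xi> = (\<lambda>i. \<lfloor>real m * squash \<delta> (\<xi> $ i)\<rfloor>)" for \<xi>
    have idx: "idx \<xi> \<in> UNIV \<rightarrow>\<^sub>E {- int m..<int m}" for \<xi>
    proof (simp add: idx_def PiE_iff, intro allI conjI)
      fix i
      have "\<bar>real m * squash \<delta> (\<xi> $ i)\<bar> < real m"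
        using squash_bound[OF \<delta>, of "\<xi> $ i"] m0 by (simp add: abs_mult)
      then have "- real m < real m * squash \<delta> (\<xi> $ i)" "real m * squash \<delta> (\<xi> $ i) < real m" by linarith+
      then show "- int m \<le> \<lfloor>real m * squash \<delta> (\<xi> $ i)\<rfloor>" "\<lfloor>real m * squash \<delta> (\<xi> $ i)\<rfloor> < int m"
        by (simp_all add: le_floor_iff floor_less_iff)
    qed
    have fin: "finite (UNIV \<rightarrow>\<^sub>E {- int m..<int m} :: ('n \<Rightarrow> int) set)"
      by (intro finite_PiE) auto
    have idxV: "idx ` V \<subseteq> (UNIV \<rightarrow>\<^sub>E {- int m..<int m})" using idx by (rule image_subsetI)
    have "card (idx ` V) \<le> card (UNIV \<rightarrow>\<^sub>E {- int m..<int m} :: ('n \<Rightarrow> int) set)"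
      by (rule card_mono[OF fin idxV])
    also have "\<dots> = card {- int m..<int m} ^ CARD('n)" by (subst card_PiE) simp_all
    also have "card {- int m..<int m} = 2 * m"
      using nat_int[of "2 * m"] by simp
    also have "(2 * m) ^ CARD('n) \<le> n"
    proof -
      have "(2 * real m) ^ CARD('n) \<le> x ^ CARD('n)" using m by (intro power_mono) auto
      then have "real ((2 * m) ^ CARD('n)) \<le> real n" by (simp add: xd)
      then show ?thesis by (simp only: of_nat_le_iff)
    qed
    finally have card: "card (idx ` V) \<le> n" .
    have finV: "finite (idx ` V)" by (rule finite_subset[OF idxV fin])
    have "\<exists>a\<in>V. idx a = z \<and> (\<forall>\<xi>\<in>V. idx \<xi> = z \<longrightarrow> norm a \<le> norm \<xi> + 1)" if z: "z \<in> idx ` V" for z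
    proof -
      let ?S = "norm ` {\<xi>\<in>V. idx \<xi> = z}"
      have ne: "?S \<noteq> {}" "bdd_below ?S" using z by (auto intro: bdd_belowI[of _ 0])
      obtain s where s: "s \<in> ?S" "s < Inf ?S + 1" using cInf_lessD[OF ne(1), of "Inf ?S + 1"] by auto
      then obtain a where a: "a \<in> V" "idx a = z" "norm a < Inf ?S + 1" by auto
      have "norm a \<le> norm \<xi> + 1" if "\<xi> \<in> V" "idx \<xi> = z" for \<xi>
        using a(3) cInf_lower[OF _ ne(2), of "norm \<xi>"] that by auto
      with a show ?thesis by blast
    qed
    then obtain rep where rep: "\<And>z. z \<in> idx ` V \<Longrightarrow> rep z \<in> V \<and> idx (rep z) = z \<and>
        (\<forall>\<xi>\<in>V. idx \<xi> = z \<longrightarrow> norm (rep z) \<le> norm \<xi> + 1)" by metis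
    let ?\<Gamma> = "rep ` idx ` V"
    have dist: "norm (\<xi> - rep (idx \<xi>)) \<le> d * (2 powr (1 + \<delta>) / (real m * \<delta>)) * (1 + norm \<xi>) powr (1 + \<delta>)"
      if \<xi>: "\<xi> \<in> V" for \<xi>
    proof -
      define a where "a = rep (idx \<xi>)"
      have a: "a \<in> V" "idx a = idx \<xi>" "norm a \<le> norm \<xi> + 1" using rep[of "idx \<xi>"] \<xi> by (auto simp: a_def)
      have "\<bar>\<xi> $ i - a $ i\<bar> \<le> 2 powr (1 + \<delta>) / (real m * \<delta>) * (1 + norm \<xi>) powr (1 + \<delta>)" for i
      proof -
        have "\<lfloor>real m * squash \<delta> (a $ i)\<rfloor> = \<lfloor>real m * squash \<delta> (\<xi> $ i)\<rfloor>"
          using fun_cong[OF a(2), of i] by (simp add: idx_def)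
        then have "\<bar>real m * squash \<delta> (\<xi> $ i) - real m * squash \<delta> (a $ i)\<bar> \<le> 1" by linarith
        then have "real m * \<bar>squash \<delta> (\<xi> $ i) - squash \<delta> (a $ i)\<bar> \<le> 1"
          using m0 by (simp add: abs_mult right_diff_distrib[symmetric])
        then have sq: "\<bar>squash \<delta> (\<xi> $ i) - squash \<delta> (a $ i)\<bar> \<le> 1 / real m"
          using m0 by (simp add: field_simps)
        have "\<delta> * \<bar>\<xi> $ i - a $ i\<bar> \<le> \<bar>squash \<delta> (\<xi> $ i) - squash \<delta> (a $ i)\<bar> * (1 + (norm \<xi> + 1)) powr (1 + \<delta>)"
          using component_le_norm_cart[of \<xi> i] component_le_norm_cart[of a i] a(3)
          by (intro squash_expansion \<delta>) linarith+
        also have "\<dots> \<le> 1 / real m * (2 * (1 + norm \<xi>)) powr (1 + \<delta>)"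
          using \<delta> m0 by (intro mult_mono sq powr_mono2) (auto simp: add_nonneg_nonneg)
        also have "\<dots> = 1 / real m * (2 powr (1 + \<delta>) * (1 + norm \<xi>) powr (1 + \<delta>))"
          by (subst powr_mult) (simp_all add: add_nonneg_nonneg)
        finally show ?thesis using \<delta> m0 by (simp add: field_simps)
      qed
      then have "(\<Sum>i\<in>UNIV. \<bar>(\<xi> - a) $ i\<bar>) \<le> (\<Sum>i\<in>(UNIV::'n set). 2 powr (1 + \<delta>) / (real m * \<delta>) * (1 + norm \<xi>) powr (1 + \<delta>))"
        by (intro sum_mono) simp
      then show ?thesis using norm_le_l1_cart[of "\<xi> - a"] by (simp add: d_def a_def mult.assoc)
    qed
    have cost: "(INF a\<in>?\<Gamma>. c \<xi> a) \<le> ennreal (C * A powr r * real n powr - q) * ennreal ((1 + norm \<xi>) powr (r * (1 + \<delta>)))"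
      if \<xi>: "\<xi> \<in> V" for \<xi>
    proof -
      have "(INF a\<in>?\<Gamma>. c \<xi> a) \<le> c \<xi> (rep (idx \<xi>))" using \<xi> by (intro INF_lower) auto
      also have "\<dots> \<le> ennreal (C * norm (\<xi> - rep (idx \<xi>)) powr r)" using \<xi> rep by (intro c) auto
      also have "\<dots> \<le> ennreal (C * (A / x * (1 + norm \<xi>) powr (1 + \<delta>)) powr r)"
      proof (intro ennreal_leI mult_left_mono powr_mono2 C)
        have "norm (\<xi> - rep (idx \<xi>)) \<le> d * (2 powr (1 + \<delta>) / (real m * \<delta>)) * (1 + norm \<xi>) powr (1 + \<delta>)"
          using \<xi> by (rule dist)
        also have "d * (2 powr (1 + \<delta>) / (real m * \<delta>)) \<le> d * (2 powr (1 + \<delta>) / (x / 4 * \<delta>))"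
          using m x \<delta> d by (intro mult_left_mono divide_left_mono mult_right_mono mult_pos_pos) auto
        also have "d * (2 powr (1 + \<delta>) / (x / 4 * \<delta>)) = A / x" by (simp add: A_def mult_ac)
        finally show "norm (\<xi> - rep (idx \<xi>)) \<le> A / x * (1 + norm \<xi>) powr (1 + \<delta>)"
          by (simp add: mult_right_mono)
      qed (use r in auto)
      also have "(A / x * (1 + norm \<xi>) powr (1 + \<delta>)) powr r = A powr r * real n powr - q * (1 + norm \<xi>) powr (r * (1 + \<delta>))"
        using A x n0 by (simp add: powr_mult powr_divide powr_powr x_def q_def powr_minus_divide mult.commute)
      finally show ?thesis using C by (simp add: ennreal_mult[symmetric] mult.assoc)
    qed
    have "opt_cost c V \<mu> B n \<le> cost_over c \<mu> B (?\<Gamma>)"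
      using V rep finV card card_image_le[OF finV, of rep] by (intro opt_cost_le) auto
    also have "\<dots> \<le> (\<integral>\<^sup>+\<xi>\<in>B. ennreal (C * A powr r * real n powr - q) * ennreal ((1 + norm \<xi>) powr (r * (1 + \<delta>))) \<partial>\<mu>)"
      using V by (intro nn_set_integral_mono_on cost) auto
    also have "\<dots> = ennreal (C * A powr r * real n powr - q) * I"
      unfolding I_def mult.assoc using B
      by (intro nn_integral_cmult) (auto simp: measurable_cong_sets[OF \<mu> refl])
    finally show ?case .
  qed
  then have *: "\<forall>\<^sub>F n in sequentially. opt_cost c V \<mu> B n \<le> ennreal (C * A powr r * real n powr - q) * I" .
  have "rate_sup q (opt_cost c V \<mu> B) \<le> ennreal (C * A powr r) * I"
  proof (cases I rule: ennreal_cases)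
    case (real i)
    then show ?thesis
      using * C by (auto simp: ennreal_mult[symmetric] intro!: rate_sup_leI elim!: eventually_mono simp: mult_ac)
  next
    case top
    show ?thesis
    proof (cases "C = 0")
      case True
      then have "rate_sup q (opt_cost c V \<mu> B) \<le> ennreal 0"
        using * by (intro rate_sup_leI) auto
      then show ?thesis by simp
    next
      case False
      then show ?thesis using C A top by (simp add: ennreal_mult_top)
    qed
  qed
  then show ?thesis by (simp add: q_def d_def A_def I_def)
qed

text \<open>With mesh \<open>s = (\<eta> / n)\<^sup>1\<^sup>/\<^sup>d\<close> a compact null set meets at most \<open>n\<close> cells. One center per cell costs
  a multiple of \<open>s\<^sup>r = \<eta>\<^sup>q n\<^sup>-\<^sup>q\<close>, and \<open>\<eta>\<close> is arbitrary.\<close>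

lemma rate_sup_null_compact:
  fixes K V :: "(real^'n) set" and c :: "real^'n \<Rightarrow> real^'n \<Rightarrow> ennreal"
  assumes r: "0 < r" and C: "0 \<le> C"
    and c: "\<And>\<xi> a. \<xi> \<in> V \<Longrightarrow> a \<in> V \<Longrightarrow> c \<xi> a \<le> ennreal (C * norm (\<xi> - a) powr r)"
    and meas: "\<And>a. a \<in> V \<Longrightarrow> (\<lambda>\<xi>. c \<xi> a) \<in> borel_measurable borel"
    and \<mu>: "sets \<mu> = sets borel" "finite_measure \<mu>"
    and K: "compact K" "K \<subseteq> V" "emeasure lborel K = 0" "V \<noteq> {}"
  shows "rate_sup (r / CARD('n)) (opt_cost c V \<mu> K) = 0"
proof -
  interpret finite_measure \<mu> by fact
  define q where "q = r / real CARD('n)"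
  have q: "0 < q" using r by (simp add: q_def)
  define D where "D = C * real CARD('n) powr r * measure \<mu> K"
  have D: "0 \<le> D" using C by (simp add: D_def)
  have bound: "rate_sup q (opt_cost c V \<mu> K) \<le> ennreal (D * \<eta> powr q)" if \<eta>: "0 < \<eta>" for \<eta>
  proof (rule rate_sup_leI)
    obtain s0 where s0: "0 < s0"
      "\<And>s. 0 < s \<Longrightarrow> s < s0 \<Longrightarrow> finite (grid_index s ` K) \<and> real (card (grid_index s ` K)) * s ^ CARD('n) \<le> \<eta>"
      using compact_cell_cover[OF K(1) subset_UNIV open_UNIV, of \<eta>] K(3) \<eta> by (metis ennreal_0 ennreal_less_iff order_refl)
    define s where "s n = (\<eta> * real 1 / real n) powr (1 / real CARD('n))" for n
    note mesh = mesh_size[of \<eta> 1 "CARD('n)", OF \<eta> zero_less_one zero_less_card_finite, folded s_def]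
    show "\<forall>\<^sub>F n in sequentially. opt_cost c V \<mu> K n \<le> ennreal (D * \<eta> powr q * real n powr - q)"
      using mesh(4)[OF s0(1)] eventually_gt_at_top[of 0]
    proof eventually_elim
      case (elim n)
      let ?s = "s n"
      let ?Z = "grid_index ?s ` K"
      have s: "0 < ?s" "?s ^ CARD('n) = \<eta> / real n" "?s powr r = \<eta> powr q * real n powr - q"
        using elim mesh(1)[of n] mesh(2)[of n] mesh(3)[of n r] by (auto simp: q_def)
      have Z: "finite ?Z" "real (card ?Z) * ?s ^ CARD('n) \<le> \<eta>" using s0(2)[OF s(1) elim(1)] by auto
      show ?case
      proof (cases "K = {}")
        case True
        obtain w where "w \<in> V" using K by auto
        then have "opt_cost c V \<mu> K n \<le> cost_over c \<mu> K {w}"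
          using elim by (intro opt_cost_le) auto
        then show ?thesis by (simp add: True)
      next
        case False
        have "real (card ?Z * 1) \<le> real n"
          using Z(2) s(2) \<eta> elim by (simp add: field_simps)
        then have cardZ: "card ?Z * 1 \<le> n" by (simp only: of_nat_le_iff)
        have "\<exists>a. a \<in> K \<and> grid_index ?s a = z" if "z \<in> ?Z" for z using that by auto
        then obtain a where a: "\<And>z. z \<in> ?Z \<Longrightarrow> a z \<in> K \<and> grid_index ?s (a z) = z" by metis
        have Kb: "K \<in> sets borel" using K by (simp add: borel_compact)
        have "opt_cost c V \<mu> K n \<le> (\<Sum>z\<in>?Z. \<integral>\<^sup>+\<xi>\<in>cell ?s z \<inter> K. (INF a\<in>{a z}. c \<xi> a) \<partial>\<mu>)"
        proof (rule opt_cost_cells[OF Z(1) _ _ _ cardZ])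
          show "K \<subseteq> (\<Union>z\<in>?Z. cell ?s z \<inter> K)" using mem_cell_iff[OF s(1)] by fastforce
        qed (use False a K Kb meas in \<open>auto simp: \<mu> measurable_cong_sets[OF \<mu>(1) refl]\<close>)
        also have "\<dots> \<le> (\<Sum>z\<in>?Z. ennreal (C * (real CARD('n) * ?s) powr r) * emeasure \<mu> (cell ?s z \<inter> K))"
        proof (rule sum_mono)
          fix z assume z: "z \<in> ?Z"
          have "cost_over c \<mu> (cell ?s z \<inter> K) {a z}
            \<le> (\<integral>\<^sup>+\<xi>\<in>cell ?s z \<inter> K. ennreal (C * (real CARD('n) * ?s) powr r) \<partial>\<mu>)"
          proof (rule nn_set_integral_mono_on)
            fix \<xi> assume \<xi>: "\<xi> \<in> cell ?s z \<inter> K"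
            have "a z \<in> cell ?s z" using a[OF z] by (simp add: mem_cell_iff[OF s(1)])
            then have "norm (\<xi> - a z) \<le> real CARD('n) * ?s"
              using \<xi> cell_subset_cbox by (intro norm_diff_cbox_le) auto
            then have "ennreal (C * norm (\<xi> - a z) powr r) \<le> ennreal (C * (real CARD('n) * ?s) powr r)"
              using r C by (intro ennreal_leI mult_left_mono powr_mono2) auto
            moreover have "c \<xi> (a z) \<le> ennreal (C * norm (\<xi> - a z) powr r)"
              using \<xi> a[OF z] K by (intro c) auto
            ultimately show "(INF a\<in>{a z}. c \<xi> a) \<le> ennreal (C * (real CARD('n) * ?s) powr r)" by simp
          qed
          also have "\<dots> = ennreal (C * (real CARD('n) * ?s) powr r) * emeasure \<mu> (cell ?s z \<inter> K)"
            using Kb by (intro nn_integral_cmult_indicator) (auto simp: \<mu>)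
          finally show "cost_over c \<mu> (cell ?s z \<inter> K) {a z} \<le> \<dots>" .
        qed
        also have "\<dots> = ennreal (C * (real CARD('n) * ?s) powr r) * (\<Sum>z\<in>?Z. emeasure \<mu> (cell ?s z \<inter> K))"
          by (simp add: sum_distrib_left)
        also have "(\<Sum>z\<in>?Z. emeasure \<mu> (cell ?s z \<inter> K)) = emeasure \<mu> (\<Union>z\<in>?Z. cell ?s z \<inter> K)"
          using Z Kb disjoint_cells[OF s(1)]
          by (intro sum_emeasure) (auto simp: \<mu> disjoint_family_on_def)
        also have "\<dots> \<le> emeasure \<mu> K" using Kb by (intro emeasure_mono) (auto simp: \<mu>)
        also have "\<dots> = ennreal (measure \<mu> K)" by (rule emeasure_eq_measure)
        also have "ennreal (C * (real CARD('n) * ?s) powr r) * ennreal (measure \<mu> K) = ennreal (D * \<eta> powr q * real n powr - q)"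
          using C s by (simp add: ennreal_mult[symmetric] D_def powr_mult mult_ac)
        finally show ?thesis by (simp add: mult_left_mono)
      qed
    qed
  qed (use D in auto)
  have "((\<lambda>\<eta>. ennreal (D * \<eta> powr q)) \<longlongrightarrow> ennreal (D * 0 powr q)) (at_right 0)"
    using q by (intro tendsto_intros tendsto_powr') (auto intro!: eventually_mono[OF eventually_at_right_less])
  then have "rate_sup q (opt_cost c V \<mu> K) \<le> ennreal (D * 0 powr q)"
    using bound by (intro tendsto_lowerbound[of _ _ "at_right 0"]) (auto intro!: eventually_mono[OF eventually_at_right_less])
  then show ?thesis by (simp add: q_def)
qed

section \<open>Rates as set functions\<close>

text \<open>The finite measure \<open>\<nu>\<close> dominates the upper rate inside \<open>X\<close>. It makes parts of small \<open>\<nu>\<close>-measure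
  negligible, which upgrades finite subadditivity to inner regularity and countable subadditivity.\<close>

locale regular_rate =
  fixes q p :: real and c :: "'a::euclidean_space \<Rightarrow> 'a \<Rightarrow> ennreal" and V X :: "'a set"
    and \<mu> \<nu> :: "'a measure"
  assumes q_gt0: "0 < q" and p_eq: "p = 1 / (1 + q)"
    and meas: "\<And>a. a \<in> V \<Longrightarrow> (\<lambda>\<xi>. c \<xi> a) \<in> borel_measurable borel"
    and \<mu>: "sets \<mu> = sets borel"
    and \<nu>: "sets \<nu> = sets borel" "finite_measure \<nu>"
    and dom: "\<And>B. B \<in> sets borel \<Longrightarrow> B \<subseteq> X \<Longrightarrow> rate_sup q (opt_cost c V \<mu> B) \<le> emeasure \<nu> B"
begin

definition upper_rate :: "'a set \<Rightarrow> ennreal" where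
  "upper_rate B = ennreal_powr (rate_sup q (opt_cost c V \<mu> B)) p"

lemma upper_rate_Un:
  assumes "A \<in> sets borel" "B \<in> sets borel"
  shows "upper_rate (A \<union> B) \<le> upper_rate A + upper_rate B"
  unfolding upper_rate_def using assms meas
  by (intro rate_sup_add[OF q_gt0 p_eq] opt_cost_add) (auto simp: \<mu> measurable_cong_sets[OF \<mu> refl])

lemma upper_rate_dom: "B \<in> sets borel \<Longrightarrow> B \<subseteq> X \<Longrightarrow> upper_rate B \<le> ennreal_powr (emeasure \<nu> B) p"
  unfolding upper_rate_def using p_pos[OF q_gt0 p_eq] dom by (intro ennreal_powr_mono) auto

lemma upper_rate_empty: "upper_rate {} = 0"
  using upper_rate_dom[of "{}"] by simp

lemma upper_rate_regular:
  assumes E: "E \<in> sets borel" "E \<subseteq> X"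
    and m: "\<And>K. compact K \<Longrightarrow> K \<subseteq> E \<Longrightarrow> upper_rate K \<le> m"
  shows "upper_rate E \<le> m"
proof (rule ennreal_le_epsilon)
  interpret \<nu>: finite_measure \<nu> by (rule \<nu>(2))
  fix e :: real assume e: "0 < e"
  have reg: "emeasure \<nu> E = (SUP K\<in>{K. K \<subseteq> E \<and> compact K}. emeasure \<nu> K)"
    using E by (intro inner_regular) (auto simp: \<nu>)
  have "\<exists>K. compact K \<and> K \<subseteq> E \<and> emeasure \<nu> (E - K) \<le> ennreal (e powr (1 + q))"
  proof (cases "emeasure \<nu> E = 0")
    case True then show ?thesis by (intro exI[of _ "{}"]) auto
  next
    case False
    then have "ennreal (measure \<nu> E - e powr (1 + q)) < emeasure \<nu> E"
      using e unfolding \<nu>.emeasure_eq_measure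
      by (intro ennreal_lessI) (auto simp: zero_less_measure_iff)
    then obtain K where K: "K \<subseteq> E" "compact K" "ennreal (measure \<nu> E - e powr (1 + q)) < emeasure \<nu> K"
      unfolding reg less_SUP_iff by auto
    have Kb: "K \<in> sets borel" using K by (simp add: borel_compact)
    have "emeasure \<nu> (E - K) = ennreal (measure \<nu> E - measure \<nu> K)"
      using K Kb E by (subst \<nu>.emeasure_eq_measure, subst \<nu>.finite_measure_Diff) (auto simp: \<nu>)
    also have "\<dots> \<le> ennreal (e powr (1 + q))"
    proof (rule ennreal_leI)
      have "measure \<nu> E - e powr (1 + q) \<le> measure \<nu> K"
        using K(3) unfolding \<nu>.emeasure_eq_measure by (metis ennreal_leI not_le order_less_imp_le)
      then show "measure \<nu> E - measure \<nu> K \<le> e powr (1 + q)" by simp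
    qed
    finally show ?thesis using K by blast
  qed
  then obtain K where K: "compact K" "K \<subseteq> E" "emeasure \<nu> (E - K) \<le> ennreal (e powr (1 + q))" by blast
  have Kb: "K \<in> sets borel" using K by (simp add: borel_compact)
  have "upper_rate E = upper_rate (K \<union> (E - K))" using K by (simp add: Un_absorb1)
  also have "\<dots> \<le> upper_rate K + upper_rate (E - K)" using Kb E by (intro upper_rate_Un) auto
  also have "upper_rate (E - K) \<le> ennreal_powr (emeasure \<nu> (E - K)) p" using E Kb by (intro upper_rate_dom) auto
  also have "\<dots> \<le> ennreal e" using e by (intro ennreal_powr_p_le[OF q_gt0 p_eq] K) auto
  finally show "upper_rate E \<le> m + ennreal e" using m[OF K(1,2)] by (meson add_mono order_refl order_trans)
qed

lemma upper_rate_countable: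
  assumes E: "\<And>i. E i \<in> sets borel" "disjoint_family E" "(\<Union>i. E i) \<subseteq> X"
  shows "upper_rate (\<Union>i::nat. E i) \<le> (\<Sum>i. upper_rate (E i))"
proof -
  interpret \<nu>: finite_measure \<nu> by (rule \<nu>(2))
  have fin: "upper_rate (\<Union>i<N. E i) \<le> (\<Sum>i<N. upper_rate (E i))" for N
  proof (induction N)
    case (Suc N)
    have "upper_rate (\<Union>i<Suc N. E i) = upper_rate ((\<Union>i<N. E i) \<union> E N)" by (simp add: lessThan_Suc Un_commute)
    also have "\<dots> \<le> upper_rate (\<Union>i<N. E i) + upper_rate (E N)" using E by (intro upper_rate_Un) auto
    also have "\<dots> \<le> (\<Sum>i<N. upper_rate (E i)) + upper_rate (E N)" by (intro add_right_mono Suc)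
    finally show ?case by simp
  qed (simp add: upper_rate_empty)
  define T where "T N = (\<Union>i\<in>{N..}. E i)" for N
  have "(\<lambda>N. emeasure \<nu> (T N)) \<longlonglongrightarrow> emeasure \<nu> (\<Inter>N. T N)"
  proof (rule Lim_emeasure_decseq)
    show "decseq T" unfolding decseq_def T_def by (intro allI impI UN_mono) auto
  qed (use E in \<open>auto simp: T_def \<nu>\<close>)
  also have "(\<Inter>N. T N) = {}"
  proof (rule equals0I)
    fix x assume x: "x \<in> (\<Inter>N. T N)"
    then obtain i where i: "x \<in> E i" by (auto simp: T_def)
    from x obtain j where "j \<ge> Suc i" "x \<in> E j" unfolding T_def by blast
    moreover have "E i \<inter> E j = {}" using E(2) \<open>j \<ge> Suc i\<close> by (intro disjoint_family_onD) auto
    ultimately show False using i by auto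
  qed
  finally have "(\<lambda>N. emeasure \<nu> (T N)) \<longlonglongrightarrow> 0" by simp
  from continuous_on_tendsto_compose[OF continuous_ennreal_powr[OF p_pos[OF q_gt0 p_eq]] this]
  have lim: "(\<lambda>N. ennreal_powr (emeasure \<nu> (T N)) p) \<longlonglongrightarrow> 0" by simp
  have "upper_rate (\<Union>i. E i) \<le> (\<Sum>i. upper_rate (E i)) + ennreal_powr (emeasure \<nu> (T N)) p" for N
  proof -
    have "(\<Union>i. E i) = (\<Union>i<N. E i) \<union> T N"
      unfolding T_def by (auto simp: not_less) (metis lessThan_iff atLeast_iff not_le)
    then have "upper_rate (\<Union>i. E i) \<le> upper_rate (\<Union>i<N. E i) + upper_rate (T N)" using E by (simp add: T_def upper_rate_Un)
    also have "\<dots> \<le> (\<Sum>i. upper_rate (E i)) + ennreal_powr (emeasure \<nu> (T N)) p"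
      using E by (intro add_mono order_trans[OF fin] sum_le_suminf upper_rate_dom) (auto simp: T_def)
    finally show ?thesis .
  qed
  moreover have "(\<lambda>N. (\<Sum>i. upper_rate (E i)) + ennreal_powr (emeasure \<nu> (T N)) p) \<longlonglongrightarrow> (\<Sum>i. upper_rate (E i)) + 0"
    by (intro tendsto_add tendsto_const lim)
  ultimately show ?thesis by (intro LIMSEQ_le_const[where X = "\<lambda>N. (\<Sum>i. upper_rate (E i)) + ennreal_powr (emeasure \<nu> (T N)) p"]) auto
qed

end

section \<open>The Euclidean cost on bounded sets\<close>

context
  fixes r q p Q :: real
  assumes r: "0 < r" and q: "q = r / CARD('n::finite)" and p: "p = 1 / (1 + q)"
    and Q: "zador_const TYPE('n) r = ennreal Q" "0 \<le> Q"
begin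

lemma q_pos: "0 < q" using r by (simp add: q)

text \<open>Inner regularity reduces this to compact sets. The dominating measure is a multiple of Lebesgue measure on
  a ball, by Pierce's bound with \<open>\<delta> = 1\<close>.\<close>

lemma rate_sup_bounded:
  fixes B :: "(real^'n) set"
  assumes B: "bounded B" "B \<in> sets borel"
  shows "ennreal_powr (rate_sup q (opt_cost (ecost r) UNIV lborel B)) p \<le> ennreal (Q powr p * measure lborel B)"
proof -
  obtain R where R: "\<And>x. x \<in> B \<Longrightarrow> norm x \<le> R" "0 < R" using B(1) bounded_pos by metis
  define X :: "(real^'n) set" where "X = cball 0 R"
  have X: "X \<in> sets borel" "B \<subseteq> X" using R by (auto simp: X_def)
  define C where "C = (real CARD('n) * 4 * 2 powr (1 + 1) / 1) powr r * (1 + R) powr (r * (1 + 1))"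
  define \<nu> :: "(real^'n) measure" where "\<nu> = density lborel (\<lambda>x. ennreal C * indicator X x)"
  have \<nu>: "emeasure \<nu> A = ennreal C * emeasure lborel A" if "A \<in> sets borel" "A \<subseteq> X" for A
  proof -
    have "emeasure \<nu> A = (\<integral>\<^sup>+x. ennreal C * indicator X x * indicator A x \<partial>lborel)"
      unfolding \<nu>_def using X that by (intro emeasure_density) auto
    also have "\<dots> = (\<integral>\<^sup>+x. ennreal C * indicator A x \<partial>lborel)"
      using that by (intro nn_integral_cong) (auto simp: indicator_def)
    finally show ?thesis using that by (simp add: nn_integral_cmult_indicator)
  qed
  interpret regular_rate q p "ecost r" UNIV X lborel \<nu>
  proof (rule regular_rate.intro)
    have "emeasure \<nu> (space \<nu>) = (\<integral>\<^sup>+x. ennreal C * indicator X x * indicator (space lborel) x \<partial>lborel)"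
      unfolding \<nu>_def using X by (subst emeasure_density) auto
    also have "\<dots> = ennreal C * emeasure lborel X" using X by (simp add: nn_integral_cmult_indicator)
    also have "\<dots> < \<infinity>" using emeasure_compact_finite[of X] by (auto simp: X_def ennreal_mult_less_top)
    finally show "finite_measure \<nu>" by (intro finite_measureI) simp
    fix A :: "(real^'n) set" assume A: "A \<in> sets borel" "A \<subseteq> X"
    have "rate_sup q (opt_cost (ecost r) UNIV lborel A)
      \<le> ennreal (1 * (real CARD('n) * 4 * 2 powr (1 + 1) / 1) powr r)
        * (\<integral>\<^sup>+\<xi>\<in>A. ennreal ((1 + norm \<xi>) powr (r * (1 + 1))) \<partial>lborel)"
      unfolding q using r A by (intro pierce_bound) (auto simp: ecost_def)
    also have "(\<integral>\<^sup>+\<xi>\<in>A. ennreal ((1 + norm \<xi>) powr (r * (1 + 1))) \<partial>lborel)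
       \<le> (\<integral>\<^sup>+\<xi>\<in>A. ennreal ((1 + R) powr (r * (1 + 1))) \<partial>lborel)"
      using r A by (intro nn_set_integral_mono_on ennreal_leI powr_mono2) (auto simp: X_def)
    also have "\<dots> = ennreal ((1 + R) powr (r * (1 + 1))) * emeasure lborel A"
      using A by (simp add: nn_integral_cmult_indicator)
    also have "ennreal (1 * (real CARD('n) * 4 * 2 powr (1 + 1) / 1) powr r) * \<dots> = emeasure \<nu> A"
      by (simp only: \<nu>[OF A] C_def mult_1 ennreal_mult[OF powr_ge_zero powr_ge_zero] mult.assoc)
    finally show "rate_sup q (opt_cost (ecost r) UNIV lborel A) \<le> emeasure \<nu> A" by (simp add: mult_left_mono)
  qed (use q_pos p in \<open>auto simp: \<nu>_def\<close>)
  have Bfin: "emeasure lborel B < top"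
    using emeasure_bounded_finite[OF B(1)] by simp
  have "upper_rate B \<le> ennreal (Q powr p * measure lborel B)"
  proof (rule upper_rate_regular[OF B(2) X(2)])
    fix K assume K: "compact K" "K \<subseteq> B"
    have Kb: "K \<in> sets borel" using K by (simp add: borel_compact)
    have "rate_sup q (opt_cost (ecost r) UNIV lborel K) \<le> ennreal (Q * measure lborel K powr (1 + q))"
      unfolding q by (rule rate_sup_compact[OF r Q K(1)]) auto
    then have "upper_rate K \<le> ennreal_powr (ennreal (Q * measure lborel K powr (1 + q))) p"
      unfolding upper_rate_def using p_pos[OF q_pos p] by (intro ennreal_powr_mono) auto
    also have "\<dots> = ennreal (Q powr p * measure lborel K)"
      using Q by (simp add: powr_mult powr_p_powr(2)[OF q_pos p])
    also have "\<dots> \<le> ennreal (Q powr p * measure lborel B)"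
      using K B Kb Bfin by (intro ennreal_leI mult_left_mono measure_mono_fmeasurable) (auto simp: fmeasurable_def)
    finally show "upper_rate K \<le> ennreal (Q powr p * measure lborel B)" .
  qed
  then show ?thesis by (simp add: upper_rate_def)
qed

text \<open>The constant \<open>Q\<close> is an infimum over all \<open>n\<close>, so it bounds the error of the unit cube for each \<open>n\<close>.\<close>

lemma opt_cost_cube_ge:
  assumes s: "0 < s" and n: "1 \<le> n"
  shows "ennreal ((Q powr p * s ^ CARD('n)) powr (1 + q) * real n powr - q)
    \<le> opt_cost (ecost r) UNIV lborel (cube l s :: (real^'n) set) n"
proof (rule opt_cost_geI)
  fix \<Gamma> :: "(real^'n) set" assume \<Gamma>: "finite \<Gamma>" "\<Gamma> \<noteq> {}" "card \<Gamma> \<le> n"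
  define \<Gamma>' where "\<Gamma>' = (\<lambda>a. (1 / s) *\<^sub>R (a - l)) ` \<Gamma>"
  have \<Gamma>': "finite \<Gamma>'" "\<Gamma>' \<noteq> {}" "card \<Gamma>' \<le> n"
    using \<Gamma> card_image_le[OF \<Gamma>(1), of "\<lambda>a. (1 / s) *\<^sub>R (a - l)"] by (auto simp: \<Gamma>'_def)
  have img: "(\<lambda>a. l + s *\<^sub>R a) ` \<Gamma>' = \<Gamma>"
    using s by (auto simp: \<Gamma>'_def image_image)
  have "ennreal Q \<le> ennreal (real n powr q) * opt_cost (ecost r) (UNIV :: (real^'n) set) lborel (cbox 0 1) n"
    unfolding Q(1)[symmetric] zador_const_eq q using n by (intro INF_lower) auto
  then have "ennreal (Q * real n powr - q) \<le> opt_cost (ecost r) (UNIV :: (real^'n) set) lborel (cbox 0 1) n"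
    using n Q by (subst (asm) rate_bound_iff) auto
  also have "\<dots> \<le> cost_over (ecost r) lborel (cbox 0 1) \<Gamma>'"
    using \<Gamma>' by (intro opt_cost_le) auto
  finally have "ennreal (s ^ CARD('n) * s powr r) * ennreal (Q * real n powr - q)
     \<le> ennreal (s ^ CARD('n) * s powr r) * cost_over (ecost r) lborel (cbox 0 1) \<Gamma>'"
    by (rule mult_left_mono) simp
  also have "\<dots> = (\<integral>\<^sup>+\<xi>\<in>cube l s. (INF a\<in>\<Gamma>. ecost r \<xi> a) \<partial>lborel)"
    using cell_cost_scale[OF s \<Gamma>'(1), where l = l and r = r] by (simp add: img)
  also have "ennreal (s ^ CARD('n) * s powr r) * ennreal (Q * real n powr - q)
     = ennreal ((Q powr p * s ^ CARD('n)) powr (1 + q) * real n powr - q)"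
  proof -
    have "(s ^ CARD('n)) powr (1 + q) = s ^ CARD('n) * s powr r"
      using s by (simp add: powr_realpow[symmetric] powr_powr q distrib_left powr_add)
    then show ?thesis
      using s Q by (simp add: ennreal_mult[symmetric] powr_mult powr_p_powr(1)[OF q_pos p] mult_ac)
  qed
  finally show "ennreal ((Q powr p * s ^ CARD('n)) powr (1 + q) * real n powr - q)
     \<le> (\<integral>\<^sup>+\<xi>\<in>cube l s. (INF a\<in>\<Gamma>. ecost r \<xi> a) \<partial>lborel)" .
qed

text \<open>Compare \<open>B\<close> with its complement in a large cube \<open>X\<close>. As \<open>p\<close>-th powers of the rates of \<open>X\<close> and of
  \<open>X - B\<close> are \<open>Q\<^sup>p\<close> times their volumes, the difference is the volume of \<open>B\<close>.\<close>

lemma rate_inf_bounded: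
  fixes B :: "(real^'n) set"
  assumes B: "bounded B" "B \<in> sets borel"
  shows "ennreal (Q powr p * measure lborel B) \<le> ennreal_powr (rate_inf q (opt_cost (ecost r) UNIV lborel B)) p"
proof -
  obtain R where R: "\<And>x. x \<in> B \<Longrightarrow> norm x \<le> R" "0 < R" using B(1) bounded_pos by metis
  define l :: "real^'n" where "l = (\<chi> i. - R)"
  define X :: "(real^'n) set" where "X = cube l (2 * R)"
  have BX: "B \<subseteq> X"
  proof
    fix x assume "x \<in> B"
    then have "\<bar>x $ i\<bar> \<le> R" for i using R(1)[of x] component_le_norm_cart[of x i] by linarith
    then show "x \<in> X" by (auto simp: X_def l_def mem_box_cart abs_le_iff minus_le_iff)
  qed
  have mX: "emeasure lborel X = ennreal ((2 * R) ^ CARD('n))"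
  proof -
    have "emeasure lborel X = (\<Prod>b\<in>Basis. ((l + (\<chi> i. 2 * R)) - l) \<bullet> b)"
      unfolding X_def using R by (intro emeasure_lborel_cbox) (auto simp: Basis_vec_def inner_axis)
    then show ?thesis by (simp add: prod_Basis_cart inner_axis)
  qed
  have Xb: "X \<in> sets borel" "bounded X" by (auto simp: X_def)
  have fin: "X - B \<in> fmeasurable lborel" "B \<in> fmeasurable lborel" "X \<in> fmeasurable lborel"
    using B Xb BX emeasure_bounded_finite[of "X - B"] emeasure_bounded_finite[of B] emeasure_bounded_finite[of X]
      bounded_subset[of X "X - B"] by (auto simp: fmeasurable_def)
  have "ennreal (Q powr p * (2 * R) ^ CARD('n))
     \<le> ennreal_powr (rate_inf q (opt_cost (ecost r) UNIV lborel B)) p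
      + ennreal_powr (rate_sup q (opt_cost (ecost r) UNIV lborel (X - B))) p"
  proof (rule rate_inf_complement[OF q_pos p])
    show "opt_cost (ecost r) UNIV lborel X (m + n) \<le> opt_cost (ecost r) UNIV lborel B m + opt_cost (ecost r) UNIV lborel (X - B) n" for m n
    proof -
      have "X = B \<union> (X - B)" using BX by auto
      then have "opt_cost (ecost r) UNIV lborel X (m + n) = opt_cost (ecost r) UNIV lborel (B \<union> (X - B)) (m + n)" by simp
      also have "\<dots> \<le> opt_cost (ecost r) UNIV lborel B m + opt_cost (ecost r) UNIV lborel (X - B) n"
        using B Xb by (intro opt_cost_add) auto
      finally show ?thesis .
    qed
    show "ennreal ((Q powr p * (2 * R) ^ CARD('n)) powr (1 + q) * real n powr - q) \<le> opt_cost (ecost r) UNIV lborel X n"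
      if "1 \<le> n" for n
      unfolding X_def using R that by (intro opt_cost_cube_ge) auto
  qed (use R in auto)
  also have "ennreal_powr (rate_sup q (opt_cost (ecost r) UNIV lborel (X - B))) p \<le> ennreal (Q powr p * measure lborel (X - B))"
    using B Xb by (intro rate_sup_bounded) auto
  finally have *: "ennreal (Q powr p * (2 * R) ^ CARD('n)) \<le> ennreal_powr (rate_inf q (opt_cost (ecost r) UNIV lborel B)) p
      + ennreal (Q powr p * measure lborel (X - B))" by (simp add: add_left_mono)
  have "measure lborel (X - B) = (2 * R) ^ CARD('n) - measure lborel B"
    using fin BX mX R by (subst measurable_measure_Diff) (auto simp: measure_def fmeasurable_def)
  then have "Q powr p * measure lborel B = Q powr p * (2 * R) ^ CARD('n) - Q powr p * measure lborel (X - B)"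
    by (simp add: right_diff_distrib)
  with ennreal_diff_le_real[OF *] show ?thesis by simp
qed

end

section \<open>Bregman divergences\<close>

lemma grad_has_derivative:
  fixes F :: "real^'n \<Rightarrow> real"
  assumes "F differentiable (at x)"
  shows "(F has_derivative (\<lambda>h. h \<bullet> grad F x)) (at x)"
proof -
  obtain F' where F': "(F has_derivative F') (at x)" using assms by (auto simp: differentiable_def)
  interpret F': bounded_linear F' using F' by (rule has_derivative_bounded_linear)
  define D where "D = (\<Sum>i\<in>Basis. F' i *\<^sub>R i)"
  have "F' h = h \<bullet> D" for h
  proof -
    have "F' h = F' (\<Sum>i\<in>Basis. (h \<bullet> i) *\<^sub>R i)" by (simp add: euclidean_representation)
    also have "\<dots> = (\<Sum>i\<in>Basis. (h \<bullet> i) * F' i)" by (simp add: F'.sum F'.scaleR)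
    also have "\<dots> = h \<bullet> D" by (simp add: D_def inner_sum_right mult.commute)
    finally show ?thesis .
  qed
  then have "F' = (\<lambda>h. h \<bullet> D)" by (rule ext)
  with F' have D: "GDERIV F x :> D" by (simp add: gderiv_def)
  have uniq: "E = D" if "GDERIV F x :> E" for E
  proof -
    have "(\<lambda>h. h \<bullet> E) = (\<lambda>h. h \<bullet> D)"
      using has_derivative_unique[OF that[unfolded gderiv_def] D[unfolded gderiv_def]] .
    from fun_cong[OF this, of "E - D"] have "(E - D) \<bullet> E = (E - D) \<bullet> D" .
    then have "(E - D) \<bullet> (E - D) = 0" by (simp add: inner_diff_right)
    then show ?thesis by simp
  qed
  have "grad F x = D" unfolding grad_def using D uniq by (rule the_equality)
  with D show ?thesis by (simp add: gderiv_def)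
qed

lemma hessian_has_derivative:
  assumes "grad F differentiable (at x)"
  shows "(grad F has_derivative (\<lambda>h. hessian F x *v h)) (at x)"
  using assms unfolding hessian_def jacobian_works .

text \<open>Taylor's formula of order two along the segment from \<open>a\<close> to \<open>\<xi>\<close>.\<close>

lemma bregman_taylor:
  fixes F :: "real^'n \<Rightarrow> real"
  assumes C2: "C2_on U F" and V: "convex V" "V \<subseteq> U" and xy: "a \<in> V" "\<xi> \<in> V"
  shows "\<exists>z\<in>V. bregman F \<xi> a = ((\<xi> - a) \<bullet> (hessian F z *v (\<xi> - a))) / 2"
proof -
  define v where "v = \<xi> - a"
  define g where "g t = F (a + t *\<^sub>R v)" for t :: real
  define g1 where "g1 t = grad F (a + t *\<^sub>R v) \<bullet> v" for t :: real
  define g2 where "g2 t = (hessian F (a + t *\<^sub>R v) *v v) \<bullet> v" for t :: real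
  have seg: "a + t *\<^sub>R v \<in> V" if "0 \<le> t" "t \<le> 1" for t
  proof -
    have "(1 - t) *\<^sub>R a + t *\<^sub>R \<xi> \<in> V" using V(1) xy that by (intro convexD) auto
    then show ?thesis by (simp add: v_def algebra_simps)
  qed
  have d1: "DERIV g t :> g1 t" if "0 \<le> t" "t \<le> 1" for t
  proof -
    have F: "(F has_derivative (\<lambda>h. h \<bullet> grad F (a + t *\<^sub>R v))) (at (a + t *\<^sub>R v))"
      using C2 V seg[OF that] by (intro grad_has_derivative) (auto simp: C2_on_def)
    have l: "((\<lambda>t. a + t *\<^sub>R v) has_derivative (\<lambda>h. h *\<^sub>R v)) (at t)"
      by (auto intro!: derivative_eq_intros)
    show ?thesis
      unfolding g_def g1_def has_field_derivative_def
      by (rule has_derivative_eq_rhs[OF has_derivative_compose[OF l F]]) (auto simp: fun_eq_iff inner_commute)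
  qed
  have d2: "DERIV g1 t :> g2 t" if "0 \<le> t" "t \<le> 1" for t
  proof -
    have F: "(grad F has_derivative (\<lambda>h. hessian F (a + t *\<^sub>R v) *v h)) (at (a + t *\<^sub>R v))"
      using C2 V seg[OF that] by (intro hessian_has_derivative) (auto simp: C2_on_def)
    have l: "((\<lambda>t. a + t *\<^sub>R v) has_derivative (\<lambda>h. h *\<^sub>R v)) (at t)"
      by (auto intro!: derivative_eq_intros)
    have "((\<lambda>t. grad F (a + t *\<^sub>R v) \<bullet> v) has_derivative (\<lambda>h. (hessian F (a + t *\<^sub>R v) *v (h *\<^sub>R v)) \<bullet> v)) (at t)"
      using has_derivative_compose[OF l F] by (rule has_derivative_inner_left)
    then show ?thesis
      unfolding g1_def g2_def has_field_derivative_def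
      by (rule has_derivative_eq_rhs) (auto simp: fun_eq_iff matrix_vector_mult_scaleR)
  qed
  define D where "D m = (if m = 0 then g else if m = 1 then g1 else g2)" for m :: nat
  have "\<forall>m t. m < 2 \<and> 0 \<le> t \<and> t \<le> 1 \<longrightarrow> DERIV (D m) t :> D (Suc m) t"
    using d1 d2 by (auto simp: D_def less_2_cases_iff)
  from Taylor_up[of 2 D g 0 1 0, OF _ _ this] obtain t where
    t: "0 < t" "t < 1" "g 1 = (\<Sum>m<2. D m 0 / fact m * (1 - 0) ^ m) + D 2 t / fact 2 * (1 - 0)\<^sup>2"
    by (auto simp: D_def)
  have "(\<Sum>m<2. D m 0 / fact m * (1 - 0) ^ m) = g 0 + g1 0"
    by (simp add: D_def numeral_2_eq_2)
  with t have "g 1 = g 0 + g1 0 + g2 t / 2" by (simp add: D_def)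
  then have "bregman F \<xi> a = ((\<xi> - a) \<bullet> (hessian F (a + t *\<^sub>R v) *v (\<xi> - a))) / 2"
    by (simp add: bregman_def g_def g1_def g2_def v_def inner_commute)
  with seg[of t] t show ?thesis by auto
qed

lemma bregman_upper:
  fixes F :: "real^'n \<Rightarrow> real"
  assumes "C2_on U F" "convex V" "V \<subseteq> U" "a \<in> V" "\<xi> \<in> V"
    and "\<And>z. z \<in> V \<Longrightarrow> (\<xi> - a) \<bullet> (hessian F z *v (\<xi> - a)) \<le> l"
  shows "bregman F \<xi> a \<le> l / 2"
  using bregman_taylor[OF assms(1-5)] assms(6) by (metis divide_right_mono zero_le_numeral)

lemma bregman_lower:
  fixes F :: "real^'n \<Rightarrow> real"
  assumes "C2_on U F" "convex V" "V \<subseteq> U" "a \<in> V" "\<xi> \<in> V"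
    and "\<And>z. z \<in> V \<Longrightarrow> l \<le> (\<xi> - a) \<bullet> (hessian F z *v (\<xi> - a))"
  shows "l / 2 \<le> bregman F \<xi> a"
  using bregman_taylor[OF assms(1-5)] assms(6) by (metis divide_right_mono zero_le_numeral)

lemma sym_pos_def_nonneg: "sym_pos_def A \<Longrightarrow> 0 \<le> v \<bullet> (A *v v)"
  unfolding sym_pos_def_def by (cases "v = 0") (auto intro: less_imp_le)

lemma bregman_nonneg:
  fixes F :: "real^'n \<Rightarrow> real"
  assumes "C2_on U F" "convex U" "a \<in> U" "\<xi> \<in> U" "\<And>x. x \<in> U \<Longrightarrow> sym_pos_def (hessian F x)"
  shows "0 \<le> bregman F \<xi> a"
  using bregman_lower[OF assms(1,2) order_refl assms(3,4), of 0] assms(5) sym_pos_def_nonneg by auto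

text \<open>For \<open>b\<close> on the segment from \<open>\<xi>\<close> to \<open>a\<close>, the difference of the divergences with centers \<open>a\<close> and
  \<open>b\<close> is the divergence of \<open>b\<close> from \<open>a\<close> plus a multiple of \<open>(grad F b - grad F a) \<bullet> (b - a)\<close>, which
  is nonnegative because the gradient is monotone.\<close>

lemma bregman_ray_mono:
  fixes F :: "real^'n \<Rightarrow> real"
  assumes U: "C2_on U F" "convex U" "a \<in> U" "\<xi> \<in> U" "\<And>x. x \<in> U \<Longrightarrow> sym_pos_def (hessian F x)"
    and t: "0 \<le> t" "t \<le> 1"
  shows "bregman F \<xi> (\<xi> + t *\<^sub>R (a - \<xi>)) \<le> bregman F \<xi> a"
proof (cases "t = 1")
  case False
  define b where "b = \<xi> + t *\<^sub>R (a - \<xi>)"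
  have "(1 - t) *\<^sub>R \<xi> + t *\<^sub>R a \<in> U" using U t by (intro convexD) auto
  then have b: "b \<in> U" by (simp add: b_def algebra_simps)
  have ba: "b - a = (1 - t) *\<^sub>R (\<xi> - a)" and \<xi>b: "\<xi> - b = t *\<^sub>R (\<xi> - a)"
    by (simp_all add: b_def algebra_simps)
  have "0 \<le> bregman F a b + bregman F b a"
    using U b by (intro add_nonneg_nonneg bregman_nonneg[OF U(1,2)]) auto
  also have "\<dots> = (grad F b - grad F a) \<bullet> (b - a)"
    by (simp add: bregman_def inner_diff_left inner_diff_right)
  also have "\<dots> = (1 - t) * ((grad F b - grad F a) \<bullet> (\<xi> - a))" by (simp add: ba)
  finally have "0 \<le> (grad F b - grad F a) \<bullet> (\<xi> - a)"
    using t False by (simp add: zero_le_mult_iff)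
  then have "0 \<le> (grad F b - grad F a) \<bullet> (\<xi> - b)" using t by (simp add: \<xi>b)
  moreover have "bregman F \<xi> a - bregman F \<xi> b = bregman F b a + (grad F b - grad F a) \<bullet> (\<xi> - b)"
    by (simp add: bregman_def inner_diff_left inner_diff_right)
  moreover have "0 \<le> bregman F b a" using U b by (intro bregman_nonneg[OF U(1,2)]) auto
  ultimately show ?thesis by (simp add: b_def)
qed simp

lemma continuous_on_quadratic_form:
  fixes H :: "'a::topological_space \<Rightarrow> real^'n^'n"
  assumes "continuous_on S H"
  shows "continuous_on (S \<times> T) (\<lambda>(y, v). v \<bullet> (H y *v v))"
proof -
  have "continuous_on (S \<times> T) (\<lambda>z. H (fst z))"
    using assms by (intro continuous_on_compose2[OF assms] continuous_intros) auto
  then have "continuous_on (S \<times> T) (\<lambda>z. \<Sum>i\<in>UNIV. snd z $ i * (\<Sum>j\<in>UNIV. H (fst z) $ i $ j * snd z $ j))"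
    by (intro continuous_intros)
  then show ?thesis
    by (simp add: case_prod_unfold inner_vec_def matrix_vector_mult_def)
qed

text \<open>The form attains its extrema on the compact set of pairs \<open>(x, v)\<close> with \<open>|v| = 1\<close>, and the minimum is
  positive.\<close>

lemma quadratic_form_bounds:
  fixes H :: "real^'n \<Rightarrow> real^'n^'n"
  assumes S: "compact S" "S \<noteq> {}" "continuous_on S H" and pd: "\<And>x. x \<in> S \<Longrightarrow> sym_pos_def (H x)"
  obtains m M where "0 < m" "m \<le> M"
    "\<And>x v. x \<in> S \<Longrightarrow> m * (norm v)\<^sup>2 \<le> v \<bullet> (H x *v v) \<and> v \<bullet> (H x *v v) \<le> M * (norm v)\<^sup>2"
proof -
  let ?f = "\<lambda>(y, v). v \<bullet> (H y *v v)"
  let ?X = "S \<times> sphere (0::real^'n) 1"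
  have X: "compact ?X" "?X \<noteq> {}" "continuous_on ?X ?f"
    using S by (auto intro: compact_Times continuous_on_quadratic_form)
  obtain z where z: "z \<in> ?X" "\<And>x. x \<in> ?X \<Longrightarrow> ?f z \<le> ?f x"
    using continuous_attains_inf[OF X] by blast
  obtain w where w: "w \<in> ?X" "\<And>x. x \<in> ?X \<Longrightarrow> ?f x \<le> ?f w"
    using continuous_attains_sup[OF X] by blast
  show ?thesis
  proof (rule that[of "?f z" "?f w"])
    obtain y e where ye: "z = (y, e)" "y \<in> S" "norm e = 1" using z(1) by auto
    then have "e \<noteq> 0" by auto
    with pd[OF ye(2)] ye show "0 < ?f z" by (simp add: sym_pos_def_def)
    show "?f z \<le> ?f w" using w(1) by (rule z(2))
    fix x v assume x: "x \<in> S"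
    show "?f z * (norm v)\<^sup>2 \<le> v \<bullet> (H x *v v) \<and> v \<bullet> (H x *v v) \<le> ?f w * (norm v)\<^sup>2"
    proof (cases "v = 0")
      case False
      define e where "e = (1 / norm v) *\<^sub>R v"
      have e: "(x, e) \<in> ?X" using x False by (simp add: e_def)
      have "v = norm v *\<^sub>R e" using False by (simp add: e_def)
      then have "v \<bullet> (H x *v v) = (norm v *\<^sub>R e) \<bullet> (H x *v (norm v *\<^sub>R e))" by simp
      also have "\<dots> = ?f (x, e) * (norm v)\<^sup>2"
        by (simp add: matrix_vector_mult_scaleR power2_eq_square)
      finally show ?thesis using z(2)[OF e] w(2)[OF e] by (simp add: mult_right_mono)
    qed simp
  qed
qed

text \<open>A center outside \<open>W\<close> is at distance more than \<open>\<tau>\<close> from \<open>\<xi>\<close>. By monotonicity along rays its divergence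
  is at least that of a point at distance \<open>\<tau>\<close>, which is bounded below uniformly on \<open>A\<close>; a sufficiently
  fine finite net of \<open>A\<close> does better.\<close>

lemma bregman_localization:
  fixes F :: "real^'n \<Rightarrow> real"
  assumes U: "C2_on U F" "convex U" "\<And>x. x \<in> U \<Longrightarrow> sym_pos_def (hessian F x)"
    and A: "compact A" "A \<subseteq> W" "open W" "W \<subseteq> U"
  obtains G where "finite G" "G \<subseteq> A"
    "\<And>\<xi> a. \<xi> \<in> A \<Longrightarrow> a \<in> U - W \<Longrightarrow> \<exists>g\<in>G. bregman F \<xi> g \<le> bregman F \<xi> a"
proof (cases "A = {}")
  case False
  obtain \<epsilon> where \<epsilon>: "\<epsilon> > 0" "(\<Union>x\<in>A. ball x \<epsilon>) \<subseteq> W"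
    using compact_subset_open_imp_ball_epsilon_subset[OF A(1,3,2)] by auto
  define \<tau> where "\<tau> = \<epsilon> / 2"
  have \<tau>: "0 < \<tau>" "\<tau> < \<epsilon>" using \<epsilon> by (auto simp: \<tau>_def)
  define B where "B = {x + y |x y. x \<in> A \<and> y \<in> cball 0 \<tau>}"
  have "compact B" unfolding B_def using A by (intro compact_sums) auto
  have cb: "cball x \<tau> \<subseteq> B" if "x \<in> A" for x
  proof
    fix z assume "z \<in> cball x \<tau>"
    then have "z = x + (z - x)" "z - x \<in> cball 0 \<tau>" by (auto simp: dist_norm norm_minus_commute)
    then show "z \<in> B" unfolding B_def using that by blast
  qed
  have "B \<subseteq> W"
  proof
    fix z assume "z \<in> B"
    then obtain x y where "x \<in> A" "norm y \<le> \<tau>" "z = x + y" by (auto simp: B_def)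
    then have "z \<in> ball x \<epsilon>" using \<tau> by (simp add: dist_norm)
    then show "z \<in> W" using \<epsilon> \<open>x \<in> A\<close> by blast
  qed
  then have "B \<subseteq> U" using A by simp
  have "B \<noteq> {}" using False cb \<tau> by fastforce
  have "continuous_on B (hessian F)" using U \<open>B \<subseteq> U\<close> by (auto simp: C2_on_def intro: continuous_on_subset)
  from quadratic_form_bounds[OF \<open>compact B\<close> \<open>B \<noteq> {}\<close> this] U(3) \<open>B \<subseteq> U\<close>
  obtain m M where mM: "0 < m" "m \<le> M"
    "\<And>x v. x \<in> B \<Longrightarrow> m * (norm v)\<^sup>2 \<le> v \<bullet> (hessian F x *v v) \<and> v \<bullet> (hessian F x *v v) \<le> M * (norm v)\<^sup>2"
    by blast
  \<comment> \<open>A net of this mesh does better than any point at distance \<open>\<tau>\<close>.\<close>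
  define \<rho> where "\<rho> = \<tau> * sqrt (m / M)"
  have \<rho>: "0 < \<rho>" "\<rho> \<le> \<tau>" "M * \<rho>\<^sup>2 = m * \<tau>\<^sup>2"
    using mM \<tau> by (auto simp: \<rho>_def power_mult_distrib mult_le_cancel_left1)
  obtain G where G: "finite G" "G \<subseteq> A" "A \<subseteq> (\<Union>x\<in>G. ball x \<rho>)"
    using seq_compact_imp_totally_bounded[of A] A(1) \<rho>(1) by (auto simp: compact_eq_seq_compact_metric)
  show ?thesis
  proof (rule that[OF G(1,2)])
    fix \<xi> a assume \<xi>: "\<xi> \<in> A" and a: "a \<in> U - W"
    have "a \<notin> ball \<xi> \<epsilon>" using a \<epsilon>(2) \<xi> by blast
    then have far: "\<epsilon> \<le> norm (a - \<xi>)" by (simp add: dist_norm norm_minus_commute)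
    define t where "t = \<tau> / norm (a - \<xi>)"
    define b where "b = \<xi> + t *\<^sub>R (a - \<xi>)"
    have "0 < norm (a - \<xi>)" using far \<tau> by linarith
    then have t: "0 \<le> t" "t \<le> 1" using far \<tau> by (auto simp: t_def divide_le_eq_1)
    have nb: "norm (\<xi> - b) = \<tau>" using far \<tau> \<epsilon> by (auto simp: b_def t_def)
    have \<xi>U: "\<xi> \<in> U" using \<xi> A by auto
    have "m * \<tau>\<^sup>2 / 2 \<le> bregman F \<xi> b"
    proof (rule bregman_lower[OF U(1) convex_cball])
      show "cball \<xi> \<tau> \<subseteq> U" using cb[OF \<xi>] \<open>B \<subseteq> U\<close> by auto
      show "m * \<tau>\<^sup>2 \<le> (\<xi> - b) \<bullet> (hessian F z *v (\<xi> - b))" if "z \<in> cball \<xi> \<tau>" for z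
        using mM(3)[of z "\<xi> - b"] cb[OF \<xi>] that nb by auto
    qed (use nb \<tau> in \<open>auto simp: dist_norm\<close>)
    also have "\<dots> \<le> bregman F \<xi> a"
      unfolding b_def using a \<xi>U t U by (intro bregman_ray_mono[OF U(1,2)]) auto
    finally have lower: "m * \<tau>\<^sup>2 / 2 \<le> bregman F \<xi> a" .
    obtain g where g: "g \<in> G" "norm (\<xi> - g) \<le> \<rho>"
      using G(3) \<xi> by (auto simp: dist_norm norm_minus_commute less_imp_le subset_eq)
    have "bregman F \<xi> g \<le> M * \<rho>\<^sup>2 / 2"
    proof (rule bregman_upper[OF U(1) convex_cball])
      show "cball \<xi> \<tau> \<subseteq> U" using cb[OF \<xi>] \<open>B \<subseteq> U\<close> by auto
      show "(\<xi> - g) \<bullet> (hessian F z *v (\<xi> - g)) \<le> M * \<rho>\<^sup>2" if "z \<in> cball \<xi> \<tau>" for z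
      proof -
        have "(\<xi> - g) \<bullet> (hessian F z *v (\<xi> - g)) \<le> M * (norm (\<xi> - g))\<^sup>2"
          using mM(3)[of z "\<xi> - g"] cb[OF \<xi>] that by auto
        also have "\<dots> \<le> M * \<rho>\<^sup>2" using g mM by (intro mult_left_mono power_mono) auto
        finally show ?thesis .
      qed
    qed (use g \<rho> \<tau> in \<open>auto simp: dist_norm\<close>)
    with lower g show "\<exists>g\<in>G. bregman F \<xi> g \<le> bregman F \<xi> a" unfolding \<rho>(3) by (intro bexI[of _ g]) auto
  qed
qed (use that in auto)

section \<open>Square roots of positive definite matrices\<close>

text \<open>The Gram-Schmidt process for the inner product \<open>x \<bullet> (A *v y)\<close>.\<close>

lemma pos_def_orthonormal_set:
  fixes A :: "real^'n^'n"
  assumes A: "sym_pos_def A" and k: "k \<le> CARD('n)"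
  shows "\<exists>S. finite S \<and> card S = k \<and> (\<forall>s\<in>S. \<forall>t\<in>S. s \<bullet> (A *v t) = (if s = t then 1 else 0))"
  using k
proof (induction k)
  case 0
  then show ?case by (intro exI[of _ "{}"]) auto
next
  case (Suc k)
  then obtain S where S: "finite S" "card S = k" "\<And>s t. s \<in> S \<Longrightarrow> t \<in> S \<Longrightarrow> s \<bullet> (A *v t) = (if s = t then 1 else 0)"
    by auto
  have sym: "x \<bullet> (A *v y) = y \<bullet> (A *v x)" for x y
  proof -
    have "x \<bullet> (A *v y) = (x v* A) \<bullet> y" by (rule dot_lmul_matrix[symmetric])
    also have "x v* A = transpose A *v x" by (rule transpose_matrix_vector[symmetric])
    also have "transpose A = A" using A by (simp add: sym_pos_def_def)
    finally show ?thesis by (simp add: inner_commute)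
  qed
  have "dim ((*v) A ` S) \<le> card ((*v) A ` S)" using S by (intro dim_le_card') auto
  also have "\<dots> \<le> k" using card_image_le[OF S(1)] S(2) by auto
  finally have "dim ((*v) A ` S) < DIM(real^'n)" using Suc.prems by simp
  then obtain w where w: "w \<noteq> 0" "\<And>y. y \<in> span ((*v) A ` S) \<Longrightarrow> orthogonal w y"
    by (rule orthogonal_to_subspace_exists) blast
  have ws: "w \<bullet> (A *v s) = 0" if "s \<in> S" for s
    using w(2)[of "A *v s"] that by (auto simp: orthogonal_def intro: span_base)
  have pos: "0 < w \<bullet> (A *v w)" using A w(1) by (simp add: sym_pos_def_def)
  define e where "e = (1 / sqrt (w \<bullet> (A *v w))) *\<^sub>R w"
  have ee: "e \<bullet> (A *v e) = 1"
    using pos by (simp add: e_def matrix_vector_mult_scaleR power2_eq_square[symmetric] real_sqrt_pow2 field_simps)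
  have es: "e \<bullet> (A *v s) = 0" "s \<bullet> (A *v e) = 0" if "s \<in> S" for s
    using ws[OF that] sym[of s e] by (auto simp: e_def)
  have "e \<notin> S" using es(1)[of e] ee by auto
  then show ?case
    using S ee es by (intro exI[of _ "insert e S"]) auto
qed

text \<open>If the columns of \<open>M\<close> are orthonormal for the inner product defined by \<open>A\<close>, then \<open>L\<close> is the inverse of \<open>M\<close>.\<close>

lemma pos_def_square_root:
  fixes A :: "real^'n^'n"
  assumes A: "sym_pos_def A"
  obtains L where "det L \<noteq> 0" "(det L)\<^sup>2 = det A" "\<And>v. v \<bullet> (A *v v) = (norm (L *v v))\<^sup>2"
proof -
  obtain S where S: "finite S" "card S = CARD('n)" "\<And>s t. s \<in> S \<Longrightarrow> t \<in> S \<Longrightarrow> s \<bullet> (A *v t) = (if s = t then 1 else 0)"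
    using pos_def_orthonormal_set[OF A order_refl] by blast
  obtain f where f: "bij_betw f (UNIV :: 'n set) S"
    using finite_same_card_bij[of "UNIV :: 'n set" S] S by auto
  define M :: "real^'n^'n" where "M = (\<chi> i j. f j $ i)"
  have col: "M *v axis j 1 = f j" for j
    by (simp add: M_def vec_eq_iff matrix_vector_mult_def axis_def if_distrib cong: if_cong)
  have inner_M: "(M *v x) \<bullet> y = x \<bullet> (transpose M *v y)" for x y
  proof -
    have "(M *v x) \<bullet> y = y \<bullet> (M *v x)" by (rule inner_commute)
    also have "\<dots> = (y v* M) \<bullet> x" by (rule dot_lmul_matrix[symmetric])
    also have "\<dots> = x \<bullet> (transpose M *v y)" by (simp add: transpose_matrix_vector inner_commute)
    finally show ?thesis .
  qed
  have one: "transpose M ** (A ** M) = mat 1"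
  proof -
    have "(transpose M ** (A ** M)) $ i $ j = (mat 1 :: real^'n^'n) $ i $ j" for i j
    proof -
      have "(transpose M ** (A ** M)) $ i $ j = axis i 1 \<bullet> ((transpose M ** (A ** M)) *v axis j 1)"
        by (simp add: inner_axis' matrix_vector_mult_basis column_def)
      also have "\<dots> = (M *v axis i 1) \<bullet> (A *v (M *v axis j 1))"
        by (simp add: inner_M matrix_vector_mul_assoc matrix_mul_assoc)
      also have "\<dots> = f i \<bullet> (A *v f j)" by (simp add: col)
      also have "\<dots> = (if f i = f j then 1 else 0)" using f by (intro S) (auto simp: bij_betw_def)
      also have "\<dots> = (mat 1 :: real^'n^'n) $ i $ j"
        using f by (auto simp: mat_def bij_betw_def inj_on_def)
      finally show ?thesis .
    qed
    then show ?thesis by (simp add: vec_eq_iff)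
  qed
  have det1: "det M * (det A * det M) = 1"
    using arg_cong[OF one, of det] by (simp add: det_mul det_transpose)
  then have nz: "det M \<noteq> 0" by auto
  define L where "L = transpose M ** A"
  have LM: "L ** M = mat 1" using one by (simp add: L_def matrix_mul_assoc)
  then have right_inv: "M ** L = mat 1" by (simp add: matrix_left_right_inverse)
  show ?thesis
  proof (rule that[of L])
    have "det L * det M = 1" using arg_cong[OF LM, of det] by (simp add: det_mul)
    then show "det L \<noteq> 0" by auto
    show "(det L)\<^sup>2 = det A"
      using det1 \<open>det L * det M = 1\<close> nz by (simp add: L_def det_mul det_transpose power2_eq_square mult_ac)
    fix v
    have "v = M *v (L *v v)" using right_inv by (simp add: matrix_vector_mul_assoc)
    then have "v \<bullet> (A *v v) = (M *v (L *v v)) \<bullet> (A *v v)" by simp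
    also have "\<dots> = (L *v v) \<bullet> (L *v v)" by (simp only: inner_M) (simp add: L_def matrix_vector_mul_assoc)
    finally show "v \<bullet> (A *v v) = (norm (L *v v))\<^sup>2" by (simp add: power2_norm_eq_inner)
  qed
qed

section \<open>Tame pieces\<close>

text \<open>Used to let the distortion \<open>\<kappa>\<close> of tame pieces tend to 1.\<close>

lemma ennreal_le_by_factor:
  assumes "\<And>\<kappa>. 1 < \<kappa> \<Longrightarrow> x \<le> ennreal (\<kappa> powr \<beta>) * y"
  shows "x \<le> y"
proof (cases y rule: ennreal_cases)
  case (real b)
  have "((\<lambda>\<kappa>. ennreal (\<kappa> powr \<beta> * b)) \<longlongrightarrow> ennreal (1 powr \<beta> * b)) (at_right 1)"
    by (intro tendsto_intros) auto
  moreover have "\<forall>\<^sub>F \<kappa> in at_right 1. x \<le> ennreal (\<kappa> powr \<beta> * b)"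
  proof (rule eventually_mono[OF eventually_at_right_less])
    fix \<kappa> :: real assume "1 < \<kappa>"
    then show "x \<le> ennreal (\<kappa> powr \<beta> * b)" using assms[of \<kappa>] real by (simp add: ennreal_mult)
  qed
  ultimately show ?thesis using real tendsto_lowerbound[of _ _ "at_right (1::real)" x] by fastforce
qed simp

lemma nn_integral_linear_image:
  fixes L :: "real^'n^'n" and f :: "real^'n \<Rightarrow> ennreal"
  assumes L: "det L \<noteq> 0" and K: "(*v) L ` K \<in> sets borel" and [measurable]: "f \<in> borel_measurable borel"
  shows "(\<integral>\<^sup>+x\<in>(*v) L ` K. f x \<partial>lborel) = ennreal \<bar>det L\<bar> * (\<integral>\<^sup>+x\<in>K. f (L *v x) \<partial>lborel)"
proof -
  have inj: "inj ((*v) L)" using L by (simp add: inj_matrix_vector_mult invertible_det_nz)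
  have ind: "indicator ((*v) L ` K) (0 + L *v x) = (indicator K x :: ennreal)" for x
    using inj by (auto simp: indicator_def inj_image_mem_iff)
  have "(\<integral>\<^sup>+x\<in>(*v) L ` K. f x \<partial>lborel)
    = ennreal \<bar>det L\<bar> * (\<integral>\<^sup>+x. f (0 + L *v x) * indicator ((*v) L ` K) (0 + L *v x) \<partial>lborel)"
    using L K by (intro nn_integral_lborel_affine) auto
  then show ?thesis unfolding ind by simp
qed

lemma measure_linear_image_compact:
  fixes L :: "real^'n^'n"
  assumes L: "det L \<noteq> 0" and K: "compact K"
  shows "compact ((*v) L ` K)" "measure lborel ((*v) L ` K) = \<bar>det L\<bar> * measure lborel K"
proof -
  show LK: "compact ((*v) L ` K)"
    using K by (intro compact_continuous_image) (auto intro: linear_continuous_on matrix_vector_mul_bounded_linear)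
  have "emeasure lborel ((*v) L ` K) = (\<integral>\<^sup>+x\<in>(*v) L ` K. 1 \<partial>lborel)"
    using LK by (simp add: borel_compact)
  also have "\<dots> = ennreal \<bar>det L\<bar> * (\<integral>\<^sup>+x\<in>K. 1 \<partial>lborel)"
    using LK by (intro nn_integral_linear_image L) (auto simp: borel_compact)
  also have "\<dots> = ennreal \<bar>det L\<bar> * emeasure lborel K"
    using K by (simp add: borel_compact)
  finally show "measure lborel ((*v) L ` K) = \<bar>det L\<bar> * measure lborel K"
    by (simp add: measure_def enn2real_mult)
qed

lemma sq_powr_half: "0 \<le> (a::real) \<Longrightarrow> (a\<^sup>2) powr (r / 2) = a powr r"
  by (cases "a = 0") (auto simp: powr_powr powr_numeral[symmetric] simp del: powr_numeral)

lemma quadratic_form_le_norm: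
  fixes A :: "real^'n^'n"
  shows "\<bar>v \<bullet> (A *v v)\<bar> \<le> (real CARD('n))\<^sup>2 * norm A * (norm v)\<^sup>2"
proof -
  have "\<bar>v \<bullet> (A *v v)\<bar> = \<bar>\<Sum>i\<in>UNIV. \<Sum>j\<in>UNIV. v $ i * (A $ i $ j * v $ j)\<bar>"
    by (simp add: inner_vec_def matrix_vector_mult_def sum_distrib_left)
  also have "\<dots> \<le> (\<Sum>i\<in>UNIV. \<Sum>j\<in>UNIV. \<bar>v $ i * (A $ i $ j * v $ j)\<bar>)"
    by (intro order_trans[OF sum_abs] sum_mono sum_abs)
  also have "\<dots> \<le> (\<Sum>i\<in>(UNIV::'n set). \<Sum>j\<in>(UNIV::'n set). norm v * (norm A * norm v))"
  proof (intro sum_mono)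
    fix i j :: 'n
    have "\<bar>A $ i $ j\<bar> \<le> norm (A $ i)" by (rule component_le_norm_cart)
    also have "\<dots> \<le> norm A" by (rule Finite_Cartesian_Product.norm_nth_le)
    finally show "\<bar>v $ i * (A $ i $ j * v $ j)\<bar> \<le> norm v * (norm A * norm v)"
      by (simp add: abs_mult mult_mono component_le_norm_cart)
  qed
  finally show ?thesis by (simp add: power2_eq_square mult_ac)
qed

text \<open>Zador's constant is finite, and \<open>Q\<close> is its real value.\<close>

locale bregman_quantization =
  fixes U :: "(real^'n) set" and F :: "real^'n \<Rightarrow> real" and r :: real
    and P :: "(real^'n) measure" and h :: "real^'n \<Rightarrow> ennreal" and q p Q :: real
  assumes r: "0 < r" and U: "U \<noteq> {}" "open U" "convex U"
    and C2: "C2_on U F" and pd: "\<And>x. x \<in> U \<Longrightarrow> sym_pos_def (hessian F x)"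
    and P: "finite_measure P" "sets P = sets borel" and ac: "ac_density P h"
    and q: "q = r / real CARD('n)" and p: "p = 1 / (1 + q)"
    and Q: "zador_const TYPE('n) r = ennreal Q" "0 \<le> Q"
begin

lemma q_gt0: "0 < q" using r by (simp add: q)

lemmas p_gt0 = p_pos[OF q_gt0 p]

abbreviation hess_weight :: "real^'n \<Rightarrow> real" where
  "hess_weight x \<equiv> det (hessian F x) powr (r / (2 * real CARD('n)))"

text \<open>The indicator makes the cost Borel measurable: nothing is known about \<open>F\<close> outside \<open>U\<close>.\<close>

definition bcost :: "real^'n \<Rightarrow> real^'n \<Rightarrow> ennreal" where
  "bcost \<xi> a = ennreal (bregman F \<xi> a powr (r / 2)) * indicator U \<xi>"

text \<open>Up to the factor \<open>limit_const\<close>, this is the measure that the \<open>p\<close>-th powers of both rates turn out to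
  be.\<close>

definition limit_measure :: "(real^'n) measure" where
  "limit_measure = density lborel (\<lambda>x. ennreal_powr (ennreal (hess_weight x) * h x) p * indicator U x)"

definition limit_const :: real where "limit_const = (Q * 2 powr - (r / 2)) powr p"

text \<open>On a piece that is tame with distortion \<open>\<kappa>\<close> the rates are known up to the factor \<open>\<kappa>\<^sup>\<beta>\<close>.\<close>

definition \<beta> :: real where "\<beta> = (2 + r / 2) * p"

lemma h_measurable [measurable]: "h \<in> borel_measurable borel"
  using ac by (simp add: ac_density_def)

lemma U_sets [measurable]: "U \<in> sets borel" using U by simp

lemma bcost_measurable [measurable]: "(\<lambda>\<xi>. bcost \<xi> a) \<in> borel_measurable borel"
proof -
  have "continuous_on U F"
    using C2 by (auto simp: C2_on_def continuous_on_eq_continuous_at U(2) intro: differentiable_imp_continuous_within)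
  then have "continuous_on U (\<lambda>\<xi>. bregman F \<xi> a)"
    unfolding bregman_def by (intro continuous_intros)
  then have [measurable]: "(\<lambda>\<xi>. indicator U \<xi> *\<^sub>R bregman F \<xi> a) \<in> borel_measurable borel"
    by (intro borel_measurable_continuous_on_indicator) auto
  have "(\<lambda>\<xi>. bcost \<xi> a) = (\<lambda>\<xi>. ennreal ((indicator U \<xi> *\<^sub>R bregman F \<xi> a) powr (r / 2)) * indicator U \<xi>)"
    by (auto simp: bcost_def fun_eq_iff indicator_def)
  also have "\<dots> \<in> borel_measurable borel" by measurable
  finally show ?thesis .
qed

lemma continuous_on_det_hessian: "continuous_on U (\<lambda>x. det (hessian F x))"
  using C2 unfolding C2_on_def det_def by (intro continuous_intros) auto

lemma det_hessian_pos: "x \<in> U \<Longrightarrow> 0 < det (hessian F x)"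
  using pos_def_square_root[OF pd] by (metis zero_less_power2)

lemma limit_density_measurable [measurable]:
  "(\<lambda>x. ennreal_powr (ennreal (hess_weight x) * h x) p * indicator U x)
    \<in> borel_measurable borel"
proof -
  have [measurable]: "(\<lambda>x. indicator U x *\<^sub>R det (hessian F x)) \<in> borel_measurable borel"
    using continuous_on_det_hessian by (intro borel_measurable_continuous_on_indicator) auto
  have "(\<lambda>x. ennreal_powr (ennreal (hess_weight x) * h x) p * indicator U x)
    = (\<lambda>x. ennreal_powr (ennreal ((indicator U x *\<^sub>R det (hessian F x)) powr (r / (2 * real CARD('n)))) * h x) p * indicator U x)"
    by (auto simp: fun_eq_iff indicator_def)
  also have "\<dots> \<in> borel_measurable borel" using p_gt0 by measurable
  finally show ?thesis .
qed

lemma sets_limit_measure: "sets limit_measure = sets borel" by (simp add: limit_measure_def)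

lemma emeasure_limit_measure:
  "A \<in> sets borel \<Longrightarrow> emeasure limit_measure A = (\<integral>\<^sup>+x\<in>A. (ennreal_powr (ennreal (hess_weight x) * h x) p * indicator U x) \<partial>lborel)"
  unfolding limit_measure_def by (subst emeasure_density) auto

text \<open>The null set \<open>N\<close> carries the singular part of \<open>P\<close>. Off \<open>N\<close> the measure \<open>P\<close> has density \<open>h\<close>, and everywhere
  it is at least the measure with density \<open>h\<close>.\<close>

lemma singular_set:
  obtains N where "N \<in> null_sets lborel"
    "\<And>A f. A \<in> sets borel \<Longrightarrow> A \<inter> N = {} \<Longrightarrow> f \<in> borel_measurable borel
      \<Longrightarrow> (\<integral>\<^sup>+x\<in>A. f x \<partial>P) = (\<integral>\<^sup>+x\<in>A. h x * f x \<partial>lborel)"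
    "\<And>A f. A \<in> sets borel \<Longrightarrow> f \<in> borel_measurable borel
      \<Longrightarrow> (\<integral>\<^sup>+x\<in>A. h x * f x \<partial>lborel) \<le> (\<integral>\<^sup>+x\<in>A. f x \<partial>P)"
proof -
  obtain S N where S: "sets S = sets borel" "N \<in> null_sets lborel" "emeasure S (- N) = 0"
    "\<And>A. A \<in> sets borel \<Longrightarrow> emeasure P A = emeasure (density lborel h) A + emeasure S A"
    using ac unfolding ac_density_def by blast
  note [measurable_cong] = P(2)
  have N [measurable]: "N \<in> sets borel" using S(2) by auto
  have off: "(\<integral>\<^sup>+x\<in>A. f x \<partial>P) = (\<integral>\<^sup>+x\<in>A. h x * f x \<partial>lborel)"
    if A [measurable]: "A \<in> sets borel" and AN: "A \<inter> N = {}" and [measurable]: "f \<in> borel_measurable borel"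
    for A and f :: "real^'n \<Rightarrow> ennreal"
  proof -
    have "density P (indicator A) = density lborel (\<lambda>x. h x * indicator A x)"
    proof (rule measure_eqI)
      fix X assume "X \<in> sets (density P (indicator A))"
      then have X [measurable]: "X \<in> sets borel" by (simp add: P)
      have "emeasure S (A \<inter> X) \<le> emeasure S (- N)" using AN by (intro emeasure_mono) (auto simp: S)
      then have "emeasure S (A \<inter> X) = 0" using S by simp
      have "emeasure (density P (indicator A)) X = emeasure P (A \<inter> X)"
        by (rule emeasure_restricted) (simp_all add: P)
      also have "\<dots> = emeasure (density lborel h) (A \<inter> X)"
        using \<open>emeasure S (A \<inter> X) = 0\<close> by (subst S) auto
      also have "\<dots> = emeasure (density lborel (\<lambda>x. h x * indicator A x)) X"
        by (simp add: emeasure_density indicator_inter_arith mult.assoc)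
      finally show "emeasure (density P (indicator A)) X = emeasure (density lborel (\<lambda>x. h x * indicator A x)) X" .
    qed (simp add: P)
    then have "(\<integral>\<^sup>+x. f x \<partial>density P (indicator A)) = (\<integral>\<^sup>+x. f x \<partial>density lborel (\<lambda>x. h x * indicator A x))"
      by simp
    then show ?thesis by (simp add: nn_integral_density mult_ac)
  qed
  have le: "(\<integral>\<^sup>+x\<in>A. h x * f x \<partial>lborel) \<le> (\<integral>\<^sup>+x\<in>A. f x \<partial>P)"
    if A [measurable]: "A \<in> sets borel" and [measurable]: "f \<in> borel_measurable borel"
    for A and f :: "real^'n \<Rightarrow> ennreal"
  proof -
    have "AE x in lborel. x \<notin> N" using S(2) by (rule AE_not_in)
    then have "(\<integral>\<^sup>+x\<in>A. h x * f x \<partial>lborel) = (\<integral>\<^sup>+x\<in>A - N. h x * f x \<partial>lborel)"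
      by (intro nn_integral_cong_AE) (auto simp: indicator_def)
    also have "\<dots> = (\<integral>\<^sup>+x\<in>A - N. f x \<partial>P)" by (intro off[symmetric]) auto
    also have "\<dots> \<le> (\<integral>\<^sup>+x\<in>A. f x \<partial>P)" by (rule nn_set_integral_set_mono) auto
    finally show ?thesis .
  qed
  show ?thesis by (rule that[OF S(2)]) (use off le in auto)
qed

text \<open>Up to the factor \<open>\<kappa>\<close>, the density is the constant \<open>c\<close> on \<open>E\<close>, and the Hessian is \<open>L\<^sup>T L\<close> on the convex open
  neighborhood \<open>Ob\<close> of \<open>E\<close>, in which the centers for \<open>E\<close> are to be placed.\<close>

definition tame :: "real \<Rightarrow> (real^'n) set \<Rightarrow> (real^'n) set \<Rightarrow> real^'n^'n \<Rightarrow> real \<Rightarrow> (real^'n) set \<Rightarrow> bool" where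
  "tame \<kappa> V Ob L c E \<longleftrightarrow>
     open Ob \<and> convex Ob \<and> bounded Ob \<and> Ob \<subseteq> V \<and> E \<subseteq> Ob \<and> E \<in> sets borel \<and> 0 < c \<and> det L \<noteq> 0 \<and>
     (\<forall>x\<in>Ob. \<forall>v. (norm (L *v v))\<^sup>2 / \<kappa> \<le> v \<bullet> (hessian F x *v v) \<and> v \<bullet> (hessian F x *v v) \<le> \<kappa> * (norm (L *v v))\<^sup>2) \<and>
     (\<forall>x\<in>E. ennreal c \<le> h x \<and> h x \<le> ennreal (\<kappa> * c)) \<and>
     (\<forall>x\<in>E. \<bar>det L\<bar> powr q / \<kappa> \<le> hess_weight x \<and>
        hess_weight x \<le> \<kappa> * \<bar>det L\<bar> powr q)"

lemma tame_subset: "tame \<kappa> V Ob L c E \<Longrightarrow> E' \<subseteq> E \<Longrightarrow> E' \<in> sets borel \<Longrightarrow> tame \<kappa> V Ob L c E'"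
  unfolding tame_def by blast

lemma tame_limit_measure:
  assumes \<kappa>: "1 < \<kappa>" and T: "tame \<kappa> V Ob L c E" and V: "V \<subseteq> U"
  shows "ennreal ((\<bar>det L\<bar> powr q * c / \<kappa>) powr p) * emeasure lborel E \<le> emeasure limit_measure E"
    and "emeasure limit_measure E \<le> ennreal ((\<kappa>\<^sup>2 * (\<bar>det L\<bar> powr q * c)) powr p) * emeasure lborel E"
proof -
  let ?g = "\<lambda>x. ennreal_powr (ennreal (hess_weight x) * h x) p * indicator U x"
  have E: "E \<in> sets borel" "E \<subseteq> U" "0 < c" using T V by (auto simp: tame_def)
  have bounds: "ennreal ((\<bar>det L\<bar> powr q * c / \<kappa>) powr p) \<le> ?g x \<and> ?g x \<le> ennreal ((\<kappa>\<^sup>2 * (\<bar>det L\<bar> powr q * c)) powr p)"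
    if x: "x \<in> E" for x
  proof -
    let ?a = "hess_weight x"
    have b: "ennreal c \<le> h x" "h x \<le> ennreal (\<kappa> * c)" "\<bar>det L\<bar> powr q / \<kappa> \<le> ?a" "?a \<le> \<kappa> * \<bar>det L\<bar> powr q"
      using T x by (auto simp: tame_def)
    have "ennreal ((\<bar>det L\<bar> powr q * c / \<kappa>) powr p) = ennreal_powr (ennreal (\<bar>det L\<bar> powr q / \<kappa>) * ennreal c) p"
      using \<kappa> E by (simp add: ennreal_mult[symmetric])
    also have "\<dots> \<le> ennreal_powr (ennreal ?a * h x) p"
      using p_gt0 b by (intro ennreal_powr_mono mult_mono ennreal_leI) auto
    finally have lo: "ennreal ((\<bar>det L\<bar> powr q * c / \<kappa>) powr p) \<le> ennreal_powr (ennreal ?a * h x) p" .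
    have "ennreal_powr (ennreal ?a * h x) p \<le> ennreal_powr (ennreal (\<kappa> * \<bar>det L\<bar> powr q) * ennreal (\<kappa> * c)) p"
      using p_gt0 b by (intro ennreal_powr_mono mult_mono ennreal_leI) auto
    also have "\<dots> = ennreal ((\<kappa>\<^sup>2 * (\<bar>det L\<bar> powr q * c)) powr p)"
      using \<kappa> E by (simp add: ennreal_mult[symmetric] power2_eq_square mult_ac)
    finally show ?thesis using lo x E by (auto simp: indicator_def)
  qed
  have "ennreal ((\<bar>det L\<bar> powr q * c / \<kappa>) powr p) * emeasure lborel E
     = (\<integral>\<^sup>+x\<in>E. ennreal ((\<bar>det L\<bar> powr q * c / \<kappa>) powr p) \<partial>lborel)"
    using E by (simp add: nn_integral_cmult_indicator)
  also have "\<dots> \<le> emeasure limit_measure E"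
    unfolding emeasure_limit_measure[OF E(1)] using bounds by (intro nn_set_integral_mono_on) blast
  finally show "ennreal ((\<bar>det L\<bar> powr q * c / \<kappa>) powr p) * emeasure lborel E \<le> emeasure limit_measure E" .
  have "emeasure limit_measure E \<le> (\<integral>\<^sup>+x\<in>E. ennreal ((\<kappa>\<^sup>2 * (\<bar>det L\<bar> powr q * c)) powr p) \<partial>lborel)"
    unfolding emeasure_limit_measure[OF E(1)] using bounds by (intro nn_set_integral_mono_on) blast
  also have "\<dots> = ennreal ((\<kappa>\<^sup>2 * (\<bar>det L\<bar> powr q * c)) powr p) * emeasure lborel E"
    using E by (simp add: nn_integral_cmult_indicator)
  finally show "emeasure limit_measure E \<le> \<dots>" .
qed

lemma ecost_linear_measurable [measurable]: "(\<lambda>\<xi>. ecost r (L *v \<xi>) b) \<in> borel_measurable borel" for L :: "real^'n^'n"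
proof -
  have [measurable]: "(*v) L \<in> borel_measurable borel"
    by (intro borel_measurable_continuous_onI linear_continuous_on matrix_vector_mul_bounded_linear)
  show ?thesis unfolding ecost_def by measurable
qed

lemma borel_measurable_INF_finite:
  "finite \<Gamma> \<Longrightarrow> (\<And>a. a \<in> \<Gamma> \<Longrightarrow> (\<lambda>\<xi>. c \<xi> a) \<in> borel_measurable M)
    \<Longrightarrow> (\<lambda>\<xi>. INF a\<in>\<Gamma>. c \<xi> a :: ennreal) \<in> borel_measurable M"
  by (intro borel_measurable_INF countable_finite) auto

lemma INF_mono_on: "(\<And>a. a \<in> A \<Longrightarrow> f a \<le> g a) \<Longrightarrow> (INF a\<in>A. f a :: ennreal) \<le> (INF a\<in>A. g a)"
  by (rule INF_mono) blast

lemma tame_cost: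
  assumes \<kappa>: "1 < \<kappa>" and T: "tame \<kappa> V Ob L c E" and V: "V \<subseteq> U" and \<xi>: "\<xi> \<in> Ob" "a \<in> Ob"
  shows "bcost \<xi> a \<le> ennreal ((\<kappa> / 2) powr (r / 2)) * ecost r (L *v \<xi>) (L *v a)"
    and "ennreal ((1 / (2 * \<kappa>)) powr (r / 2)) * ecost r (L *v \<xi>) (L *v a) \<le> bcost \<xi> a"
proof -
  have Ob: "convex Ob" "Ob \<subseteq> U" and b: "\<And>x v. x \<in> Ob \<Longrightarrow> (norm (L *v v))\<^sup>2 / \<kappa> \<le> v \<bullet> (hessian F x *v v)
      \<and> v \<bullet> (hessian F x *v v) \<le> \<kappa> * (norm (L *v v))\<^sup>2"
    using T V by (auto simp: tame_def)
  define w where "w = norm (L *v (\<xi> - a))"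
  have up: "bregman F \<xi> a \<le> \<kappa> * w\<^sup>2 / 2"
    using b unfolding w_def by (intro bregman_upper[OF C2 Ob \<xi>(2,1)]) auto
  have lo: "w\<^sup>2 / \<kappa> / 2 \<le> bregman F \<xi> a"
    using b unfolding w_def by (intro bregman_lower[OF C2 Ob \<xi>(2,1)]) auto
  have lo0: "0 \<le> w\<^sup>2 / \<kappa> / 2" using \<kappa> by simp
  have e: "ecost r (L *v \<xi>) (L *v a) = ennreal (w powr r)"
    by (simp add: ecost_def w_def matrix_vector_mult_diff_distrib)
  have bc: "bcost \<xi> a = ennreal (bregman F \<xi> a powr (r / 2))"
    using \<xi> Ob by (auto simp: bcost_def)
  have "bregman F \<xi> a powr (r / 2) \<le> (\<kappa> / 2 * w\<^sup>2) powr (r / 2)"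
    using up lo lo0 r by (intro powr_mono2) auto
  also have "\<dots> = (\<kappa> / 2) powr (r / 2) * w powr r"
    by (subst powr_mult) (simp_all add: sq_powr_half w_def)
  finally show "bcost \<xi> a \<le> ennreal ((\<kappa> / 2) powr (r / 2)) * ecost r (L *v \<xi>) (L *v a)"
    unfolding e bc by (simp add: ennreal_mult[symmetric])
  have "(1 / (2 * \<kappa>)) powr (r / 2) * w powr r = (1 / (2 * \<kappa>) * w\<^sup>2) powr (r / 2)"
    by (subst powr_mult) (simp_all add: sq_powr_half w_def)
  also have "\<dots> \<le> bregman F \<xi> a powr (r / 2)"
    using lo lo0 r \<kappa> by (intro powr_mono2) auto
  finally show "ennreal ((1 / (2 * \<kappa>)) powr (r / 2)) * ecost r (L *v \<xi>) (L *v a) \<le> bcost \<xi> a"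
    unfolding e bc by (simp add: ennreal_mult[symmetric])
qed

text \<open>On a tame piece the cost is comparable to \<open>|L \<xi> - L a|\<^sup>r\<close>. The map \<open>L\<close> turns the piece into the
  Euclidean problem for \<open>L K\<close>, and centers in \<open>L Ob\<close> come from centers in \<open>Ob\<close>.\<close>

lemma piece_upper:
  assumes \<kappa>: "1 < \<kappa>" and T: "tame \<kappa> V Ob L c E" and V: "V \<subseteq> U"
    and N: "\<And>A f. A \<in> sets borel \<Longrightarrow> A \<inter> N = {} \<Longrightarrow> f \<in> borel_measurable borel
      \<Longrightarrow> (\<integral>\<^sup>+x\<in>A. f x \<partial>P) = (\<integral>\<^sup>+x\<in>A. h x * f x \<partial>lborel)"
    and K: "compact K" "K \<subseteq> E" "K \<inter> N = {}"
    and Ob: "Ob \<noteq> {}"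
  shows "ennreal_powr (rate_sup q (opt_cost bcost V P K)) p \<le> ennreal (\<kappa> powr \<beta> * limit_const) * emeasure limit_measure K"
proof -
  have Tp: "open Ob" "Ob \<subseteq> V" "E \<subseteq> Ob" "E \<in> sets borel" "0 < c" "det L \<noteq> 0" using T by (auto simp: tame_def)
  have Kb [measurable]: "K \<in> sets borel" using K by (simp add: borel_compact)
  have TK: "tame \<kappa> V Ob L c K" using T K(2) Kb by (rule tame_subset)
  have inj: "inj ((*v) L)" using Tp by (simp add: inj_matrix_vector_mult invertible_det_nz)
  define D where "D = \<bar>det L\<bar>"
  have D: "0 < D" using Tp by (simp add: D_def)
  define C1 where "C1 = (\<kappa> / 2) powr (r / 2) * (\<kappa> * c) / D"
  have C1: "0 \<le> C1" using \<kappa> Tp D by (simp add: C1_def)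
  have LK: "compact ((*v) L ` K)" "measure lborel ((*v) L ` K) = D * measure lborel K"
    using measure_linear_image_compact[OF Tp(6) K(1)] by (auto simp: D_def)
  have LKb: "(*v) L ` K \<in> sets borel" using LK by (simp add: borel_compact)
  have opt_cost: "opt_cost bcost V P K n \<le> ennreal C1 * opt_cost (ecost r) ((*v) L ` Ob) lborel ((*v) L ` K) n" for n
  proof -
    have *: "opt_cost bcost V P K n \<le> ennreal C1 * cost_over (ecost r) lborel ((*v) L ` K) \<Gamma>'"
      if \<Gamma>': "\<Gamma>' \<subseteq> (*v) L ` Ob" "finite \<Gamma>'" "\<Gamma>' \<noteq> {}" "card \<Gamma>' \<le> n" for \<Gamma>'
    proof -
      obtain \<Gamma> where \<Gamma>: "\<Gamma> \<subseteq> Ob" "\<Gamma>' = (*v) L ` \<Gamma>" using \<Gamma>'(1) by (metis subset_imageE)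
      have inj': "inj_on ((*v) L) \<Gamma>" using inj by (rule inj_on_subset) simp
      have \<Gamma>fin: "finite \<Gamma>" "\<Gamma> \<noteq> {}" "card \<Gamma> \<le> n"
        using \<Gamma>' \<Gamma> card_image[OF inj'] inj' by (auto dest: finite_imageD)
      have meas [measurable]: "(\<lambda>\<xi>. INF b\<in>\<Gamma>'. ecost r \<xi> b) \<in> borel_measurable borel"
        "(\<lambda>\<xi>. INF b\<in>\<Gamma>'. ecost r (L *v \<xi>) b) \<in> borel_measurable borel"
        using \<Gamma>'(2) by (auto intro!: borel_measurable_INF_finite)
      have "opt_cost bcost V P K n \<le> cost_over bcost P K \<Gamma>"
        using \<Gamma> \<Gamma>fin Tp by (intro opt_cost_le) auto
      also have "\<dots> \<le> (\<integral>\<^sup>+\<xi>\<in>K. ennreal ((\<kappa> / 2) powr (r / 2)) * (INF b\<in>\<Gamma>'. ecost r (L *v \<xi>) b) \<partial>P)"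
      proof (rule nn_set_integral_mono_on)
        fix \<xi> assume "\<xi> \<in> K"
        then have \<xi>: "\<xi> \<in> Ob" using K Tp by auto
        have "(INF a\<in>\<Gamma>. bcost \<xi> a) \<le> (INF a\<in>\<Gamma>. ennreal ((\<kappa> / 2) powr (r / 2)) * ecost r (L *v \<xi>) (L *v a))"
          using \<Gamma> by (intro INF_mono_on tame_cost(1)[OF \<kappa> TK V \<xi>]) blast
        also have "\<dots> = ennreal ((\<kappa> / 2) powr (r / 2)) * (INF b\<in>\<Gamma>'. ecost r (L *v \<xi>) b)"
          using \<kappa> by (subst INF_cmult_ennreal) (auto simp: \<Gamma> image_image)
        finally show "(INF a\<in>\<Gamma>. bcost \<xi> a) \<le> \<dots>" .
      qed
      also have "\<dots> = (\<integral>\<^sup>+\<xi>\<in>K. h \<xi> * (ennreal ((\<kappa> / 2) powr (r / 2)) * (INF b\<in>\<Gamma>'. ecost r (L *v \<xi>) b)) \<partial>lborel)"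
        using K by (intro N) auto
      also have "\<dots> \<le> (\<integral>\<^sup>+\<xi>\<in>K. ennreal (\<kappa> * c) * (ennreal ((\<kappa> / 2) powr (r / 2)) * (INF b\<in>\<Gamma>'. ecost r (L *v \<xi>) b)) \<partial>lborel)"
        using TK by (intro nn_set_integral_mono_on mult_right_mono) (auto simp: tame_def)
      also have "\<dots> = ennreal ((\<kappa> / 2) powr (r / 2) * (\<kappa> * c)) * (\<integral>\<^sup>+\<xi>\<in>K. (INF b\<in>\<Gamma>'. ecost r (L *v \<xi>) b) \<partial>lborel)"
        using \<kappa> Tp by (subst nn_integral_cmult[symmetric]) (auto simp: ennreal_mult mult_ac)
      also have "\<dots> = ennreal C1 * cost_over (ecost r) lborel ((*v) L ` K) \<Gamma>'"
        using D C1 \<kappa> Tp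
        by (subst nn_integral_linear_image[OF Tp(6) LKb])
           (auto simp: D_def[symmetric] C1_def mult.assoc[symmetric] ennreal_mult[symmetric])
      finally show ?thesis .
    qed
    show ?thesis
    proof (cases "C1 = 0")
      case True
      then show ?thesis using \<kappa> Tp D by (simp add: C1_def)
    next
      case False
      then have "0 < C1" using C1 by simp
      then show ?thesis
        unfolding opt_cost_def[of "ecost r"] by (subst INF_cmult_ennreal[symmetric]) (auto intro!: INF_greatest *)
    qed
  qed
  have "rate_sup q (opt_cost bcost V P K) \<le> rate_sup q (\<lambda>n. ennreal C1 * opt_cost (ecost r) ((*v) L ` Ob) lborel ((*v) L ` K) n)"
    using opt_cost by (intro rate_sup_mono) auto
  also have "\<dots> = ennreal C1 * rate_sup q (opt_cost (ecost r) ((*v) L ` Ob) lborel ((*v) L ` K))"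
    by (rule rate_sup_cmult)
  also have "\<dots> \<le> ennreal C1 * ennreal (Q * (D * measure lborel K) powr (1 + q))"
    unfolding LK(2)[symmetric] unfolding q
  proof (intro mult_left_mono rate_sup_compact r Q LK(1))
    show "open ((*v) L ` Ob)"
      using Tp inj by (intro open_surjective_linear_image linear_injective_imp_surjective) auto
  qed (use Ob K Tp in auto)
  also have "\<dots> = ennreal (C1 * Q * (D * measure lborel K) powr (1 + q))"
    using C1 Q by (simp add: ennreal_mult[symmetric] mult.assoc)
  also have "C1 * Q * (D * measure lborel K) powr (1 + q)
     = ((Q * 2 powr - (r / 2) * (\<kappa> powr (2 + r / 2) * (D powr q * c / \<kappa>))) powr p * measure lborel K) powr (1 + q)"
    (is "_ = ?t powr (1 + q)")
  proof -
    have "?t powr (1 + q) = (Q * 2 powr - (r / 2) * (\<kappa> powr (2 + r / 2) * (D powr q * c / \<kappa>))) * measure lborel K powr (1 + q)"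
      using Q \<kappa> Tp by (simp add: powr_mult powr_p_powr(1)[OF q_gt0 p] del: times_divide_eq_right)
    also have "\<dots> = C1 * Q * (D * measure lborel K) powr (1 + q)"
    proof -
      have e1: "\<kappa> powr (2 + r / 2) = \<kappa> * \<kappa> * \<kappa> powr (r / 2)"
        using \<kappa> by (simp add: powr_add power2_eq_square)
      have e2: "(D * measure lborel K) powr (1 + q) = D * D powr q * measure lborel K powr (1 + q)"
        using D by (simp add: powr_add powr_mult)
      have e3: "(\<kappa> / 2) powr (r / 2) = 2 powr - (r / 2) * \<kappa> powr (r / 2)"
        using \<kappa> by (simp add: powr_divide powr_minus_divide)
      have arith: "Q * x * (\<kappa> * \<kappa> * y * (z * c / \<kappa>)) * l = x * y * (\<kappa> * c) / D * Q * (D * z * l)" for x y z l :: real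
        using D \<kappa> by (simp add: field_simps)
      show ?thesis unfolding C1_def e1 e2 e3 by (rule arith)
    qed
    finally show ?thesis by simp
  qed
  finally have "ennreal_powr (rate_sup q (opt_cost bcost V P K)) p \<le> ennreal ?t"
    by (intro ennreal_powr_p_le[OF q_gt0 p]) auto
  also have "?t = \<kappa> powr \<beta> * limit_const * ((D powr q * c / \<kappa>) powr p * measure lborel K)"
    using Q \<kappa> Tp D by (simp add: powr_mult powr_powr \<beta>_def limit_const_def del: times_divide_eq_right)
  also have "ennreal \<dots> = ennreal (\<kappa> powr \<beta> * limit_const) * (ennreal ((D powr q * c / \<kappa>) powr p) * emeasure lborel K)"
    using emeasure_compact_finite[OF K(1)]
    by (simp add: ennreal_mult limit_const_def emeasure_eq_ennreal_measure mult.assoc)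
  also have "\<dots> \<le> ennreal (\<kappa> powr \<beta> * limit_const) * emeasure limit_measure K"
    using tame_limit_measure(1)[OF \<kappa> TK V] by (intro mult_left_mono) (auto simp: D_def)
  finally show ?thesis .
qed

text \<open>Centers outside \<open>W\<close> may be exchanged for the points of \<open>H\<close>, as in \<open>bregman_localization\<close>.\<close>

lemma INF_bcost_replace_centers:
  assumes "\<xi> \<in> U" "\<Gamma> \<subseteq> U" "H \<subseteq> U" "a \<in> \<Gamma>"
    and rep: "\<And>a. a \<in> U - W \<Longrightarrow> \<exists>g\<in>H. bregman F \<xi> g \<le> bregman F \<xi> a"
  shows "(INF b\<in>(\<Gamma> \<inter> W) \<union> H. bcost \<xi> b) \<le> bcost \<xi> a"
proof (cases "a \<in> W")
  case True
  then show ?thesis using assms(4) by (intro INF_lower) auto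
next
  case False
  then obtain g where g: "g \<in> H" "bregman F \<xi> g \<le> bregman F \<xi> a" using rep[of a] assms(2,4) by blast
  have gU: "g \<in> U" using g(1) assms(3) by blast
  have "(INF b\<in>(\<Gamma> \<inter> W) \<union> H. bcost \<xi> b) \<le> bcost \<xi> g" using g by (intro INF_lower) auto
  also have "\<dots> \<le> bcost \<xi> a"
    unfolding bcost_def using g(2) r bregman_nonneg[OF C2 U(3) gU assms(1) pd]
    by (intro mult_right_mono ennreal_leI powr_mono2) auto
  finally show ?thesis .
qed

text \<open>The comparison with the Euclidean cost only holds for centers in \<open>Ob\<close>. All others are replaced by a finite
  net \<open>G0\<close> whose size does not depend on \<open>n\<close>.\<close>

lemma piece_lower:
  assumes \<kappa>: "1 < \<kappa>" and T: "tame \<kappa> U Ob L c E" and K: "compact K" "K \<subseteq> E" "K \<noteq> {}"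
  shows "ennreal (\<kappa> powr - \<beta> * limit_const) * emeasure limit_measure K \<le> ennreal_powr (rate_inf q (opt_cost bcost U P K)) p"
proof -
  have Tp: "open Ob" "Ob \<subseteq> U" "E \<subseteq> Ob" "E \<in> sets borel" "0 < c" "det L \<noteq> 0" using T by (auto simp: tame_def)
  have Kb [measurable]: "K \<in> sets borel" using K by (simp add: borel_compact)
  have TK: "tame \<kappa> U Ob L c K" using T K(2) Kb by (rule tame_subset)
  have inj: "inj ((*v) L)" using Tp by (simp add: inj_matrix_vector_mult invertible_det_nz)
  define D where "D = \<bar>det L\<bar>"
  have D: "0 < D" using Tp by (simp add: D_def)
  define C1 where "C1 = (1 / (2 * \<kappa>)) powr (r / 2) * c / D"
  have C1: "0 \<le> C1" using \<kappa> Tp D by (simp add: C1_def)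
  have LK: "compact ((*v) L ` K)" "measure lborel ((*v) L ` K) = D * measure lborel K"
    using measure_linear_image_compact[OF Tp(6) K(1)] by (auto simp: D_def)
  have LKb: "(*v) L ` K \<in> sets borel" using LK by (simp add: borel_compact)
  obtain N where N: "\<And>A f. A \<in> sets borel \<Longrightarrow> f \<in> borel_measurable borel
      \<Longrightarrow> (\<integral>\<^sup>+x\<in>A. h x * f x \<partial>lborel) \<le> (\<integral>\<^sup>+x\<in>A. f x \<partial>P)"
    by (rule singular_set) blast
  obtain G0 where G0: "finite G0" "G0 \<subseteq> K"
    "\<And>\<xi> a. \<xi> \<in> K \<Longrightarrow> a \<in> U - Ob \<Longrightarrow> \<exists>g\<in>G0. bregman F \<xi> g \<le> bregman F \<xi> a"
    using bregman_localization[OF C2 U(3) pd K(1) order_trans[OF K(2) Tp(3)] Tp(1,2)] by blast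
  have opt_cost: "ennreal C1 * opt_cost (ecost r) UNIV lborel ((*v) L ` K) (n + card G0) \<le> opt_cost bcost U P K n" for n
  proof (rule opt_cost_geI)
    fix \<Gamma> assume \<Gamma>: "\<Gamma> \<subseteq> U" "finite \<Gamma>" "\<Gamma> \<noteq> {}" "card \<Gamma> \<le> n"
    define \<Delta> where "\<Delta> = (\<Gamma> \<inter> Ob) \<union> G0"
    have \<Delta>: "finite \<Delta>" "\<Delta> \<subseteq> Ob" using \<Gamma> G0 K Tp by (auto simp: \<Delta>_def)
    have dom: "(INF a\<in>\<Delta>. bcost \<xi> a) \<le> bcost \<xi> a" if \<xi>: "\<xi> \<in> K" and a: "a \<in> \<Gamma>" for \<xi> a
    proof -
      have "\<xi> \<in> U" "G0 \<subseteq> U" using \<xi> G0(2) K(2) Tp(2,3) by blast+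
      then show ?thesis unfolding \<Delta>_def using \<Gamma>(1) a G0(3)[OF \<xi>] by (intro INF_bcost_replace_centers)
    qed
    have "\<Delta> \<noteq> {}"
    proof
      assume "\<Delta> = {}"
      obtain \<xi> a where "\<xi> \<in> K" "a \<in> \<Gamma>" using K \<Gamma> by auto
      then show False using \<open>\<Delta> = {}\<close> G0(3)[of \<xi> a] \<Gamma> by (auto simp: \<Delta>_def)
    qed
    have card: "card ((*v) L ` \<Delta>) \<le> n + card G0"
    proof -
      have "card ((*v) L ` \<Delta>) \<le> card \<Delta>" using \<Delta> by (intro card_image_le)
      also have "\<dots> \<le> card (\<Gamma> \<inter> Ob) + card G0" unfolding \<Delta>_def by (rule card_Un_le)
      also have "card (\<Gamma> \<inter> Ob) \<le> card \<Gamma>" using \<Gamma> by (intro card_mono) auto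
      finally show ?thesis using \<Gamma> by simp
    qed
    have meas [measurable]: "(\<lambda>\<xi>. INF b\<in>(*v) L ` \<Delta>. ecost r \<xi> b) \<in> borel_measurable borel"
        "(\<lambda>\<xi>. INF b\<in>(*v) L ` \<Delta>. ecost r (L *v \<xi>) b) \<in> borel_measurable borel"
        "(\<lambda>\<xi>. INF a\<in>\<Gamma>. bcost \<xi> a) \<in> borel_measurable borel"
      using \<Delta>(1) \<Gamma>(2) by (auto intro!: borel_measurable_INF_finite)
    have "ennreal C1 * opt_cost (ecost r) UNIV lborel ((*v) L ` K) (n + card G0)
        \<le> ennreal C1 * cost_over (ecost r) lborel ((*v) L ` K) ((*v) L ` \<Delta>)"
      using \<Delta> \<open>\<Delta> \<noteq> {}\<close> card by (intro mult_left_mono opt_cost_le) auto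
    also have "\<dots> = ennreal ((1 / (2 * \<kappa>)) powr (r / 2) * c) * (\<integral>\<^sup>+\<xi>\<in>K. (INF b\<in>(*v) L ` \<Delta>. ecost r (L *v \<xi>) b) \<partial>lborel)"
      using D C1 \<kappa> Tp
      by (subst nn_integral_linear_image[OF Tp(6) LKb])
         (auto simp: D_def[symmetric] C1_def mult.assoc[symmetric] ennreal_mult[symmetric])
    also have "\<dots> = (\<integral>\<^sup>+\<xi>\<in>K. ennreal c * (ennreal ((1 / (2 * \<kappa>)) powr (r / 2)) * (INF b\<in>(*v) L ` \<Delta>. ecost r (L *v \<xi>) b)) \<partial>lborel)"
      using \<kappa> Tp by (subst nn_integral_cmult[symmetric]) (auto simp: ennreal_mult mult_ac)
    also have "\<dots> \<le> (\<integral>\<^sup>+\<xi>\<in>K. h \<xi> * (INF a\<in>\<Gamma>. bcost \<xi> a) \<partial>lborel)"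
    proof (intro nn_set_integral_mono_on mult_mono)
      fix \<xi> assume \<xi>: "\<xi> \<in> K"
      then have \<xi>O: "\<xi> \<in> Ob" using K Tp by auto
      show "ennreal c \<le> h \<xi>" using TK \<xi> by (auto simp: tame_def)
      have "ennreal ((1 / (2 * \<kappa>)) powr (r / 2)) * (INF b\<in>(*v) L ` \<Delta>. ecost r (L *v \<xi>) b)
          = (INF a\<in>\<Delta>. ennreal ((1 / (2 * \<kappa>)) powr (r / 2)) * ecost r (L *v \<xi>) (L *v a))"
        using \<kappa> by (subst INF_cmult_ennreal) (auto simp: image_image)
      also have "\<dots> \<le> (INF a\<in>\<Delta>. bcost \<xi> a)"
        using \<Delta> by (intro INF_mono_on tame_cost(2)[OF \<kappa> TK order_refl \<xi>O]) blast
      also have "\<dots> \<le> (INF a\<in>\<Gamma>. bcost \<xi> a)" using dom[OF \<xi>] by (intro INF_greatest)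
      finally show "ennreal ((1 / (2 * \<kappa>)) powr (r / 2)) * (INF b\<in>(*v) L ` \<Delta>. ecost r (L *v \<xi>) b) \<le> (INF a\<in>\<Gamma>. bcost \<xi> a)" .
    qed auto
    also have "\<dots> \<le> cost_over bcost P K \<Gamma>" by (intro N) auto
    finally show "ennreal C1 * opt_cost (ecost r) UNIV lborel ((*v) L ` K) (n + card G0) \<le> cost_over bcost P K \<Gamma>" .
  qed
  have "ennreal_powr (rate_inf q (\<lambda>n. ennreal C1 * opt_cost (ecost r) UNIV lborel ((*v) L ` K) n)) p + ennreal_powr (rate_inf q (\<lambda>_. 0)) p
     \<le> ennreal_powr (rate_inf q (opt_cost bcost U P K)) p"
  proof (rule rate_inf_superadd[OF q_gt0 p, where K = "card G0"])
    show "antimono (\<lambda>n. ennreal C1 * opt_cost (ecost r) UNIV lborel ((*v) L ` K) n)"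
      using opt_cost_antimono[of "ecost r" UNIV lborel "(*v) L ` K"] by (auto simp: antimono_def intro: mult_left_mono)
    fix n :: nat and y :: ennreal
    assume "\<And>i j. i + j \<le> n + card G0 \<Longrightarrow> y \<le> ennreal C1 * opt_cost (ecost r) UNIV lborel ((*v) L ` K) i + 0"
    from this[of "n + card G0" 0] opt_cost[of n] show "y \<le> opt_cost bcost U P K n" by simp
  qed (auto simp: antimono_def)
  then have low: "ennreal_powr (rate_inf q (\<lambda>n. ennreal C1 * opt_cost (ecost r) UNIV lborel ((*v) L ` K) n)) p
     \<le> ennreal_powr (rate_inf q (opt_cost bcost U P K)) p"
    by (rule order_trans[rotated]) (simp add: add_increasing2)
  have "ennreal (\<kappa> powr - \<beta> * limit_const) * emeasure limit_measure K
     \<le> ennreal (\<kappa> powr - \<beta> * limit_const) * (ennreal ((\<kappa>\<^sup>2 * (D powr q * c)) powr p) * emeasure lborel K)"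
    using tame_limit_measure(2)[OF \<kappa> TK order_refl] by (intro mult_left_mono) (auto simp: D_def)
  also have "\<dots> = ennreal (\<kappa> powr - \<beta> * limit_const * ((\<kappa>\<^sup>2 * (D powr q * c)) powr p * measure lborel K))"
    using emeasure_compact_finite[OF K(1)]
    by (simp add: ennreal_mult limit_const_def emeasure_eq_ennreal_measure mult.assoc)
  also have "\<kappa> powr - \<beta> * limit_const * ((\<kappa>\<^sup>2 * (D powr q * c)) powr p * measure lborel K)
     = C1 powr p * (Q powr p * (D * measure lborel K))"
  proof -
    have "C1 = 2 powr - (r / 2) * \<kappa> powr - (r / 2) * c / D"
      using \<kappa> by (simp add: C1_def powr_divide powr_mult powr_minus_divide)
    then have "C1 powr p * D = (2 powr - (r / 2) * \<kappa> powr - (r / 2) * c / D) powr p * (D powr (1 + q)) powr p"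
      using D by (simp add: powr_p_powr(2)[OF q_gt0 p])
    also have "\<dots> = (2 powr - (r / 2) * \<kappa> powr - (r / 2) * c / D * D powr (1 + q)) powr p"
      using D \<kappa> Tp by (subst powr_mult) auto
    also have "2 powr - (r / 2) * \<kappa> powr - (r / 2) * c / D * D powr (1 + q) = 2 powr - (r / 2) * (\<kappa> powr - (r / 2) * (D powr q * c))"
      using D by (simp add: powr_add)
    finally have 1: "C1 powr p * D = (2 powr - (r / 2)) powr p * (\<kappa> powr (- (r / 2) * p) * (D powr q * c) powr p)"
      using D \<kappa> Tp by (simp add: powr_mult powr_powr)
    have "\<kappa>\<^sup>2 = \<kappa> powr 2" using \<kappa> by simp
    then have k: "\<kappa> powr - \<beta> * (\<kappa>\<^sup>2) powr p = \<kappa> powr (- (r / 2) * p)"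
      using \<kappa> by (simp only: powr_powr powr_add[symmetric]) (simp add: \<beta>_def algebra_simps)
    have X: "(\<kappa>\<^sup>2 * (D powr q * c)) powr p = (\<kappa>\<^sup>2) powr p * (D powr q * c) powr p"
      using D Tp by (intro powr_mult)
    have B: "limit_const = Q powr p * (2 powr - (r / 2)) powr p" unfolding limit_const_def using Q by (intro powr_mult)
    have "\<kappa> powr - \<beta> * limit_const * ((\<kappa>\<^sup>2 * (D powr q * c)) powr p * measure lborel K)
      = (\<kappa> powr - \<beta> * (\<kappa>\<^sup>2) powr p) * (2 powr - (r / 2)) powr p * (D powr q * c) powr p * (Q powr p * measure lborel K)"
      unfolding X B by (simp only: mult_ac)
    also have "\<dots> = (C1 powr p * D) * (Q powr p * measure lborel K)"
      unfolding k 1 by (simp only: mult_ac)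
    finally show ?thesis by (simp only: mult_ac)
  qed
  also have "ennreal \<dots> = ennreal (C1 powr p) * ennreal (Q powr p * measure lborel ((*v) L ` K))"
    unfolding LK(2) by (rule ennreal_mult') simp
  also have "\<dots> \<le> ennreal (C1 powr p) * ennreal_powr (rate_inf q (opt_cost (ecost r) UNIV lborel ((*v) L ` K))) p"
    using LK LKb by (intro mult_left_mono rate_inf_bounded[OF r q p Q] compact_imp_bounded) auto
  also have "\<dots> = ennreal_powr (rate_inf q (\<lambda>n. ennreal C1 * opt_cost (ecost r) UNIV lborel ((*v) L ` K) n)) p"
    using C1 p_gt0 by (simp add: rate_inf_cmult ennreal_powr_mult)
  finally show ?thesis using low by (rule order_trans)
qed

section \<open>Independence and exhaustion\<close>

definition lower_rate :: "(real^'n) set \<Rightarrow> ennreal" where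
  "lower_rate A = ennreal_powr (rate_inf q (opt_cost bcost U P A)) p"

lemma lower_rate_mono: "A \<subseteq> B \<Longrightarrow> lower_rate A \<le> lower_rate B"
  unfolding lower_rate_def using p_gt0 by (intro ennreal_powr_mono rate_inf_mono opt_cost_mono_set) auto

lemma lower_rate_empty: "lower_rate {} = 0"
proof -
  obtain x where "x \<in> U" using U by auto
  have "rate_inf q (opt_cost bcost U P {}) \<le> rate_sup q (opt_cost bcost U P {})" by (rule rate_inf_le_rate_sup)
  also have "\<dots> \<le> ennreal 0"
  proof (rule rate_sup_leI)
    show "\<forall>\<^sub>F n in sequentially. opt_cost bcost U P {} n \<le> ennreal (0 * real n powr - q)"
      using eventually_ge_at_top[of 1]
    proof eventually_elim
      case (elim n)
      have "opt_cost bcost U P {} n \<le> cost_over bcost P {} {x}"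
        using elim \<open>x \<in> U\<close> by (intro opt_cost_le) auto
      then show ?case by simp
    qed
  qed simp
  finally show ?thesis by (simp add: lower_rate_def)
qed

text \<open>Separate the two sets by open sets \<open>W1\<close> and \<open>W2\<close>. Replacing centers outside \<open>W1\<close> by a finite net, the
  part \<open>A\<close> only uses centers in \<open>W1\<close>, and similarly for \<open>B\<close>; no center is used twice.\<close>

lemma lower_rate_superadd:
  assumes A: "compact A" "A \<subseteq> U" "A \<noteq> {}" and B: "compact B" "B \<subseteq> U" "B \<noteq> {}" and AB: "A \<inter> B = {}"
  shows "lower_rate A + lower_rate B \<le> lower_rate (A \<union> B)"
proof -
  obtain W1' W2' where W': "open W1'" "open W2'" "A \<subseteq> W1'" "B \<subseteq> W2'" "W1' \<inter> W2' = {}"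
    using separation_normal[of A B] A B AB compact_imp_closed by metis
  define W1 where "W1 = W1' \<inter> U"
  define W2 where "W2 = W2' \<inter> U"
  have W: "open W1" "open W2" "A \<subseteq> W1" "B \<subseteq> W2" "W1 \<inter> W2 = {}" "W1 \<subseteq> U" "W2 \<subseteq> U"
    using W' A B U by (auto simp: W1_def W2_def)
  obtain G1 where G1: "finite G1" "G1 \<subseteq> A"
    "\<And>\<xi> a. \<xi> \<in> A \<Longrightarrow> a \<in> U - W1 \<Longrightarrow> \<exists>g\<in>G1. bregman F \<xi> g \<le> bregman F \<xi> a"
    using bregman_localization[OF C2 U(3) pd A(1) W(3,1,6)] by blast
  obtain G2 where G2: "finite G2" "G2 \<subseteq> B"
    "\<And>\<xi> a. \<xi> \<in> B \<Longrightarrow> a \<in> U - W2 \<Longrightarrow> \<exists>g\<in>G2. bregman F \<xi> g \<le> bregman F \<xi> a"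
    using bregman_localization[OF C2 U(3) pd B(1) W(4,2,7)] by blast
  note [measurable_cong] = P(2)
  have part: "opt_cost bcost U P X (card ((\<Gamma> \<inter> W) \<union> H)) \<le> cost_over bcost P X \<Gamma>"
    if X: "X \<subseteq> U" "X \<noteq> {}" and H: "finite H" "H \<subseteq> X" "\<And>\<xi> a. \<xi> \<in> X \<Longrightarrow> a \<in> U - W \<Longrightarrow> \<exists>g\<in>H. bregman F \<xi> g \<le> bregman F \<xi> a"
    and \<Gamma>: "finite \<Gamma>" "\<Gamma> \<noteq> {}" "\<Gamma> \<subseteq> U" for X W H \<Gamma>
  proof -
    have ne: "(\<Gamma> \<inter> W) \<union> H \<noteq> {}"
    proof
      assume e: "(\<Gamma> \<inter> W) \<union> H = {}"
      obtain \<xi> a where "\<xi> \<in> X" "a \<in> \<Gamma>" using X \<Gamma> by auto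
      then show False using e H(3)[of \<xi> a] \<Gamma> by auto
    qed
    have "opt_cost bcost U P X (card ((\<Gamma> \<inter> W) \<union> H)) \<le> cost_over bcost P X ((\<Gamma> \<inter> W) \<union> H)"
      using X H \<Gamma> ne by (intro opt_cost_le) auto
    also have "\<dots> \<le> cost_over bcost P X \<Gamma>"
    proof (intro nn_set_integral_mono_on INF_greatest)
      fix \<xi> a assume \<xi>: "\<xi> \<in> X" and a: "a \<in> \<Gamma>"
      have "\<xi> \<in> U" "H \<subseteq> U" using \<xi> H(2) X(1) by blast+
      then show "(INF a\<in>(\<Gamma> \<inter> W) \<union> H. bcost \<xi> a) \<le> bcost \<xi> a"
        using \<Gamma>(3) a H(3)[OF \<xi>] by (intro INF_bcost_replace_centers)
    qed
    finally show ?thesis .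
  qed
  show ?thesis unfolding lower_rate_def
  proof (rule rate_inf_superadd[OF q_gt0 p opt_cost_antimono opt_cost_antimono, where K = "card G1 + card G2"])
    fix n :: nat and y :: ennreal
    assume y: "\<And>i j. i + j \<le> n + (card G1 + card G2) \<Longrightarrow> y \<le> opt_cost bcost U P A i + opt_cost bcost U P B j"
    show "y \<le> opt_cost bcost U P (A \<union> B) n"
    proof (rule opt_cost_geI)
      fix \<Gamma> assume \<Gamma>: "\<Gamma> \<subseteq> U" "finite \<Gamma>" "\<Gamma> \<noteq> {}" "card \<Gamma> \<le> n"
      have "card (\<Gamma> \<inter> W1) + card (\<Gamma> \<inter> W2) = card ((\<Gamma> \<inter> W1) \<union> (\<Gamma> \<inter> W2))"
        using \<Gamma> W by (intro card_Un_disjoint[symmetric]) auto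
      also have "\<dots> \<le> card \<Gamma>" using \<Gamma> by (intro card_mono) auto
      finally have c: "card (\<Gamma> \<inter> W1) + card (\<Gamma> \<inter> W2) \<le> n" using \<Gamma> by simp
      have "card ((\<Gamma> \<inter> W1) \<union> G1) + card ((\<Gamma> \<inter> W2) \<union> G2) \<le> n + (card G1 + card G2)"
        using c card_Un_le[of "\<Gamma> \<inter> W1" G1] card_Un_le[of "\<Gamma> \<inter> W2" G2] by linarith
      then have "y \<le> opt_cost bcost U P A (card ((\<Gamma> \<inter> W1) \<union> G1)) + opt_cost bcost U P B (card ((\<Gamma> \<inter> W2) \<union> G2))"
        by (rule y)
      also have "\<dots> \<le> cost_over bcost P A \<Gamma> + cost_over bcost P B \<Gamma>"
        by (rule add_mono[OF part[OF A(2,3) G1 \<Gamma>(2,3,1)] part[OF B(2,3) G2 \<Gamma>(2,3,1)]])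
      also have "\<dots> = cost_over bcost P (A \<union> B) \<Gamma>"
        using \<Gamma> A B AB
        by (intro nn_integral_disjoint_pair[symmetric])
           (auto intro!: borel_measurable_INF_finite simp: P borel_compact)
      finally show "y \<le> cost_over bcost P (A \<union> B) \<Gamma>" .
    qed
  qed
qed

lemma lower_rate_finite_union:
  assumes "\<And>i. i < N \<Longrightarrow> compact (K i) \<and> K i \<subseteq> U" "disjoint_family_on K {..<N}"
  shows "(\<Sum>i<N::nat. lower_rate (K i)) \<le> lower_rate (\<Union>i<N. K i)"
  using assms
proof (induction N)
  case (Suc N)
  let ?A = "\<Union>i<N. K i"
  have Ki: "compact (K i)" "K i \<subseteq> U" if "i < N" for i using Suc.prems(1)[of i] that by simp_all
  have A: "compact ?A" using Ki by (intro compact_UN) auto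
  have AU: "?A \<subseteq> U" using Ki by (intro UN_least) simp
  have "K i \<inter> K N = {}" if "i < N" for i
    using that by (intro disjoint_family_onD[OF Suc.prems(2)]) auto
  then have dis: "?A \<inter> K N = {}" by blast
  have IH: "(\<Sum>i<N. lower_rate (K i)) \<le> lower_rate ?A"
    using Suc.prems by (intro Suc.IH) (auto simp: disjoint_family_on_def)
  have "lower_rate ?A + lower_rate (K N) \<le> lower_rate (?A \<union> K N)"
  proof (cases "?A = {} \<or> K N = {}")
    case True then show ?thesis by (elim disjE) (simp_all only: lower_rate_empty Un_empty_left Un_empty_right add_0 add_0_right order_refl)
  next
    case False
    then show ?thesis using A AU Suc.prems(1)[of N] dis by (intro lower_rate_superadd) auto
  qed
  then show ?case using IH by (simp add: lessThan_Suc Un_commute add.commute) (meson add_left_mono order_trans)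
qed (simp add: lower_rate_empty)

text \<open>By continuity of the Hessian every point has a ball on which the condition on \<open>L\<close> holds, where \<open>L\<close> is a
  square root of the Hessian at the center. Countably many of these balls suffice; they are intersected with
  the level sets of \<open>h\<close> between consecutive powers of \<open>\<kappa>\<close> and made disjoint.\<close>

lemma tame_cover:
  assumes \<kappa>: "1 < \<kappa>" and V: "open V" "V \<subseteq> U" "V \<noteq> {}"
  shows "\<exists>E :: nat \<Rightarrow> (real^'n) set.
    disjoint_family E \<and> (\<Union>i. E i) = V \<inter> {x. 0 < h x \<and> h x < top} \<and>
    (\<forall>i. \<exists>Ob L c. tame \<kappa> V Ob L c (E i) \<and> Ob \<noteq> {})"
proof -
  define good where "good Ob L \<longleftrightarrow> open Ob \<and> convex Ob \<and> bounded Ob \<and> Ob \<subseteq> V \<and> Ob \<noteq> {} \<and> det L \<noteq> 0 \<and>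
     (\<forall>x\<in>Ob. \<forall>v. (norm (L *v v))\<^sup>2 / \<kappa> \<le> v \<bullet> (hessian F x *v v) \<and> v \<bullet> (hessian F x *v v) \<le> \<kappa> * (norm (L *v v))\<^sup>2) \<and>
     (\<forall>x\<in>Ob. \<bar>det L\<bar> powr q / \<kappa> \<le> hess_weight x \<and>
        hess_weight x \<le> \<kappa> * \<bar>det L\<bar> powr q)" for Ob :: "(real^'n) set" and L :: "real^'n^'n"
  have local: "\<exists>\<tau>>0. \<exists>L. good (ball x \<tau>) L" if x: "x \<in> V" for x
  proof -
    have xU: "x \<in> U" using x V by auto
    obtain L where L: "det L \<noteq> 0" "(det L)\<^sup>2 = det (hessian F x)" "\<And>v. v \<bullet> (hessian F x *v v) = (norm (L *v v))\<^sup>2"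
      using pos_def_square_root[OF pd[OF xU]] by blast
    obtain m where m: "0 < m" "\<And>v. m * (norm v)\<^sup>2 \<le> v \<bullet> (hessian F x *v v)"
    proof -
      obtain m M where "0 < m" "m \<le> M" "\<And>y v. y \<in> {x} \<Longrightarrow> m * (norm v)\<^sup>2 \<le> v \<bullet> (hessian F y *v v)
          \<and> v \<bullet> (hessian F y *v v) \<le> M * (norm v)\<^sup>2"
        by (rule quadratic_form_bounds[of "{x}" "hessian F"]) (use pd[OF xU] in auto)
      then show ?thesis by (intro that[of m]) auto
    qed
    define d where "d = (real CARD('n))\<^sup>2"
    have d: "0 < d" by (simp add: d_def)
    \<comment> \<open>A relative change of the form by \<open>\<theta>\<close> is harmless in both directions: \<open>1 - \<theta> = 1 / \<kappa>\<close>, \<open>1 + \<theta> \<le> \<kappa>\<close>.\<close>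
    define \<theta> where "\<theta> = 1 - 1 / \<kappa>"
    have \<theta>: "0 < \<theta>" "1 - \<theta> = 1 / \<kappa>" "1 + \<theta> \<le> \<kappa>"
    proof -
      have "0 \<le> (\<kappa> - 1)\<^sup>2 / \<kappa>" using \<kappa> by simp
      also have "(\<kappa> - 1)\<^sup>2 / \<kappa> = \<kappa> - (1 + \<theta>)" using \<kappa> by (simp add: \<theta>_def field_simps power2_eq_square)
      finally show "1 + \<theta> \<le> \<kappa>" by simp
    qed (use \<kappa> in \<open>auto simp: \<theta>_def\<close>)
    have det: "\<bar>det L\<bar> powr q = hess_weight x"
    proof -
      have "hess_weight x = (\<bar>det L\<bar>\<^sup>2) powr (q / 2)"
        using L(2) by (simp add: q mult.commute)
      also have "\<dots> = \<bar>det L\<bar> powr q" by (rule sq_powr_half) simp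
      finally show ?thesis by simp
    qed
    have det0: "0 < \<bar>det L\<bar> powr q" using L by simp
    have cont: "isCont (hessian F) x" using C2 xU U(2) by (auto simp: C2_on_def continuous_on_eq_continuous_at)
    have contd: "isCont (\<lambda>x. hess_weight x) x"
    proof -
      have "isCont (\<lambda>x. det (hessian F x)) x"
        using continuous_on_det_hessian xU U(2) by (auto simp: continuous_on_eq_continuous_at)
      then show ?thesis
        unfolding isCont_def using det_hessian_pos[OF xU] by (intro tendsto_powr tendsto_const) auto
    qed
    have contd': "((\<lambda>x. hess_weight x) \<longlongrightarrow> \<bar>det L\<bar> powr q) (nhds x)"
      using contd unfolding isCont_def det
      by (simp only: tendsto_at_iff_tendsto_nhds[where g = "\<lambda>x. hess_weight x"])
    have "\<forall>\<^sub>F y in nhds x. y \<in> V" using V(1) x by (rule eventually_nhds_in_open)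
    moreover have "\<forall>\<^sub>F y in nhds x. dist (hessian F y) (hessian F x) < \<theta> * m / d"
      using cont \<theta> m d unfolding isCont_def tendsto_at_iff_tendsto_nhds[where g = "hessian F"]
      by (auto elim!: tendstoD)
    moreover have "\<forall>\<^sub>F y in nhds x. \<bar>det L\<bar> powr q / \<kappa> < hess_weight y"
      by (rule order_tendstoD(1)[OF contd']) (use det0 \<kappa> in \<open>simp add: divide_less_eq\<close>)
    moreover have "\<forall>\<^sub>F y in nhds x. hess_weight y < \<kappa> * \<bar>det L\<bar> powr q"
      by (rule order_tendstoD(2)[OF contd']) (use det0 \<kappa> in simp)
    ultimately have "\<forall>\<^sub>F y in nhds x. y \<in> V \<and> dist (hessian F y) (hessian F x) < \<theta> * m / d
       \<and> \<bar>det L\<bar> powr q / \<kappa> < hess_weight y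
       \<and> hess_weight y < \<kappa> * \<bar>det L\<bar> powr q"
      by eventually_elim auto
    then obtain \<tau> where \<tau>: "0 < \<tau>" "\<And>y. dist y x < \<tau> \<Longrightarrow> y \<in> V \<and> dist (hessian F y) (hessian F x) < \<theta> * m / d
       \<and> \<bar>det L\<bar> powr q / \<kappa> < hess_weight y
       \<and> hess_weight y < \<kappa> * \<bar>det L\<bar> powr q"
      unfolding eventually_nhds_metric by blast
    have quad: "(norm (L *v v))\<^sup>2 / \<kappa> \<le> v \<bullet> (hessian F y *v v) \<and> v \<bullet> (hessian F y *v v) \<le> \<kappa> * (norm (L *v v))\<^sup>2"
      if y: "dist y x < \<tau>" for y v
    proof -
      let ?A = "hessian F y - hessian F x"
      have "\<bar>v \<bullet> (?A *v v)\<bar> \<le> d * norm ?A * (norm v)\<^sup>2" unfolding d_def by (rule quadratic_form_le_norm)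
      also have "\<dots> \<le> \<theta> * m * (norm v)\<^sup>2"
      proof (rule mult_right_mono)
        have "norm ?A \<le> \<theta> * m / d" using \<tau>(2)[OF y] by (simp add: dist_norm)
        then show "d * norm ?A \<le> \<theta> * m" using d by (simp add: field_simps)
      qed simp
      also have "\<dots> \<le> \<theta> * (norm (L *v v))\<^sup>2"
        using m(2)[of v] \<theta>(1) unfolding L(3) by (simp add: mult.assoc)
      finally have "\<bar>v \<bullet> (hessian F y *v v) - (norm (L *v v))\<^sup>2\<bar> \<le> \<theta> * (norm (L *v v))\<^sup>2"
        by (simp add: L(3)[symmetric] matrix_vector_mult_diff_rdistrib inner_diff_right)
      then have "(1 - \<theta>) * (norm (L *v v))\<^sup>2 \<le> v \<bullet> (hessian F y *v v)"
        "v \<bullet> (hessian F y *v v) \<le> (1 + \<theta>) * (norm (L *v v))\<^sup>2"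
        by (auto simp: algebra_simps abs_le_iff)
      moreover have "(1 + \<theta>) * (norm (L *v v))\<^sup>2 \<le> \<kappa> * (norm (L *v v))\<^sup>2"
        using \<theta>(3) by (intro mult_right_mono) auto
      ultimately show ?thesis unfolding \<theta>(2) by simp
    qed
    have "good (ball x \<tau>) L"
      unfolding good_def using \<tau> L quad by (auto simp: dist_commute less_imp_le)
    then show ?thesis using \<tau>(1) by blast
  qed
  define \<F> where "\<F> = {Ob. \<exists>L. good Ob L}"
  have \<F>open: "\<And>S. S \<in> \<F> \<Longrightarrow> open S" by (auto simp: \<F>_def good_def)
  have \<F>V: "\<Union>\<F> = V"
  proof
    show "\<Union>\<F> \<subseteq> V" by (auto simp: \<F>_def good_def)
    show "V \<subseteq> \<Union>\<F>"
    proof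
      fix x assume "x \<in> V"
      then obtain \<tau> L where "0 < \<tau>" "good (ball x \<tau>) L" using local by blast
      then show "x \<in> \<Union>\<F>" unfolding \<F>_def by (intro UnionI[of "ball x \<tau>"]) auto
    qed
  qed
  obtain \<C> where \<C>: "\<C> \<subseteq> \<F>" "countable \<C>" "\<Union>\<C> = \<Union>\<F>"
    using Lindelof[of \<F>] \<F>open by metis
  define lev where "lev j = {x. ennreal (\<kappa> powr real_of_int j) \<le> h x \<and> h x \<le> ennreal (\<kappa> * \<kappa> powr real_of_int j)}" for j :: int
  have lev: "\<exists>j. x \<in> lev j" if x: "0 < h x" "h x < top" for x
  proof -
    obtain y where y: "h x = ennreal y" "0 < y" using x by (cases "h x" rule: ennreal_cases) auto
    define j where "j = \<lfloor>log \<kappa> y\<rfloor>"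
    have "\<kappa> powr real_of_int j \<le> \<kappa> powr log \<kappa> y" using \<kappa> by (intro powr_mono) (auto simp: j_def)
    moreover have "\<kappa> powr log \<kappa> y \<le> \<kappa> powr (1 + real_of_int j)"
      using \<kappa> real_of_int_floor_add_one_ge[of "log \<kappa> y"] by (intro powr_mono) (auto simp: j_def add.commute)
    ultimately have "x \<in> lev j" using y \<kappa> by (auto simp: lev_def powr_add intro!: ennreal_leI)
    then show ?thesis ..
  qed
  have lev': "x \<in> lev j \<Longrightarrow> 0 < h x \<and> h x < top" for x j
    using \<kappa> by (auto simp: lev_def less_top[symmetric] top_unique dest: order.strict_trans2[rotated])
  have lev_sets: "lev j \<in> sets borel" for j unfolding lev_def by measurable
  define I where "I = \<C> \<times> (UNIV :: int set)"
  have I: "countable I" "I \<noteq> {}" using \<C> \<F>V V(3) by (auto simp: I_def)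
  define S where "S i = (case from_nat_into I i of (Ob, j) \<Rightarrow> Ob \<inter> lev j)" for i
  have SI: "range (from_nat_into I) = I" using I by (intro range_from_nat_into)
  have S: "(\<Union>i. S i) = V \<inter> {x. 0 < h x \<and> h x < top}"
  proof -
    have "(\<Union>i. S i) = (\<Union>k\<in>range (from_nat_into I). case k of (Ob, j) \<Rightarrow> Ob \<inter> lev j)" by (auto simp: S_def)
    also have "\<dots> = (\<Union>(Ob, j)\<in>I. Ob \<inter> lev j)" by (simp only: SI)
    also have "\<dots> = V \<inter> {x. 0 < h x \<and> h x < top}"
    proof
      show "(\<Union>(Ob, j)\<in>I. Ob \<inter> lev j) \<subseteq> V \<inter> {x. 0 < h x \<and> h x < top}"
        using \<C> \<F>V lev' by (fastforce simp: I_def)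
      show "V \<inter> {x. 0 < h x \<and> h x < top} \<subseteq> (\<Union>(Ob, j)\<in>I. Ob \<inter> lev j)"
      proof
        fix x assume x: "x \<in> V \<inter> {x. 0 < h x \<and> h x < top}"
        then obtain Ob where "Ob \<in> \<C>" "x \<in> Ob" using \<C>(3) \<F>V by blast
        moreover obtain j where "x \<in> lev j" using lev x by auto
        ultimately show "x \<in> (\<Union>(Ob, j)\<in>I. Ob \<inter> lev j)" by (auto simp: I_def)
      qed
    qed
    finally show ?thesis .
  qed
  have tame: "\<exists>Ob L c. tame \<kappa> V Ob L c (S i) \<and> Ob \<noteq> {}" for i
  proof -
    obtain Ob j where k: "from_nat_into I i = (Ob, j)" by (cases "from_nat_into I i")
    then have "(Ob, j) \<in> I" using from_nat_into[OF I(2), of i] by simp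
    then obtain L where L: "good Ob L" using \<C>(1) by (auto simp: I_def \<F>_def)
    have "tame \<kappa> V Ob L (\<kappa> powr real_of_int j) (Ob \<inter> lev j)"
      unfolding tame_def using L \<kappa> lev_sets by (auto simp: good_def lev_def)
    moreover have "S i = Ob \<inter> lev j" by (simp add: S_def k)
    moreover have "Ob \<noteq> {}" using L unfolding good_def by blast
    ultimately show ?thesis by metis
  qed
  show ?thesis
  proof (intro exI[of _ "disjointed S"] conjI allI)
    show "disjoint_family (disjointed S)" by (rule disjoint_family_disjointed)
    show "(\<Union>i. disjointed S i) = V \<inter> {x. 0 < h x \<and> h x < top}" by (simp add: UN_disjointed_eq S)
    fix i
    obtain Ob L c where T: "tame \<kappa> V Ob L c (S i)" "Ob \<noteq> {}" using tame[of i] by blast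
    have "S k \<in> sets borel" for k using tame[of k] by (auto simp: tame_def)
    then have "disjointed S i \<in> sets borel" by (auto simp: disjointed_def)
    then have "tame \<kappa> V Ob L c (disjointed S i)" by (rule tame_subset[OF T(1) disjointed_subset[of S i]])
    then show "\<exists>Ob L c. tame \<kappa> V Ob L c (disjointed S i) \<and> Ob \<noteq> {}" using T(2) by blast
  qed
qed

section \<open>Lower and upper bounds for the rates\<close>

lemma AE_h_finite: "AE x in lborel. h x < top"
proof -
  interpret P: finite_measure P by (rule P(1))
  obtain N where N: "\<And>A f. A \<in> sets borel \<Longrightarrow> f \<in> borel_measurable borel
      \<Longrightarrow> (\<integral>\<^sup>+x\<in>A. h x * f x \<partial>lborel) \<le> (\<integral>\<^sup>+x\<in>A. f x \<partial>P)"
    by (rule singular_set) blast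
  have "(\<integral>\<^sup>+x. h x \<partial>lborel) \<le> emeasure P (space P)" using N[of UNIV "\<lambda>_. 1"] by simp
  also have "\<dots> < top" by (simp add: less_top[symmetric])
  finally have "(\<integral>\<^sup>+x. h x \<partial>lborel) \<noteq> \<infinity>" by simp
  then have "AE x in lborel. h x \<noteq> \<infinity>" by (intro nn_integral_PInf_AE) auto
  then show ?thesis by eventually_elim (simp add: less_top)
qed

lemma limit_measure_positive_part:
  assumes A: "A \<in> sets borel"
  shows "emeasure limit_measure A = emeasure limit_measure (A \<inter> {x. 0 < h x \<and> h x < top})"
proof -
  have B: "A \<inter> {x. 0 < h x \<and> h x < top} \<in> sets borel" using A by measurable
  show ?thesis
    unfolding emeasure_limit_measure[OF A] emeasure_limit_measure[OF B]
  proof (rule nn_integral_cong_AE)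
    show "AE x in lborel. ennreal_powr (ennreal (hess_weight x) * h x) p * indicator U x * indicator A x
      = ennreal_powr (ennreal (hess_weight x) * h x) p * indicator U x * indicator (A \<inter> {x. 0 < h x \<and> h x < top}) x"
      using AE_h_finite by eventually_elim (auto simp: indicator_def)
  qed
qed

lemma limit_const_nonneg: "0 \<le> limit_const" by (simp add: limit_const_def)

text \<open>Choose compact subsets of finitely many tame pieces that exhaust the limit measure up to the factor
  \<open>\<kappa>\<close>, and add up their lower rates.\<close>

proposition lower_bound: "ennreal limit_const * emeasure limit_measure UNIV \<le> lower_rate U"
proof (rule ennreal_le_by_factor[where \<beta> = "\<beta> + 1"])
  fix \<kappa> :: real assume \<kappa>: "1 < \<kappa>"
  obtain E :: "nat \<Rightarrow> (real^'n) set" where E: "disjoint_family E" "(\<Union>i. E i) = U \<inter> {x. 0 < h x \<and> h x < top}"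
    "\<And>i. \<exists>Ob L c. tame \<kappa> U Ob L c (E i) \<and> Ob \<noteq> {}"
    using tame_cover[OF \<kappa> U(2) order_refl U(1)] by blast
  have Eb: "E i \<in> sets borel" for i using E(3)[of i] by (auto simp: tame_def)
  have "\<exists>K. compact K \<and> K \<subseteq> E i \<and> emeasure limit_measure (E i) \<le> ennreal \<kappa> * emeasure limit_measure K" for i
  proof -
    obtain Ob L c where T: "tame \<kappa> U Ob L c (E i)" using E(3) by blast
    have bnd: "bounded (E i)" using T unfolding tame_def by (metis bounded_subset)
    have fin: "emeasure limit_measure (E i) < top"
      using tame_limit_measure(2)[OF \<kappa> T order_refl] emeasure_bounded_finite[OF bnd]
      by (auto simp: ennreal_mult_less_top order.strict_trans1)
    show ?thesis
    proof (cases "emeasure limit_measure (E i) = 0")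
      case True then show ?thesis by (intro exI[of _ "{}"]) auto
    next
      case False
      define M where "M = density limit_measure (indicator (E i))"
      have M: "emeasure M A = emeasure limit_measure (E i \<inter> A)" if "A \<in> sets borel" for A
        unfolding M_def using Eb that by (intro emeasure_restricted) (auto simp: sets_limit_measure)
      have sM: "sets M = sets borel" "space M = UNIV" by (auto simp: M_def sets_limit_measure limit_measure_def)
      have reg: "emeasure M (E i) = (SUP K\<in>{K. K \<subseteq> E i \<and> compact K}. emeasure M K)"
        using fin M[of UNIV] Eb by (intro inner_regular) (auto simp: sM)
      obtain x where x: "emeasure limit_measure (E i) = ennreal x" "0 < x"
        using fin False by (cases "emeasure limit_measure (E i)" rule: ennreal_cases) auto
      have "ennreal (x / \<kappa>) < emeasure M (E i)"
        using M[OF Eb, of i] x \<kappa> by (simp add: ennreal_less_iff divide_less_eq)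
      then obtain K where K: "K \<subseteq> E i" "compact K" "ennreal (x / \<kappa>) < emeasure M K"
        unfolding reg less_SUP_iff by auto
      have "emeasure M K = emeasure limit_measure K" using M[of K] K by (simp add: borel_compact Int_absorb1)
      then have "ennreal \<kappa> * ennreal (x / \<kappa>) \<le> ennreal \<kappa> * emeasure limit_measure K"
        using K(3) by (intro mult_left_mono) auto
      also have "ennreal \<kappa> * ennreal (x / \<kappa>) = emeasure limit_measure (E i)"
        using \<kappa> x by (simp add: ennreal_mult[symmetric])
      finally show ?thesis using K by blast
    qed
  qed
  then obtain K where K: "\<And>i. compact (K i)" "\<And>i. K i \<subseteq> E i" "\<And>i. emeasure limit_measure (E i) \<le> ennreal \<kappa> * emeasure limit_measure (K i)"
    by metis
  have EU: "E i \<subseteq> U" for i using E(2) by blast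
  have one: "ennreal limit_const * emeasure limit_measure (E i) \<le> ennreal (\<kappa> powr (\<beta> + 1)) * lower_rate (K i)" for i
  proof (cases "K i = {}")
    case True
    then have "emeasure limit_measure (E i) = 0" using K(3)[of i] by simp
    then show ?thesis by simp
  next
    case False
    obtain Ob L c where T: "tame \<kappa> U Ob L c (E i)" using E(3) by blast
    have "ennreal (\<kappa> powr - \<beta> * limit_const) * emeasure limit_measure (K i) \<le> lower_rate (K i)"
      unfolding lower_rate_def using piece_lower[OF \<kappa> T K(1,2) False] .
    then have "ennreal (\<kappa> powr (\<beta> + 1)) * (ennreal (\<kappa> powr - \<beta> * limit_const) * emeasure limit_measure (K i)) \<le> ennreal (\<kappa> powr (\<beta> + 1)) * lower_rate (K i)"
      by (rule mult_left_mono) simp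
    also have "ennreal (\<kappa> powr (\<beta> + 1)) * (ennreal (\<kappa> powr - \<beta> * limit_const) * emeasure limit_measure (K i)) = ennreal limit_const * (ennreal \<kappa> * emeasure limit_measure (K i))"
    proof -
      have "\<kappa> powr (\<beta> + 1) * (\<kappa> powr - \<beta> * limit_const) = limit_const * \<kappa>"
        using \<kappa> by (simp add: powr_add powr_minus field_simps)
      then have "ennreal (\<kappa> powr (\<beta> + 1)) * ennreal (\<kappa> powr - \<beta> * limit_const) = ennreal limit_const * ennreal \<kappa>"
        using limit_const_nonneg \<kappa> by (simp add: ennreal_mult[symmetric])
      then show ?thesis by (simp add: mult.assoc[symmetric])
    qed
    finally have "ennreal limit_const * (ennreal \<kappa> * emeasure limit_measure (K i)) \<le> ennreal (\<kappa> powr (\<beta> + 1)) * lower_rate (K i)" .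
    then show ?thesis using K(3)[of i] by (meson mult_left_mono order_trans zero_le)
  qed
  have part: "(\<Sum>i<N. ennreal limit_const * emeasure limit_measure (E i)) \<le> ennreal (\<kappa> powr (\<beta> + 1)) * lower_rate U" for N
  proof -
    have "(\<Sum>i<N. ennreal limit_const * emeasure limit_measure (E i)) \<le> (\<Sum>i<N. ennreal (\<kappa> powr (\<beta> + 1)) * lower_rate (K i))"
      by (intro sum_mono one)
    also have "\<dots> = ennreal (\<kappa> powr (\<beta> + 1)) * (\<Sum>i<N. lower_rate (K i))" by (simp add: sum_distrib_left)
    also have "(\<Sum>i<N. lower_rate (K i)) \<le> lower_rate (\<Union>i<N. K i)"
    proof (rule lower_rate_finite_union)
      show "compact (K i) \<and> K i \<subseteq> U" for i using K EU by blast
      show "disjoint_family_on K {..<N}"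
        unfolding disjoint_family_on_def
      proof (intro ballI impI)
        fix i j :: nat assume "i \<noteq> j"
        then have "E i \<inter> E j = {}" by (intro disjoint_family_onD[OF E(1)]) auto
        then show "K i \<inter> K j = {}" using K(2)[of i] K(2)[of j] by blast
      qed
    qed
    also have "lower_rate (\<Union>i<N. K i) \<le> lower_rate U" using K EU by (intro lower_rate_mono) blast
    finally show ?thesis by (simp add: mult_left_mono)
  qed
  have "emeasure limit_measure UNIV = emeasure limit_measure (U \<inter> {x. 0 < h x \<and> h x < top})"
  proof -
    have UNIVb: "(UNIV :: (real^'n) set) \<in> sets borel" by simp
    have "emeasure limit_measure UNIV = emeasure limit_measure U"
      unfolding emeasure_limit_measure[OF UNIVb] emeasure_limit_measure[OF U_sets]
      by (intro nn_integral_cong) (auto simp: indicator_def)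
    then show ?thesis using limit_measure_positive_part[OF U_sets] by simp
  qed
  also have "\<dots> = (\<Sum>i. emeasure limit_measure (E i))"
    unfolding E(2)[symmetric] using Eb E(1) by (intro suminf_emeasure[symmetric]) (auto simp: sets_limit_measure)
  finally have "ennreal limit_const * emeasure limit_measure UNIV = (\<Sum>i. ennreal limit_const * emeasure limit_measure (E i))" by simp
  also have "\<dots> \<le> ennreal (\<kappa> powr (\<beta> + 1)) * lower_rate U" by (rule suminf_le_const) (use part in auto)
  finally show "ennreal limit_const * emeasure limit_measure UNIV \<le> ennreal (\<kappa> powr (\<beta> + 1)) * lower_rate U" .
qed

text \<open>Off the Lebesgue-null set \<open>N\<close>, the set \<open>V\<close> is the union of the tame pieces and of a \<open>P\<close>-null set \<open>J\<close>.
  The part of \<open>V\<close> inside \<open>N\<close> has rate zero because its compact subsets do.\<close>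

proposition upper_bound:
  assumes V: "open V" "convex V" "V \<subseteq> U" "V \<noteq> {}"
    and H: "\<And>x v. x \<in> V \<Longrightarrow> v \<bullet> (hessian F x *v v) \<le> C * (norm v)\<^sup>2" and C: "0 \<le> C"
    and \<delta>: "0 < \<delta>" and mom: "(\<integral>\<^sup>+\<xi>\<in>V. ennreal ((1 + norm \<xi>) powr (r * (1 + \<delta>))) \<partial>P) < \<infinity>"
  shows "ennreal_powr (rate_sup q (opt_cost bcost V P V)) p \<le> ennreal limit_const * emeasure limit_measure V"
proof (rule ennreal_le_by_factor[where \<beta> = \<beta>])
  fix \<kappa> :: real assume \<kappa>: "1 < \<kappa>"
  note [measurable_cong] = P(2)
  have Vb [measurable]: "V \<in> sets borel" using V by simp
  define C' where "C' = (C / 2) powr (r / 2)"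
  have C': "0 \<le> C'" by (simp add: C'_def)
  have cost: "bcost \<xi> a \<le> ennreal (C' * norm (\<xi> - a) powr r)" if \<xi>: "\<xi> \<in> V" "a \<in> V" for \<xi> a
  proof -
    have up: "bregman F \<xi> a \<le> C * (norm (\<xi> - a))\<^sup>2 / 2"
      using H by (intro bregman_upper[OF C2 V(2,3) \<xi>(2,1)]) auto
    have nn: "0 \<le> bregman F \<xi> a" using \<xi> V by (intro bregman_nonneg[OF C2 U(3)] pd) auto
    have "bregman F \<xi> a powr (r / 2) \<le> (C / 2 * (norm (\<xi> - a))\<^sup>2) powr (r / 2)"
      using up nn r by (intro powr_mono2) auto
    also have "\<dots> = C' * norm (\<xi> - a) powr r"
      using C by (subst powr_mult) (simp_all add: sq_powr_half C'_def)
    finally have "bregman F \<xi> a powr (r / 2) \<le> C' * norm (\<xi> - a) powr r" .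
    moreover have "\<xi> \<in> U" using \<xi> V by blast
    ultimately show ?thesis by (simp add: bcost_def ennreal_leI)
  qed
  define A where "A = C' * (real CARD('n) * 4 * 2 powr (1 + \<delta>) / \<delta>) powr r"
  define \<nu> where "\<nu> = density P (\<lambda>\<xi>. ennreal A * (ennreal ((1 + norm \<xi>) powr (r * (1 + \<delta>))) * indicator V \<xi>))"
  have \<nu>: "emeasure \<nu> B = ennreal A * (\<integral>\<^sup>+\<xi>\<in>B. ennreal ((1 + norm \<xi>) powr (r * (1 + \<delta>))) * indicator V \<xi> \<partial>P)"
    if [measurable]: "B \<in> sets borel" for B
    unfolding \<nu>_def by (subst emeasure_density) (simp_all add: mult.assoc nn_integral_cmult)
  interpret R: regular_rate q p bcost V V P \<nu>
  proof (rule regular_rate.intro)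
    have "emeasure \<nu> UNIV = ennreal A * (\<integral>\<^sup>+\<xi>\<in>V. ennreal ((1 + norm \<xi>) powr (r * (1 + \<delta>))) \<partial>P)"
      by (subst \<nu>) simp_all
    also have "\<dots> < \<infinity>" using mom by (simp add: ennreal_mult_less_top)
    finally have "emeasure \<nu> (space \<nu>) < \<infinity>"
      using sets_eq_imp_space_eq[OF P(2)] by (simp add: \<nu>_def)
    then show "finite_measure \<nu>" by (intro finite_measureI) simp
    fix B assume B: "B \<in> sets borel" "B \<subseteq> V"
    have "rate_sup q (opt_cost bcost V P B) \<le> ennreal A * (\<integral>\<^sup>+\<xi>\<in>B. ennreal ((1 + norm \<xi>) powr (r * (1 + \<delta>))) \<partial>P)"
      unfolding q A_def by (rule pierce_bound[OF r \<delta> B(2) V(4) C' cost P(2) B(1)])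
    also have "(\<integral>\<^sup>+\<xi>\<in>B. ennreal ((1 + norm \<xi>) powr (r * (1 + \<delta>))) \<partial>P)
       = (\<integral>\<^sup>+\<xi>\<in>B. ennreal ((1 + norm \<xi>) powr (r * (1 + \<delta>))) * indicator V \<xi> \<partial>P)"
      using B by (intro nn_integral_cong) (auto simp: indicator_def)
    also have "ennreal A * \<dots> = emeasure \<nu> B" using B by (simp add: \<nu>)
    finally show "rate_sup q (opt_cost bcost V P B) \<le> emeasure \<nu> B" .
  qed (use q_gt0 p P in \<open>auto simp: \<nu>_def\<close>)
  obtain N where N: "N \<in> null_sets lborel"
    "\<And>A f. A \<in> sets borel \<Longrightarrow> A \<inter> N = {} \<Longrightarrow> f \<in> borel_measurable borel
      \<Longrightarrow> (\<integral>\<^sup>+x\<in>A. f x \<partial>P) = (\<integral>\<^sup>+x\<in>A. h x * f x \<partial>lborel)"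
    by (rule singular_set) blast
  have Nb [measurable]: "N \<in> sets borel" using N(1) by auto
  obtain E :: "nat \<Rightarrow> (real^'n) set" where E: "disjoint_family E" "(\<Union>i. E i) = V \<inter> {x. 0 < h x \<and> h x < top}"
    "\<And>i. \<exists>Ob L c. tame \<kappa> V Ob L c (E i) \<and> Ob \<noteq> {}"
    using tame_cover[OF \<kappa> V(1,3,4)] by blast
  have Eb [measurable]: "E i \<in> sets borel" for i using E(3)[of i] by (auto simp: tame_def)
  have EV: "E i \<subseteq> V" for i using E(2) by blast
  define J where "J = V \<inter> {x. \<not> (0 < h x \<and> h x < top)} - N"
  have Jb [measurable]: "J \<in> sets borel" unfolding J_def by measurable
  have "R.upper_rate (V \<inter> N) \<le> 0"
  proof (rule R.upper_rate_regular)
    fix K assume K: "compact K" "K \<subseteq> V \<inter> N"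
    have Kb: "K \<in> sets borel" using K by (simp add: borel_compact)
    have "emeasure lborel K \<le> emeasure lborel N" using K Nb by (intro emeasure_mono) auto
    then have "emeasure lborel K = 0" using N(1) by (auto dest: null_setsD1)
    then have "rate_sup q (opt_cost bcost V P K) = 0"
      unfolding q using K V P by (intro rate_sup_null_compact[OF r C' cost]) auto
    then show "R.upper_rate K \<le> 0" by (simp add: R.upper_rate_def)
  qed auto
  moreover have "R.upper_rate J \<le> 0"
  proof -
    have "emeasure P J = (\<integral>\<^sup>+x\<in>J. 1 \<partial>P)" by (simp add: P)
    also have "\<dots> = (\<integral>\<^sup>+x\<in>J. h x * 1 \<partial>lborel)" by (intro N(2)) (auto simp: J_def)
    also have "\<dots> = (\<integral>\<^sup>+x. 0 \<partial>(lborel :: (real^'n) measure))"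
      by (rule nn_integral_cong_AE, use AE_h_finite in eventually_elim) (auto simp: J_def indicator_def)
    finally have "J \<in> null_sets P" by (auto simp: null_sets_def P)
    then have "AE \<xi> in P. \<xi> \<notin> J" by (rule AE_not_in)
    then have "(\<integral>\<^sup>+\<xi>\<in>J. ennreal ((1 + norm \<xi>) powr (r * (1 + \<delta>))) * indicator V \<xi> \<partial>P) = (\<integral>\<^sup>+\<xi>. 0 \<partial>P)"
      by (intro nn_integral_cong_AE) (auto simp: indicator_def)
    then have "emeasure \<nu> J = 0" by (subst \<nu>) auto
    then show ?thesis using R.upper_rate_dom[of J] by (auto simp: J_def)
  qed
  moreover have "R.upper_rate (\<Union>i. E i - N) \<le> ennreal (\<kappa> powr \<beta>) * (ennreal limit_const * emeasure limit_measure V)"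
  proof -
    have "R.upper_rate (E i - N) \<le> ennreal (\<kappa> powr \<beta> * limit_const) * emeasure limit_measure (E i)" for i
    proof (rule R.upper_rate_regular)
      obtain Ob L c where T: "tame \<kappa> V Ob L c (E i)" "Ob \<noteq> {}" using E(3) by blast
      fix K assume K: "compact K" "K \<subseteq> E i - N"
      have "R.upper_rate K \<le> ennreal (\<kappa> powr \<beta> * limit_const) * emeasure limit_measure K"
        unfolding R.upper_rate_def using K by (intro piece_upper[OF \<kappa> T(1) V(3) N(2) _ _ _ T(2)]) auto
      also have "emeasure limit_measure K \<le> emeasure limit_measure (E i)" using K by (intro emeasure_mono) (auto simp: sets_limit_measure)
      finally show "R.upper_rate K \<le> ennreal (\<kappa> powr \<beta> * limit_const) * emeasure limit_measure (E i)" by (simp add: mult_left_mono)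
    qed (use EV in auto)
    then have "(\<Sum>i. R.upper_rate (E i - N)) \<le> (\<Sum>i. ennreal (\<kappa> powr \<beta> * limit_const) * emeasure limit_measure (E i))"
      by (intro suminf_le) auto
    also have "\<dots> = ennreal (\<kappa> powr \<beta> * limit_const) * (\<Sum>i. emeasure limit_measure (E i))" by simp
    also have "(\<Sum>i. emeasure limit_measure (E i)) = emeasure limit_measure (\<Union>i. E i)"
      using E(1) by (intro suminf_emeasure) (auto simp: sets_limit_measure)
    also have "\<dots> \<le> emeasure limit_measure V" using EV by (intro emeasure_mono) (auto simp: sets_limit_measure)
    finally have *: "(\<Sum>i. R.upper_rate (E i - N)) \<le> ennreal (\<kappa> powr \<beta> * limit_const) * emeasure limit_measure V" by (simp add: mult_left_mono)
    have "disjoint_family (\<lambda>i. E i - N)"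
      unfolding disjoint_family_on_def
    proof (intro ballI impI)
      fix i j :: nat assume "i \<noteq> j"
      then have "E i \<inter> E j = {}" by (intro disjoint_family_onD[OF E(1)]) auto
      then show "(E i - N) \<inter> (E j - N) = {}" by blast
    qed
    then have "R.upper_rate (\<Union>i. E i - N) \<le> (\<Sum>i. R.upper_rate (E i - N))"
      using EV by (intro R.upper_rate_countable) auto
    with * show ?thesis using limit_const_nonneg by (auto simp: ennreal_mult mult.assoc)
  qed
  moreover have "V = (V \<inter> N) \<union> (J \<union> (\<Union>i. E i - N))"
  proof -
    have "(\<Union>i. E i - N) = V \<inter> {x. 0 < h x \<and> h x < top} - N" using E(2) by auto
    then show ?thesis unfolding J_def by auto
  qed
  then have "R.upper_rate V \<le> R.upper_rate (V \<inter> N) + (R.upper_rate J + R.upper_rate (\<Union>i. E i - N))"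
  proof -
    have "R.upper_rate ((V \<inter> N) \<union> (J \<union> (\<Union>i. E i - N))) \<le> R.upper_rate (V \<inter> N) + R.upper_rate (J \<union> (\<Union>i. E i - N))"
      by (intro R.upper_rate_Un) auto
    also have "R.upper_rate (J \<union> (\<Union>i. E i - N)) \<le> R.upper_rate J + R.upper_rate (\<Union>i. E i - N)" by (intro R.upper_rate_Un) auto
    finally show ?thesis using \<open>V = (V \<inter> N) \<union> (J \<union> (\<Union>i. E i - N))\<close> by (simp add: add_left_mono)
  qed
  ultimately have "R.upper_rate V \<le> ennreal (\<kappa> powr \<beta>) * (ennreal limit_const * emeasure limit_measure V)" by simp
  then show "ennreal_powr (rate_sup q (opt_cost bcost V P V)) p \<le> ennreal (\<kappa> powr \<beta>) * (ennreal limit_const * emeasure limit_measure V)"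
    by (simp add: R.upper_rate_def)
qed

end

section \<open>Support and inner parts\<close>

text \<open>The complement of the support is a union of open null sets, and countably many of them suffice.\<close>

lemma emeasure_supp:
  fixes P :: "'a::second_countable_topology measure"
  assumes P: "sets P = sets borel"
  shows "- supp P \<in> null_sets P"
proof -
  define \<N> where "\<N> = {V. open V \<and> emeasure P V = 0}"
  have "\<Union>\<N> = - supp P" by (auto simp: \<N>_def supp_def)
  moreover obtain \<C> where \<C>: "\<C> \<subseteq> \<N>" "countable \<C>" "\<Union>\<C> = \<Union>\<N>"
    using Lindelof[of \<N>] by (auto simp: \<N>_def)
  moreover have "\<Union>\<C> \<in> null_sets P"
    using \<C> by (intro null_sets_UN'[where I = \<C> and N = "\<lambda>x. x", simplified]) (auto simp: \<N>_def null_sets_def P)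
  ultimately show ?thesis by simp
qed

text \<open>In terms of balls contained in \<open>U\<close> the inner part is seen to be open and convex.\<close>

lemma inner_part_iff:
  assumes "0 < \<eta>"
  shows "x \<in> inner_part U \<eta> \<longleftrightarrow> (\<exists>e>\<eta>. ball x e \<subseteq> U)"
proof
  assume "x \<in> inner_part U \<eta>"
  then have "ereal \<eta> < (INF y\<in>- U. ereal (dist x y))" using assms by (auto simp: inner_part_def)
  then obtain e where e: "ereal \<eta> < ereal e" "ereal e < (INF y\<in>- U. ereal (dist x y))"
    using ereal_dense2 by blast
  have "ball x e \<subseteq> U"
  proof
    fix y assume y: "y \<in> ball x e"
    show "y \<in> U"
    proof (rule ccontr)
      assume "y \<notin> U"
      then have "(INF y\<in>- U. ereal (dist x y)) \<le> ereal (dist x y)" by (intro INF_lower) auto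
      with e(2) y show False by (auto simp: not_less dest: order.strict_trans2)
    qed
  qed
  with e(1) show "\<exists>e>\<eta>. ball x e \<subseteq> U" by auto
next
  assume "\<exists>e>\<eta>. ball x e \<subseteq> U"
  then obtain e where e: "e > \<eta>" "ball x e \<subseteq> U" by blast
  have "ereal e \<le> (INF y\<in>- U. ereal (dist x y))"
    using e(2) by (intro INF_greatest) (auto simp: not_less[symmetric] subset_eq)
  moreover have "ereal \<eta> < ereal e" using e(1) by simp
  ultimately have "ereal \<eta> < (INF y\<in>- U. ereal (dist x y))" by (rule less_le_trans[rotated])
  then show "x \<in> inner_part U \<eta>" using e assms by (auto simp: inner_part_def)
qed

lemma inner_part_open_convex:
  fixes U :: "'a::real_normed_vector set"
  assumes U: "open U" "convex U" and \<eta>: "0 \<le> \<eta>"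
  shows "open (inner_part U \<eta>)" "convex (inner_part U \<eta>)" "inner_part U \<eta> \<subseteq> U"
proof -
  show "inner_part U \<eta> \<subseteq> U" by (auto simp: inner_part_def)
  show "open (inner_part U \<eta>)"
  proof (cases "\<eta> = 0")
    case True then show ?thesis using U by (simp add: inner_part_def)
  next
    case False
    then have \<eta>: "0 < \<eta>" using \<eta> by simp
    show ?thesis unfolding open_contains_ball
    proof
      fix x assume "x \<in> inner_part U \<eta>"
      then obtain e where e: "e > \<eta>" "ball x e \<subseteq> U" using inner_part_iff[OF \<eta>] by blast
      have "ball x ((e - \<eta>) / 2) \<subseteq> inner_part U \<eta>"
      proof
        fix y assume y: "y \<in> ball x ((e - \<eta>) / 2)"
        have "ball y ((e + \<eta>) / 2) \<subseteq> ball x e"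
        proof
          fix z assume "z \<in> ball y ((e + \<eta>) / 2)"
          then have "dist x z < (e - \<eta>) / 2 + (e + \<eta>) / 2"
            using y dist_triangle[of x z y] by (simp only: mem_ball)
          then show "z \<in> ball x e" by (simp add: field_simps)
        qed
        then show "y \<in> inner_part U \<eta>"
          using e inner_part_iff[OF \<eta>] by (intro iffD2[OF inner_part_iff[OF \<eta>]] exI[of _ "(e + \<eta>) / 2"]) auto
      qed
      then show "\<exists>e>0. ball x e \<subseteq> inner_part U \<eta>" using e by (intro exI[of _ "(e - \<eta>) / 2"]) auto
    qed
  qed
  show "convex (inner_part U \<eta>)"
  proof (cases "\<eta> = 0")
    case True then show ?thesis using U by (simp add: inner_part_def)
  next
    case False
    then have \<eta>: "0 < \<eta>" using \<eta> by simp
    show ?thesis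
    proof (rule convexI)
      fix x y :: 'a and u v :: real
      assume x: "x \<in> inner_part U \<eta>" and y: "y \<in> inner_part U \<eta>" and uv: "0 \<le> u" "0 \<le> v" "u + v = 1"
      obtain e1 where e1: "e1 > \<eta>" "ball x e1 \<subseteq> U" using x inner_part_iff[OF \<eta>] by blast
      obtain e2 where e2: "e2 > \<eta>" "ball y e2 \<subseteq> U" using y inner_part_iff[OF \<eta>] by blast
      have "ball (u *\<^sub>R x + v *\<^sub>R y) (min e1 e2) \<subseteq> U"
      proof
        fix z assume z: "z \<in> ball (u *\<^sub>R x + v *\<^sub>R y) (min e1 e2)"
        define w where "w = z - (u *\<^sub>R x + v *\<^sub>R y)"
        have nw: "norm w < min e1 e2" using z by (simp add: w_def dist_norm norm_minus_commute)
        have "x + w \<in> ball x e1" "y + w \<in> ball y e2" using nw by (simp_all add: dist_norm)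
        then have "x + w \<in> U" "y + w \<in> U" using e1 e2 by blast+
        then have "u *\<^sub>R (x + w) + v *\<^sub>R (y + w) \<in> U" using uv U(2) by (intro convexD) auto
        also have "u *\<^sub>R (x + w) + v *\<^sub>R (y + w) = u *\<^sub>R x + v *\<^sub>R y + (u + v) *\<^sub>R w" by (simp add: algebra_simps)
        also have "\<dots> = z" using uv by (simp add: w_def)
        finally show "z \<in> U" .
      qed
      then show "u *\<^sub>R x + v *\<^sub>R y \<in> inner_part U \<eta>"
        using e1 e2 by (intro iffD2[OF inner_part_iff[OF \<eta>]] exI[of _ "min e1 e2"]) auto
    qed
  qed
qed

context bregman_quantization
begin

lemma quadratic_form_le_onorm:
  fixes A :: "real^'n^'n"
  assumes "onorm ((*v) A) \<le> C"
  shows "v \<bullet> (A *v v) \<le> C * (norm v)\<^sup>2"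
proof -
  have "norm (A *v v) \<le> onorm ((*v) A) * norm v" by (rule onorm) simp
  also have "\<dots> \<le> C * norm v" using assms by (rule mult_right_mono) simp
  finally have "norm v * norm (A *v v) \<le> norm v * (C * norm v)" by (rule mult_left_mono) simp
  with norm_cauchy_schwarz[of v "A *v v"] show ?thesis by (simp add: power2_eq_square mult_ac)
qed

text \<open>In the first case \<open>V\<close> is a neighborhood of the convex hull of the support with compact closure in \<open>U\<close>; in
  the second case it is the inner part itself.\<close>

lemma bounded_hessian_domain:
  assumes PU: "- U \<in> null_sets P" and P0: "emeasure P UNIV \<noteq> 0"
    and alt: "(compact (supp P) \<and> supp P \<subseteq> U) \<or>
       (\<exists>\<eta>\<ge>0. supp P \<inter> U \<subseteq> inner_part U \<eta> \<and>
          bdd_above ((\<lambda>x. onorm ((*v) (hessian F x))) ` inner_part U \<eta>))"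
  obtains V C where "open V" "convex V" "V \<subseteq> U" "V \<noteq> {}" "- V \<in> null_sets P" "0 \<le> C"
    "\<And>x v. x \<in> V \<Longrightarrow> v \<bullet> (hessian F x *v v) \<le> C * (norm v)\<^sup>2"
proof -
  have null: "- V \<in> null_sets P" if "supp P \<inter> U \<subseteq> V" "open V" for V
  proof (rule null_sets_subset)
    show "- supp P \<union> - U \<in> null_sets P" using emeasure_supp[OF P(2)] PU by auto
    show "- V \<in> sets P" using that by (simp add: P)
  qed (use that in auto)
  have ne: "V \<noteq> {}" if "- V \<in> null_sets P" for V
    using that P0 by (auto simp: null_sets_def)
  from alt show ?thesis
  proof (elim disjE conjE exE)
    assume S: "compact (supp P)" "supp P \<subseteq> U"
    define K where "K = convex hull (supp P)"
    have K: "compact K" "K \<subseteq> U" "supp P \<subseteq> K" "convex K"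
      using S U by (auto simp: K_def compact_convex_hull hull_minimal hull_subset)
    obtain \<epsilon> where \<epsilon>: "\<epsilon> > 0" "(\<Union>x\<in>K. ball x \<epsilon>) \<subseteq> U"
      using compact_subset_open_imp_ball_epsilon_subset[OF K(1) U(2) K(2)] by blast
    define V where "V = (\<Union>x\<in>K. \<Union>y\<in>ball 0 (\<epsilon> / 2). {x + y})"
    have V': "V = (\<Union>x\<in>K. ball x (\<epsilon> / 2))"
    proof -
      have *: "ball x (\<epsilon> / 2) = (\<Union>y\<in>ball 0 (\<epsilon> / 2). {x + y})" for x :: "real^'n"
      proof -
        have "z = x + (z - x) \<and> z - x \<in> ball 0 (\<epsilon> / 2)" if "z \<in> ball x (\<epsilon> / 2)" for z
          using that by (simp add: dist_norm norm_minus_commute)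
        then have "ball x (\<epsilon> / 2) \<subseteq> (\<Union>y\<in>ball 0 (\<epsilon> / 2). {x + y})" by blast
        moreover have "(\<Union>y\<in>ball 0 (\<epsilon> / 2). {x + y}) \<subseteq> ball x (\<epsilon> / 2)" by (auto simp: dist_norm)
        ultimately show ?thesis by blast
      qed
      show ?thesis unfolding V_def by (intro SUP_cong refl *[symmetric])
    qed
    define B where "B = {x + y |x y. x \<in> K \<and> y \<in> cball 0 (\<epsilon> / 2)}"
    have "compact B" unfolding B_def using K by (intro compact_sums) auto
    have VB: "V \<subseteq> B"
    proof
      fix z assume "z \<in> V"
      then obtain x y where "x \<in> K" "norm y < \<epsilon> / 2" "z = x + y" by (auto simp: V_def)
      then show "z \<in> B" unfolding B_def by (intro CollectI exI[of _ x] exI[of _ y]) auto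
    qed
    have BU: "B \<subseteq> U"
    proof
      fix z assume "z \<in> B"
      then obtain x y where "x \<in> K" "norm y \<le> \<epsilon> / 2" "z = x + y" by (auto simp: B_def)
      then have "z \<in> ball x \<epsilon>" using \<epsilon> by (simp add: dist_norm)
      then show "z \<in> U" using \<epsilon> \<open>x \<in> K\<close> by blast
    qed
    have "open V" unfolding V' by auto
    have "convex V" unfolding V_def using K by (intro convex_sums) auto
    have "x \<in> ball x (\<epsilon> / 2)" for x :: "real^'n" using \<epsilon>(1) by simp
    then have "supp P \<subseteq> V" unfolding V' using K(3) by blast
    then have nV: "- V \<in> null_sets P" using \<open>open V\<close> by (intro null) auto
    then have "V \<noteq> {}" by (rule ne)
    then have "B \<noteq> {}" using VB by auto
    have "continuous_on B (hessian F)" using C2 BU by (auto simp: C2_on_def intro: continuous_on_subset)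
    from quadratic_form_bounds[OF \<open>compact B\<close> \<open>B \<noteq> {}\<close> this] pd BU
    obtain m M where mM: "0 < m" "m \<le> M"
      "\<And>x v. x \<in> B \<Longrightarrow> m * (norm v)\<^sup>2 \<le> v \<bullet> (hessian F x *v v) \<and> v \<bullet> (hessian F x *v v) \<le> M * (norm v)\<^sup>2"
      by blast
    show ?thesis
    proof (rule that[OF \<open>open V\<close> \<open>convex V\<close> order_trans[OF VB BU] \<open>V \<noteq> {}\<close> nV, of M])
      show "0 \<le> M" using mM(1,2) by simp
      show "v \<bullet> (hessian F x *v v) \<le> M * (norm v)\<^sup>2" if "x \<in> V" for x v
        using mM(3)[of x v] VB that by blast
    qed
  next
    fix \<eta> :: real assume \<eta>: "0 \<le> \<eta>" "supp P \<inter> U \<subseteq> inner_part U \<eta>"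
      "bdd_above ((\<lambda>x. onorm ((*v) (hessian F x))) ` inner_part U \<eta>)"
    obtain C where C: "\<And>x. x \<in> inner_part U \<eta> \<Longrightarrow> onorm ((*v) (hessian F x)) \<le> C"
      using \<eta>(3) by (auto simp: bdd_above_def)
    note V = inner_part_open_convex[OF U(2,3) \<eta>(1)]
    have nV: "- inner_part U \<eta> \<in> null_sets P" using \<eta> V by (intro null) auto
    show ?thesis
    proof (rule that[OF V ne[OF nV] nV, of "max C 0"])
      fix x v assume "x \<in> inner_part U \<eta>"
      then show "v \<bullet> (hessian F x *v v) \<le> max C 0 * (norm v)\<^sup>2"
        using C by (intro quadratic_form_le_onorm) (auto intro: max.coboundedI1)
    qed simp
  qed
qed

lemma moment_bound:
  assumes \<delta>: "0 < \<delta>" and V: "V \<subseteq> U" "V \<in> sets borel"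
    and mom: "(\<integral>\<^sup>+\<xi>\<in>U. ennreal (max (norm \<xi> powr (2 * (1 + \<delta>))) \<bar>F \<xi>\<bar> powr (r / 2)) \<partial>P) < \<infinity>"
  shows "(\<integral>\<^sup>+\<xi>\<in>V. ennreal ((1 + norm \<xi>) powr (r * (1 + \<delta>))) \<partial>P) < \<infinity>"
proof -
  interpret P: finite_measure P by (rule P(1))
  note [measurable_cong] = P(2)
  note [measurable] = V(2)
  define s where "s = r * (1 + \<delta>)"
  have s: "0 < s" using r \<delta> by (simp add: s_def)
  have pt: "(1 + t) powr s \<le> 2 powr s * (1 + t powr s)" if "0 \<le> t" for t :: real
  proof -
    have "(1 + t) powr s \<le> (2 * max 1 t) powr s" using that s by (intro powr_mono2) auto
    also have "\<dots> = 2 powr s * max 1 t powr s" using that by (simp add: powr_mult)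
    also have "max 1 t powr s \<le> 1 + t powr s" by (auto simp: max_def)
    finally show ?thesis by (simp add: mult_left_mono)
  qed
  have "(\<integral>\<^sup>+\<xi>\<in>V. ennreal ((1 + norm \<xi>) powr s) \<partial>P) \<le> (\<integral>\<^sup>+\<xi>. ennreal (2 powr s) * (indicator V \<xi> + ennreal (norm \<xi> powr s) * indicator V \<xi>) \<partial>P)"
  proof (rule nn_integral_mono)
    fix \<xi> :: "real^'n"
    have "ennreal ((1 + norm \<xi>) powr s) \<le> ennreal (2 powr s) * (1 + ennreal (norm \<xi> powr s))"
      using pt[of "norm \<xi>"] by (simp add: ennreal_mult[symmetric] ennreal_leI flip: ennreal_1 ennreal_plus)
    then show "ennreal ((1 + norm \<xi>) powr s) * indicator V \<xi> \<le> ennreal (2 powr s) * (indicator V \<xi> + ennreal (norm \<xi> powr s) * indicator V \<xi>)"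
      by (auto simp: indicator_def)
  qed
  also have "\<dots> = ennreal (2 powr s) * (emeasure P V + (\<integral>\<^sup>+\<xi>\<in>V. ennreal (norm \<xi> powr s) \<partial>P))"
    by (subst nn_integral_cmult, measurable, subst nn_integral_add) (auto simp: P)
  also have "\<dots> < \<infinity>"
  proof -
    have "(\<integral>\<^sup>+\<xi>\<in>V. ennreal (norm \<xi> powr s) \<partial>P) \<le> (\<integral>\<^sup>+\<xi>\<in>U. ennreal (max (norm \<xi> powr (2 * (1 + \<delta>))) \<bar>F \<xi>\<bar> powr (r / 2)) \<partial>P)"
    proof (rule nn_integral_mono)
      fix \<xi> :: "real^'n"
      have "norm \<xi> powr s = (norm \<xi> powr (2 * (1 + \<delta>))) powr (r / 2)"
        by (simp add: powr_powr s_def distrib_left mult_ac)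
      also have "\<dots> \<le> max (norm \<xi> powr (2 * (1 + \<delta>))) \<bar>F \<xi>\<bar> powr (r / 2)" using r by (intro powr_mono2) auto
      finally show "ennreal (norm \<xi> powr s) * indicator V \<xi> \<le> ennreal (max (norm \<xi> powr (2 * (1 + \<delta>))) \<bar>F \<xi>\<bar> powr (r / 2)) * indicator U \<xi>"
        using V by (auto simp: indicator_def intro: ennreal_leI)
    qed
    also note mom
    finally have "emeasure P V + (\<integral>\<^sup>+\<xi>\<in>V. ennreal (norm \<xi> powr s) \<partial>P) < top"
      by (simp add: less_top[symmetric])
    then show ?thesis by (simp add: ennreal_mult_less_top)
  qed
  finally show ?thesis by (simp add: s_def)
qed

text \<open>The optimal costs are compared in this direction only: centers in \<open>V\<close> are a special case, and \<open>P\<close> does not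
  charge the rest of \<open>U\<close>.\<close>

lemma opt_cost_restrict:
  assumes V: "V \<subseteq> U" "- V \<in> null_sets P"
  shows "opt_cost bcost U P U n \<le> opt_cost bcost V P V n"
proof (rule opt_cost_geI)
  fix \<Gamma> assume \<Gamma>: "\<Gamma> \<subseteq> V" "finite \<Gamma>" "\<Gamma> \<noteq> {}" "card \<Gamma> \<le> n"
  have "opt_cost bcost U P U n \<le> cost_over bcost P U \<Gamma>" using \<Gamma> V by (intro opt_cost_le) auto
  also have "\<dots> = cost_over bcost P V \<Gamma>"
    by (rule nn_integral_cong_AE, use AE_not_in[OF V(2)] in eventually_elim) (use V(1) in \<open>auto simp: indicator_def\<close>)
  finally show "opt_cost bcost U P U n \<le> \<dots>" .
qed

lemma opt_quant_err_eq: "opt_quant_err U F r P n = ennreal_powr (opt_cost bcost U P U n) (1 / r)"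
proof -
  have "opt_quant_err U F r P n = (INF \<Gamma>\<in>{\<Gamma>. \<Gamma> \<subseteq> U \<and> finite \<Gamma> \<and> \<Gamma> \<noteq> {} \<and> card \<Gamma> \<le> n}.
      ennreal_powr (cost_over bcost P U \<Gamma>) (1 / r))"
    unfolding opt_quant_err_def
  proof (intro INF_cong)
    show "{\<Gamma>. \<Gamma> \<subseteq> U \<and> finite \<Gamma> \<and> 1 \<le> card \<Gamma> \<and> card \<Gamma> \<le> n}
      = {\<Gamma>. \<Gamma> \<subseteq> U \<and> finite \<Gamma> \<and> \<Gamma> \<noteq> {} \<and> card \<Gamma> \<le> n}"
      by (auto simp: Suc_le_eq card_gt_0_iff)
    fix \<Gamma> assume \<Gamma>: "\<Gamma> \<in> {\<Gamma>. \<Gamma> \<subseteq> U \<and> finite \<Gamma> \<and> \<Gamma> \<noteq> {} \<and> card \<Gamma> \<le> n}"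
    have "(\<integral>\<^sup>+\<xi>\<in>U. ennreal (Min ((\<lambda>a. bregman F \<xi> a powr (r / 2)) ` \<Gamma>)) \<partial>P) = cost_over bcost P U \<Gamma>"
      by (intro nn_integral_cong) (use \<Gamma> in \<open>auto simp: ennreal_Min_eq_INF bcost_def indicator_def\<close>)
    then show "quant_err U F r P \<Gamma> = ennreal_powr (cost_over bcost P U \<Gamma>) (1 / r)"
      by (simp add: quant_err_def)
  qed
  also have "\<dots> = ennreal_powr (opt_cost bcost U P U n) (1 / r)"
    unfolding opt_cost_def using r by (subst ennreal_powr_INF) auto
  finally show ?thesis .
qed

lemma scaled_error_eq:
  "ennreal (real n powr (1 / CARD('n))) * opt_quant_err U F r P n
    = ennreal_powr (ennreal (real n powr q) * opt_cost bcost U P U n) (1 / r)"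
  using r by (simp add: opt_quant_err_eq ennreal_powr_mult powr_powr q)

lemma liminf_scaled_error:
  "liminf (\<lambda>n. ennreal (real n powr (1 / CARD('n))) * opt_quant_err U F r P n)
    = ennreal_powr (rate_inf q (opt_cost bcost U P U)) (1 / r)"
  unfolding scaled_error_eq rate_inf_def using r
  by (intro Liminf_compose_continuous_mono continuous_ennreal_powr monoI ennreal_powr_mono) auto

lemma limsup_scaled_error:
  "limsup (\<lambda>n. ennreal (real n powr (1 / CARD('n))) * opt_quant_err U F r P n)
    = ennreal_powr (rate_sup q (opt_cost bcost U P U)) (1 / r)"
  unfolding scaled_error_eq rate_sup_def using r
  by (intro Limsup_compose_continuous_mono continuous_ennreal_powr monoI ennreal_powr_mono) auto

lemma Q_bregman_powr: "ennreal_powr (Q_bregman U F r h) p = ennreal limit_const * emeasure limit_measure UNIV"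
proof -
  have s: "real CARD('n) / (real CARD('n) + r) = p" using r by (simp add: p q field_simps)
  have UNIVb: "(UNIV :: (real^'n) set) \<in> sets borel" by simp
  have "Q_bregman U F r h = ennreal (2 powr (- r / 2)) * ennreal Q * ennreal_powr (emeasure limit_measure UNIV) (1 / p)"
    unfolding Q_bregman_def Let_def s Q(1) emeasure_limit_measure[OF UNIVb] by simp
  then show ?thesis
    using p_gt0 Q(2) by (simp add: ennreal_powr_mult ennreal_powr_powr limit_const_def powr_mult ennreal_mult mult.commute)
qed

lemma rate_inf_lower: "Q_bregman U F r h \<le> rate_inf q (opt_cost bcost U P U)"
proof -
  have "ennreal_powr (Q_bregman U F r h) p \<le> ennreal_powr (rate_inf q (opt_cost bcost U P U)) p"
    using lower_bound by (simp add: Q_bregman_powr lower_rate_def)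
  then show ?thesis using p_gt0 by (simp add: ennreal_powr_le_iff ennreal_powr_powr)
qed

lemma rate_sup_upper:
  assumes V: "open V" "convex V" "V \<subseteq> U" "V \<noteq> {}" "- V \<in> null_sets P"
    and H: "\<And>x v. x \<in> V \<Longrightarrow> v \<bullet> (hessian F x *v v) \<le> C * (norm v)\<^sup>2" and C: "0 \<le> C"
    and \<delta>: "0 < \<delta>" and mom: "(\<integral>\<^sup>+\<xi>\<in>V. ennreal ((1 + norm \<xi>) powr (r * (1 + \<delta>))) \<partial>P) < \<infinity>"
  shows "rate_sup q (opt_cost bcost U P U) \<le> Q_bregman U F r h"
proof -
  have "ennreal_powr (rate_sup q (opt_cost bcost U P U)) p \<le> ennreal_powr (rate_sup q (opt_cost bcost V P V)) p"
    using p_gt0 opt_cost_restrict[OF V(3,5)] by (intro ennreal_powr_mono rate_sup_mono) auto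
  also have "\<dots> \<le> ennreal limit_const * emeasure limit_measure V" by (rule upper_bound[OF V(1-4) H C \<delta> mom])
  also have "\<dots> \<le> ennreal limit_const * emeasure limit_measure UNIV" by (intro mult_left_mono emeasure_mono) (auto simp: sets_limit_measure)
  also have "\<dots> = ennreal_powr (Q_bregman U F r h) p" by (simp add: Q_bregman_powr)
  finally show ?thesis using p_gt0 by (simp add: ennreal_powr_le_iff ennreal_powr_powr)
qed

end

theorem theorem4p1:
  fixes U :: "(real^'n) set" and F :: "real^'n \<Rightarrow> real" and r :: real
    and P :: "(real^'n) measure" and h :: "real^'n \<Rightarrow> ennreal"
  assumes "0 < r"
    and "U \<noteq> {}" and "open U" and "convex U"
    and "C2_on U F" and "strictly_convex_on U F"
    and "\<And>x. x \<in> U \<Longrightarrow> sym_pos_def (hessian F x)"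
    and "prob_space P" and "sets P = sets borel" and "emeasure P U = 1"
    and "ac_density P h"
  shows
    "((\<exists>\<delta>>0. (\<integral>\<^sup>+\<xi>\<in>U. ennreal (max (norm \<xi> powr (2 * (1 + \<delta>))) \<bar>F \<xi>\<bar> powr (r / 2)) \<partial>P) < \<infinity>) \<and>
      ((compact (supp P) \<and> supp P \<subseteq> U) \<or>
       (\<exists>\<eta>\<ge>0. supp P \<inter> U \<subseteq> inner_part U \<eta> \<and>
          bdd_above ((\<lambda>x. onorm ((*v) (hessian F x))) ` inner_part U \<eta>)))
      \<longrightarrow>
      ((\<lambda>n. ennreal (real n powr (1 / CARD('n))) * opt_quant_err U F r P n)
         \<longlonglongrightarrow> ennreal_powr (Q_bregman U F r h) (1 / r)))
     \<and>
     ennreal_powr (Q_bregman U F r h) (1 / r)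
       \<le> liminf (\<lambda>n. ennreal (real n powr (1 / CARD('n))) * opt_quant_err U F r P n)"
proof -
  interpret P: prob_space P by fact
  define q where "q = r / real CARD('n)"
  define p where "p = 1 / (1 + q)"
  define Q where "Q = enn2real (zador_const TYPE('n) r)"
  interpret bregman_quantization U F r P h q p Q
  proof (rule bregman_quantization.intro)
    show "zador_const TYPE('n) r = ennreal Q" "0 \<le> Q"
      using zador_const_finite[OF assms(1), where 'n = 'n] by (auto simp: Q_def)
    show "finite_measure P" by (rule P.finite_measure_axioms)
  qed (use assms in \<open>auto simp: q_def p_def\<close>)
  have lower: "ennreal_powr (Q_bregman U F r h) (1 / r)
       \<le> liminf (\<lambda>n. ennreal (real n powr (1 / CARD('n))) * opt_quant_err U F r P n)"
    unfolding liminf_scaled_error using assms(1) by (intro ennreal_powr_mono rate_inf_lower) auto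
  have UNIV_P: "space P = UNIV" using sets_eq_imp_space_eq[OF assms(9)] by simp
  have PU: "- U \<in> null_sets P"
  proof -
    have "emeasure P (space P - U) = emeasure P (space P) - emeasure P U"
      using assms by (intro emeasure_compl) auto
    then have "emeasure P (- U) = 0" using assms(10) by (simp add: UNIV_P P.emeasure_space_1[unfolded UNIV_P] Compl_eq_Diff_UNIV)
    then show ?thesis using assms by (auto simp: null_sets_def)
  qed
  show ?thesis
  proof (intro conjI impI lower)
    assume a: "(\<exists>\<delta>>0. (\<integral>\<^sup>+\<xi>\<in>U. ennreal (max (norm \<xi> powr (2 * (1 + \<delta>))) \<bar>F \<xi>\<bar> powr (r / 2)) \<partial>P) < \<infinity>) \<and>
      ((compact (supp P) \<and> supp P \<subseteq> U) \<or>
       (\<exists>\<eta>\<ge>0. supp P \<inter> U \<subseteq> inner_part U \<eta> \<and>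
          bdd_above ((\<lambda>x. onorm ((*v) (hessian F x))) ` inner_part U \<eta>)))"
    then obtain \<delta> where \<delta>: "0 < \<delta>"
      "(\<integral>\<^sup>+\<xi>\<in>U. ennreal (max (norm \<xi> powr (2 * (1 + \<delta>))) \<bar>F \<xi>\<bar> powr (r / 2)) \<partial>P) < \<infinity>" by blast
    have "emeasure P UNIV \<noteq> 0" using P.emeasure_space_1 by (simp add: UNIV_P)
    from bounded_hessian_domain[OF PU this conjunct2[OF a]] obtain V C where
      V: "open V" "convex V" "V \<subseteq> U" "V \<noteq> {}" "- V \<in> null_sets P" and C: "0 \<le> C"
      "\<And>x v. x \<in> V \<Longrightarrow> v \<bullet> (hessian F x *v v) \<le> C * (norm v)\<^sup>2" by blast
    have "rate_sup q (opt_cost bcost U P U) \<le> Q_bregman U F r h"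
      using V by (intro rate_sup_upper[OF V C(2,1) \<delta>(1)] moment_bound[OF \<delta>(1) _ _ \<delta>(2)]) auto
    then have "limsup (\<lambda>n. ennreal (real n powr (1 / CARD('n))) * opt_quant_err U F r P n)
        \<le> ennreal_powr (Q_bregman U F r h) (1 / r)"
      unfolding limsup_scaled_error using assms(1) by (intro ennreal_powr_mono) auto
    with lower Liminf_le_Limsup[of sequentially "\<lambda>n. ennreal (real n powr (1 / CARD('n))) * opt_quant_err U F r P n"]
    show "(\<lambda>n. ennreal (real n powr (1 / CARD('n))) * opt_quant_err U F r P n)
         \<longlonglongrightarrow> ennreal_powr (Q_bregman U F r h) (1 / r)"
      by (subst tendsto_iff_Liminf_eq_Limsup) (auto intro: antisym order_trans)
  qed
qed

end
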